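(* (1) Let $H$ be a braided unital algebra and $V$ a braided left $H$-module with action $\nu_L:H\otimes V\to V$ (and braiding $\Psi_{HV}$). Let $U\subset H'$ and $W\subset V'$ be non-degenerate subspaces such that $\Psi_{UU}$, $\Psi_{HW}^\circ$, $\Psi_{UV}^\circ$ and $\Psi_{WU}^\bullet$ are bijective. Assume that $\underline\Delta^{\circ}(f)\in U\otimes U$ for all $f\in U$, where $\langle\langle\underline\Delta^\circ(f),a\otimes b\rangle\rangle:=f\big(m(\Psi_{HH}^{-1}(a\otimes b))\big)$ for $a,b\in H$, so that $(U,\underline\Delta^\circ,\varepsilon)$ with $\varepsilon(f):=f(1)$ is a coalgebra. Consider the linear map $\rho_L:W\to(H\otimes V)'$, $\rho_L(e)(a\otimes v):=e\big(\nu_L(\Psi_{HV}^{-1}(v\otimes a))\big)$. If $\rho_L(W)\subset U\otimes W\subset(H\otimes V)'$, then $\rho_L$ is a left $U$-coaction on $W$ making $W$ a braided left $U$-comodule with respect to the coalgebra $(U,\underline\Delta^\circ,\varepsilon)$, the braiding $\Psi_{UU}^{-1}$ on $U$ and the braiding $\Psi_{WU}^\bullet$ between $W$ and $U$. (2) Let $H$ be a braided unital algebra and $V$ a braided right $H$-module with action $\nu_R:V\otimes H\to V$ (and braiding $\Psi_{VH}$). Let $U\subset H'$ and $W\subset V'$ be non-degenerate subspaces such that $\Psi_{UU}$, $\Psi_{WH}^\circ$, $\Psi_{VU}^\circ$ and $\Psi_{UW}^\bullet$ are bijective, and assume again that $\underline\Delta^\circ(U)\subset U\otimes U$. If the linear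 map $\rho_R:W\to(V\otimes H)'$, $\rho_R(e)(v\otimes a):=e\big(\nu_R(\Psi_{VH}^{-1}(a\otimes v))\big)$, satisfies $\rho_R(W)\subset W\otimes U\subset(V\otimes H)'$, then $\rho_R$ is a right $U$-coaction on $W$ making $W$ a braided right $U$-comodule with respect to the coalgebra $(U,\underline\Delta^\circ,\varepsilon)$, the braiding $\Psi_{UU}^{-1}$ on $U$ and the braiding $\Psi_{UW}^\bullet$ between $U$ and $W$.
   Context: All vector spaces are over a fixed field $\mathbb K$, $\otimes$ is the algebraic tensor product, $X'$ is the full linear dual of $X$, and composition of maps is written by juxtaposition. A braiding on $V$ is a bijective linear map $\Psi_{VV}:V\otimes V\to V\otimes V$ with $(\Psi_{VV}\otimes\mathrm{id})(\mathrm{id}\otimes\Psi_{VV})(\Psi_{VV}\otimes\mathrm{id})=(\mathrm{id}\otimes\Psi_{VV})(\Psi_{VV}\otimes\mathrm{id})(\mathrm{id}\otimes\Psi_{VV})$; $V$ is then a braided vector space. Let $\Psi_{VW}:V\otimes W\to W\otimes V$ be bijective and linear. If $V$ is braided, $W$ is a left $V$-braided vector space if $(\Psi_{VW}\otimes\mathrm{id})(\mathrm{id}\otimes\Psi_{VW})(\Psi_{VV}\otimes\mathrm{id})=(\mathrm{id}\otimes\Psi_{VV})(\Psi_{VW}\otimes\mathrm{id})(\mathrm{id}\otimes\Psi_{VW})$. If $W$ is braided, $V$ is a right $W$-braided vector space if $(\mathrm{id}\otimes\Psi_{VW})(\Psi_{VW}\otimes\mathrm{id})(\mathrm{id}\otimes\Psi_{WW})=(\Psi_{WW}\otimes\mathrm{id})(\mathrm{id}\otimes\Psi_{VW})(\Psi_{VW}\otimes\mathrm{id})$.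 Compatibility of $\Psi=\Psi_{VW}$: with the multiplication of an algebra $V$: $\Psi(m_V\otimes\mathrm{id})=(\mathrm{id}\otimes m_V)(\Psi\otimes\mathrm{id})(\mathrm{id}\otimes\Psi)$ and $\Psi(1\otimes w)=w\otimes1$ if $1\in V$; with the multiplication of an algebra $W$: $\Psi(\mathrm{id}\otimes m_W)=(m_W\otimes\mathrm{id})(\mathrm{id}\otimes\Psi)(\Psi\otimes\mathrm{id})$ and $\Psi(v\otimes1)=1\otimes v$ if $1\in W$; with the comultiplication of a coalgebra $V$: $(\mathrm{id}\otimes\Delta)\Psi=(\Psi\otimes\mathrm{id})(\mathrm{id}\otimes\Psi)(\Delta\otimes\mathrm{id})$ and $(\mathrm{id}\otimes\varepsilon)\Psi=\varepsilon\otimes\mathrm{id}$; with the comultiplication of a coalgebra $W$: $(\Delta\otimes\mathrm{id})\Psi=(\mathrm{id}\otimes\Psi)(\Psi\otimes\mathrm{id})(\mathrm{id}\otimes\Delta)$ and $(\varepsilon\otimes\mathrm{id})\Psi=\mathrm{id}\otimes\varepsilon$. A braided (co)algebra is a (co)algebra with a braiding satisfying both compatibility conditions with its (co)multiplication. Braided modules over a braided unital algebra $(A,m)$: a braided left $A$-module is a left $A$-braided vector space $W$ with $\Psi_{AW}$ compatible with $m$ and a map $\nu_L:A\otimes W\to W$ with $\nu_L(\mathrm{id}\otimes\nu_L)=\nu_L(m\otimes\mathrm{id})$, $\nu_L(1\otimes w)=w$, $\Psi_{AW}(\mathrm{id}\otimes\nu_L)=(\nu_L\otimes\mathrm{id})(\mathrm{id}\otimes\Psi_{AW})(\Psi_{AA}\otimes\mathrm{id})$.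 A braided right $A$-module is a right $A$-braided vector space $V$ with $\Psi_{VA}$ compatible with $m$ and $\nu_R:V\otimes A\to V$ with $\nu_R(\nu_R\otimes\mathrm{id})=\nu_R(\mathrm{id}\otimes m)$, $\nu_R(v\otimes1)=v$, $\Psi_{VA}(\nu_R\otimes\mathrm{id})=(\mathrm{id}\otimes\nu_R)(\Psi_{VA}\otimes\mathrm{id})(\mathrm{id}\otimes\Psi_{AA})$. Braided comodules over a braided coalgebra $H$: a braided right $H$-comodule is a left $H$-braided vector space $V$ with $\Psi_{HV}:H\otimes V\to V\otimes H$ compatible with the comultiplication of $H$ and $\rho_R:V\to V\otimes H$ with $(\rho_R\otimes\mathrm{id})\rho_R=(\mathrm{id}\otimes\Delta)\rho_R$, $(\mathrm{id}\otimes\varepsilon)\rho_R=\mathrm{id}$, $(\rho_R\otimes\mathrm{id})\Psi_{HV}=(\mathrm{id}\otimes\Psi_{HH})(\Psi_{HV}\otimes\mathrm{id})(\mathrm{id}\otimes\rho_R)$. A braided left $H$-comodule is a right $H$-braided vector space $V$ with $\Psi_{VH}:V\otimes H\to H\otimes V$ compatible with the comultiplication of $H$ and $\rho_L:V\to H\otimes V$ with $(\mathrm{id}\otimes\rho_L)\rho_L=(\Delta\otimes\mathrm{id})\rho_L$, $(\varepsilon\otimes\mathrm{id})\rho_L=\mathrm{id}$, $(\mathrm{id}\otimes\rho_L)\Psi_{VH}=(\Psi_{HH}\otimes\mathrm{id})(\mathrm{id}\otimes\Psi_{VH})(\rho_L\otimes\mathrm{id})$. Duality notation: $\langle f,a\rangle=\langle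 a,f\rangle=f(a)$. A subspace of $X'$ is non-degenerate if it separates the points of $X$. $\langle\langle\xi\otimes\eta,x\otimes y\rangle\rangle:=\langle\xi,y\rangle\langle\eta,x\rangle$. "$\underline\Delta^\circ(f)\in U\otimes U$" means that there is $t\in U\otimes U$ (then denoted $\underline\Delta^\circ(f)$) with $\langle\langle t,a\otimes b\rangle\rangle=f(m\Psi_{HH}^{-1}(a\otimes b))$ for all $a,b$. In all other places tensor products are embedded into duals by $(\xi\otimes\eta)(x\otimes y)=\langle\xi,x\rangle\langle\eta,y\rangle$. Define, for $a,b\in H$, $v\in V$ and functionals $f,g$ on $H$, $e$ on $V$: $\Psi_{UU}(f\otimes g)(b\otimes a):=\langle\langle f\otimes g,\Psi_{HH}(a\otimes b)\rangle\rangle$ (values in $(H\otimes H)'\supset U\otimes U$); for $V$ left $H$-braided: $\Psi_{HW}^\circ(a\otimes e)(v\otimes f):=\langle\langle e\otimes f,\Psi_{HV}^{-1}(v\otimes a)\rangle\rangle$, $e\in W$, $f\in H'$ (values in $(V\otimes H')'\supset W\otimes H$); $\Psi_{UV}^\circ(f\otimes v)(e\otimes a):=\langle\langle e\otimes f,\Psi_{HV}^{-1}(v\otimes a)\rangle\rangle$, $f\in U$, $e\in V'$ (values in $(V'\otimes H)'\supset V\otimes U$); $\Psi_{WU}^\bullet(e\otimes f)(a\otimes v):=\langle\langle a\otimes e,\Psi_{UV}^\circ(f\otimes v)\rangle\rangle$, $e\in W$, $f\in U$ (values in $(H\otimes V)'\supset U\otimes W$); for $V$ right $H$-braided: $\Psi_{WH}^\circ(e\otimes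 a)(f\otimes v):=\langle\langle f\otimes e,\Psi_{VH}^{-1}(a\otimes v)\rangle\rangle$, $e\in W$, $f\in H'$ (values in $(H'\otimes V)'\supset H\otimes W$); $\Psi_{VU}^\circ(v\otimes f)(a\otimes e):=\langle\langle f\otimes e,\Psi_{VH}^{-1}(a\otimes v)\rangle\rangle$, $f\in U$, $e\in V'$ (values in $(H\otimes V')'\supset U\otimes V$); $\Psi_{UW}^\bullet(f\otimes e)(v\otimes a):=\langle\langle e\otimes a,\Psi_{VU}^\circ(v\otimes f)\rangle\rangle$, $e\in W$, $f\in U$ (values in $(V\otimes H)'\supset W\otimes U$). Such a map $\Psi_{XY}$ is called bijective if it is a bijection $X\otimes Y\to Y\otimes X$. *)

theory Defs
  imports Complex_Main "HOL-Library.Function_Algebras"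
begin

section \<open>Vector spaces with a carrier\<close>

text \<open>
  A vector space over the field of type \<open>'k\<close> is a linear subspace (the carrier) of a type
  carrying a \<open>vector_space\<close> structure.  In this way a space, its dual, the subspaces of
  the dual, and all their tensor products are treated uniformly.  Maps between vector spaces are HOL
  functions of which only the values on the carrier matter.
\<close>

record ('k, 'a) vs =
  carrier :: "'a set"
  smul :: "'k \<Rightarrow> 'a \<Rightarrow> 'a"

definition vspace :: "('k::field, 'a::ab_group_add) vs \<Rightarrow> bool" where
  "vspace V \<longleftrightarrow> vector_space (smul V) \<and> module.subspace (smul V) (carrier V)"

definition linear_map ::
  "('k::field, 'a::ab_group_add) vs \<Rightarrow> ('k, 'b::ab_group_add) vs \<Rightarrow> ('a \<Rightarrow> 'b) \<Rightarrow> bool" where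
  "linear_map V W f \<longleftrightarrow>
     (\<forall>x\<in>carrier V. f x \<in> carrier W) \<and>
     (\<forall>x\<in>carrier V. \<forall>y\<in>carrier V. f (x + y) = f x + f y) \<and>
     (\<forall>c. \<forall>x\<in>carrier V. f (smul V c x) = smul W c (f x))"

definition linear_iso ::
  "('k::field, 'a::ab_group_add) vs \<Rightarrow> ('k, 'b::ab_group_add) vs \<Rightarrow> ('a \<Rightarrow> 'b) \<Rightarrow> bool" where
  "linear_iso V W f \<longleftrightarrow> linear_map V W f \<and> bij_betw f (carrier V) (carrier W)"

definition bilinear_map ::
  "('k::field, 'a::ab_group_add) vs \<Rightarrow> ('k, 'b::ab_group_add) vs \<Rightarrow> ('k, 'c::ab_group_add) vs
     \<Rightarrow> ('a \<Rightarrow> 'b \<Rightarrow> 'c) \<Rightarrow> bool" where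
  "bilinear_map V W Z \<phi> \<longleftrightarrow>
     (\<forall>a\<in>carrier V. linear_map W Z (\<phi> a)) \<and> (\<forall>b\<in>carrier W. linear_map V Z (\<lambda>a. \<phi> a b))"

definition ground :: "('k::field, 'k) vs" where
  "ground = \<lparr>carrier = UNIV, smul = (*)\<rparr>"

definition fscale :: "'k::field \<Rightarrow> ('x \<Rightarrow> 'k) \<Rightarrow> 'x \<Rightarrow> 'k" where
  "fscale c f = (\<lambda>x. c * f x)"

text \<open>The full linear dual.  Functionals are normalised to vanish off the carrier, so that
  equality of functionals is equality of functions.\<close>

definition dual :: "('k::field, 'a::ab_group_add) vs \<Rightarrow> ('k, 'a \<Rightarrow> 'k) vs" where
  "dual V = \<lparr>carrier = {f. linear_map V ground f \<and> (\<forall>x. x \<notin> carrier V \<longrightarrow> f x = 0)},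
             smul = fscale\<rparr>"

section \<open>The algebraic tensor product\<close>

text \<open>
  The tensor product is realised inside the dual of the space of bilinear forms: \<open>a \<otimes> b\<close> is
  evaluation of bilinear forms at \<open>(a, b)\<close>, and the tensor product is the span of these.  Over a
  field this is the algebraic tensor product; \<open>tensor_universal\<close> below proves the universal
  property.
\<close>

definition pure_tensor ::
  "'a::ab_group_add \<Rightarrow> ('k::field, 'a) vs \<Rightarrow> ('k, 'b::ab_group_add) vs \<Rightarrow> 'b \<Rightarrow> ('a \<Rightarrow> 'b \<Rightarrow> 'k) \<Rightarrow> 'k"
  ("(_ \<otimes>\<^bsub>_,_\<^esub>/ _)" [71, 0, 0, 71] 70) where
  "a \<otimes>\<^bsub>V,W\<^esub> b = (\<lambda>\<beta>. if bilinear_map V W ground \<beta> then \<beta> a b else 0)"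

definition tensor ::
  "('k::field, 'a::ab_group_add) vs \<Rightarrow> ('k, 'b::ab_group_add) vs \<Rightarrow> ('k, ('a \<Rightarrow> 'b \<Rightarrow> 'k) \<Rightarrow> 'k) vs"
  (infixr "\<otimes>" 70) where
  "V \<otimes> W = \<lparr>carrier = module.span fscale {a \<otimes>\<^bsub>V,W\<^esub> b | a b. a \<in> carrier V \<and> b \<in> carrier W},
            smul = fscale\<rparr>"

text \<open>The linear map on \<open>V \<otimes> W\<close> induced by a bilinear map, extended by 0 off the carrier.\<close>

definition tlift ::
  "('k::field, 'a::ab_group_add) vs \<Rightarrow> ('k, 'b::ab_group_add) vs \<Rightarrow> ('k, 'c::ab_group_add) vs
     \<Rightarrow> ('a \<Rightarrow> 'b \<Rightarrow> 'c) \<Rightarrow> (('a \<Rightarrow> 'b \<Rightarrow> 'k) \<Rightarrow> 'k) \<Rightarrow> 'c" where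
  "tlift V W Z \<phi> = (THE L. linear_map (V \<otimes> W) Z L \<and>
     (\<forall>a\<in>carrier V. \<forall>b\<in>carrier W. L (a \<otimes>\<^bsub>V,W\<^esub> b) = \<phi> a b) \<and>
     (\<forall>t. t \<notin> carrier (V \<otimes> W) \<longrightarrow> L t = 0))"

lemma vector_space_fscale: "vector_space (fscale :: 'k::field \<Rightarrow> ('x \<Rightarrow> 'k) \<Rightarrow> 'x \<Rightarrow> 'k)"
  by unfold_locales (auto simp: fscale_def fun_eq_iff algebra_simps)

lemma module_fscale: "module (fscale :: 'k::field \<Rightarrow> ('x \<Rightarrow> 'k) \<Rightarrow> 'x \<Rightarrow> 'k)"
  by unfold_locales (auto simp: fscale_def fun_eq_iff algebra_simps)

lemma vspace_tensor: "vspace (V \<otimes> W)"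
  unfolding vspace_def tensor_def
  by (simp add: vector_space_fscale module.subspace_span[OF module_fscale])

lemma vspaceD:
  assumes "vspace V"
  shows "vector_space (smul V)" "module (smul V)" "0 \<in> carrier V"
    "x \<in> carrier V \<Longrightarrow> y \<in> carrier V \<Longrightarrow> x + y \<in> carrier V"
    "x \<in> carrier V \<Longrightarrow> smul V c x \<in> carrier V"
proof -
  show vs: "vector_space (smul V)" using assms by (simp add: vspace_def)
  show m: "module (smul V)" using vs by (simp add: module_iff_vector_space)
  have s: "module.subspace (smul V) (carrier V)" using assms by (simp add: vspace_def)
  show "0 \<in> carrier V" by (rule module.subspace_0[OF m s])
  show "x \<in> carrier V \<Longrightarrow> y \<in> carrier V \<Longrightarrow> x + y \<in> carrier V" by (rule module.subspace_add[OF m s])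
  show "x \<in> carrier V \<Longrightarrow> smul V c x \<in> carrier V" by (rule module.subspace_scale[OF m s])
qed

lemma separating_functional:
  assumes Z: "vspace (Z :: ('k::field, 'c::ab_group_add) vs)" and z: "z \<noteq> 0"
  shows "\<exists>\<zeta>. linear_map Z ground \<zeta> \<and> \<zeta> z \<noteq> 0"
proof -
  interpret p: vector_space_pair "smul Z" "(*) :: 'k \<Rightarrow> 'k \<Rightarrow> 'k"
    by (rule vector_space_pair.intro[OF vspaceD(1)[OF Z]])
       (unfold_locales, auto simp: algebra_simps)
  have "p.vs1.independent {z}" using z by simp
  then obtain g where g: "Vector_Spaces.linear (smul Z) (*) g" "g z = 1"
    using p.linear_independent_extend[of "{z}" "\<lambda>_. 1"] by auto
  interpret g: Vector_Spaces.linear "smul Z" "(*)" g by (rule g)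
  show ?thesis
    using g(2) g.add g.scale by (intro exI[of _ g]) (auto simp: linear_map_def ground_def)
qed

lemma bilinear_pure_tensor:
  assumes "vspace V" "vspace W"
  shows "bilinear_map V W (V \<otimes> W) (\<lambda>a b. a \<otimes>\<^bsub>V,W\<^esub> b)"
proof -
  have 1: "a \<otimes>\<^bsub>V,W\<^esub> b \<in> carrier (V \<otimes> W)" if "a \<in> carrier V" "b \<in> carrier W" for a b
    unfolding tensor_def using that by (auto intro!: module.span_base[OF module_fscale])
  show ?thesis
    unfolding bilinear_map_def[of V W "V \<otimes> W"] linear_map_def
    using 1 by (auto simp: tensor_def pure_tensor_def bilinear_map_def linear_map_def
        fscale_def ground_def fun_eq_iff)
qed

inductive induced_graph for V W Z \<phi> where
  zero: "induced_graph V W Z \<phi> 0 0"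
| add: "induced_graph V W Z \<phi> t z \<Longrightarrow> a \<in> carrier V \<Longrightarrow> b \<in> carrier W \<Longrightarrow>
    induced_graph V W Z \<phi> (fscale c (a \<otimes>\<^bsub>V,W\<^esub> b) + t) (smul Z c (\<phi> a b) + z)"

theorem tensor_universal:
  fixes V :: "('k::field, 'a::ab_group_add) vs" and W :: "('k, 'b::ab_group_add) vs"
    and Z :: "('k, 'c::ab_group_add) vs"
  assumes V: "vspace V" and W: "vspace W" and Z: "vspace Z" and \<phi>: "bilinear_map V W Z \<phi>"
  shows "\<exists>!L. linear_map (V \<otimes> W) Z L \<and>
     (\<forall>a\<in>carrier V. \<forall>b\<in>carrier W. L (a \<otimes>\<^bsub>V,W\<^esub> b) = \<phi> a b) \<and>
     (\<forall>t. t \<notin> carrier (V \<otimes> W) \<longrightarrow> L t = 0)"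
proof -
  let ?P = "{a \<otimes>\<^bsub>V,W\<^esub> b | a b. a \<in> carrier V \<and> b \<in> carrier W}"
  let ?G = "induced_graph V W Z \<phi>"
  interpret T: vector_space "fscale :: 'k \<Rightarrow> (('a \<Rightarrow> 'b \<Rightarrow> 'k) \<Rightarrow> 'k) \<Rightarrow> _" by (rule vector_space_fscale)
  interpret z: vector_space "smul Z" by (rule vspaceD[OF Z])
  have carr: "carrier (V \<otimes> W) = T.span ?P" and sm: "smul (V \<otimes> W) = fscale"
    by (simp_all add: tensor_def)
  have \<phi>Z: "\<phi> a b \<in> carrier Z" if "a \<in> carrier V" "b \<in> carrier W" for a b
    using \<phi> that by (auto simp: bilinear_map_def linear_map_def)
  have GZ: "z \<in> carrier Z" if "?G t z" for t z
    using that by induction (auto intro: vspaceD[OF Z] \<phi>Z)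
  have Gtotal: "\<exists>z. ?G t z" if "t \<in> carrier (V \<otimes> W)" for t
  proof (rule T.span_induct_alt[of t ?P "\<lambda>t. \<exists>z. ?G t z"])
    show "t \<in> T.span ?P" using that by (simp only: carr)
    show "\<exists>z. ?G 0 z" by (blast intro: induced_graph.zero)
    show "\<exists>z. ?G (fscale c x + y) z" if "x \<in> ?P" "\<exists>z. ?G y z" for c x y
      using that by (blast intro: induced_graph.add)
  qed
  have Gadd: "?G (s + t) (y + z)" if "?G s y" "?G t z" for s t y z
    using that by induction (auto simp: add.assoc intro: induced_graph.intros)
  have Gscale: "?G (fscale c t) (smul Z c z)" if "?G t z" for c t z
    using that
  proof induction
    case zero
    show ?case by (simp only: T.scale_zero_right z.scale_zero_right induced_graph.zero)
  next
    case (add t z a b d)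
    then show ?case
      using induced_graph.add[OF add.IH add.hyps(2,3), of "c * d"]
      by (simp only: T.scale_right_distrib z.scale_right_distrib T.scale_scale z.scale_scale)
  qed
  have Geval: "t (\<lambda>a b. \<zeta> (\<phi> a b)) = \<zeta> z" if "?G t z" and \<zeta>: "linear_map Z ground \<zeta>" for t z \<zeta>
  proof -
    have b: "bilinear_map V W ground (\<lambda>a b. \<zeta> (\<phi> a b))"
      using \<phi> \<zeta> by (auto simp: bilinear_map_def linear_map_def ground_def)
    have \<zeta>0: "\<zeta> 0 = 0"
    proof -
      have "\<zeta> (0 + 0) = \<zeta> 0 + \<zeta> 0" using \<zeta> vspaceD(3)[OF Z] unfolding linear_map_def by blast
      then show ?thesis by (metis add.right_neutral add_left_imp_eq)
    qed
    show ?thesis using that(1)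
    proof induction
      case zero then show ?case by (simp add: \<zeta>0)
    next
      case (add t z a b' c)
      have "\<zeta> (smul Z c (\<phi> a b') + z) = \<zeta> (smul Z c (\<phi> a b')) + \<zeta> z"
        using \<zeta> vspaceD(5)[OF Z \<phi>Z[OF add.hyps(2,3)]] GZ[OF add.hyps(1)]
        unfolding linear_map_def by blast
      moreover have "\<zeta> (smul Z c (\<phi> a b')) = c * \<zeta> (\<phi> a b')"
        using \<zeta> \<phi>Z[OF add.hyps(2,3)] unfolding linear_map_def by (simp add: ground_def)
      ultimately show ?case using add.IH b by (simp add: pure_tensor_def fscale_def)
    qed
  qed
  have G0: "z = 0" if "?G 0 z" for z
  proof (rule ccontr)
    assume "z \<noteq> 0"
    then obtain \<zeta> where "linear_map Z ground \<zeta>" "\<zeta> z \<noteq> 0" using separating_functional[OF Z] by blast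
    then show False using Geval[OF that] by simp
  qed
  have Guniq: "y = z" if "?G t y" "?G t z" for t y z
    using G0[of "y + smul Z (-1) z"] Gadd[OF that(1) Gscale[OF that(2), of "-1"]] by simp
  define L where "L t = (if t \<in> carrier (V \<otimes> W) then THE z. ?G t z else 0)" for t
  have LG: "?G t (L t)" if "t \<in> carrier (V \<otimes> W)" for t
    using that Gtotal[OF that] Guniq unfolding L_def by (auto intro: theI2)
  have Leq: "L t = z" if "t \<in> carrier (V \<otimes> W)" "?G t z" for t z
    using LG[OF that(1)] that(2) Guniq by blast
  note VW = vspaceD[OF vspace_tensor[of V W]]
  show ?thesis
  proof (rule ex1I[of _ L], intro conjI ballI allI impI)
    show "linear_map (V \<otimes> W) Z L"
      unfolding linear_map_def
    proof (intro conjI ballI allI)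
      show "L x \<in> carrier Z" if "x \<in> carrier (V \<otimes> W)" for x by (rule GZ[OF LG[OF that]])
      show "L (x + y) = L x + L y" if "x \<in> carrier (V \<otimes> W)" "y \<in> carrier (V \<otimes> W)" for x y
        by (rule Leq[OF VW(4)[OF that] Gadd[OF LG LG]]) (use that in auto)
      show "L (smul (V \<otimes> W) c x) = smul Z c (L x)" if "x \<in> carrier (V \<otimes> W)" for c x
        using Leq[OF VW(5)[OF that]] Gscale[OF LG[OF that]] by (simp add: sm)
    qed
    fix a b assume ab: "a \<in> carrier V" "b \<in> carrier W"
    have "?G (a \<otimes>\<^bsub>V,W\<^esub> b) (\<phi> a b)"
      using induced_graph.add[OF induced_graph.zero ab, where c = 1 and Z = Z and \<phi> = \<phi>] by simp
    moreover have "a \<otimes>\<^bsub>V,W\<^esub> b \<in> carrier (V \<otimes> W)"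
      using ab unfolding carr by (auto intro: T.span_base)
    ultimately show "L (a \<otimes>\<^bsub>V,W\<^esub> b) = \<phi> a b" by (rule Leq[rotated])
  next
    show "L t = 0" if "t \<notin> carrier (V \<otimes> W)" for t using that by (simp add: L_def)
  next
    fix M
    assume M: "linear_map (V \<otimes> W) Z M \<and>
      (\<forall>a\<in>carrier V. \<forall>b\<in>carrier W. M (a \<otimes>\<^bsub>V,W\<^esub> b) = \<phi> a b) \<and>
      (\<forall>t. t \<notin> carrier (V \<otimes> W) \<longrightarrow> M t = 0)"
    have MG: "t \<in> carrier (V \<otimes> W) \<and> M t = z" if "?G t z" for t z
      using that
    proof induction
      case zero
      have "M (fscale 0 0) = smul Z 0 (M 0)"
        using M VW(3) unfolding linear_map_def sm by blast
      then have "M 0 = 0" by (simp only: T.scale_zero_right z.scale_zero_left)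
      then show ?case using VW(3) by blast
    next
      case (add t z a b c)
      let ?p = "a \<otimes>\<^bsub>V,W\<^esub> b"
      have p: "?p \<in> carrier (V \<otimes> W)"
        using add.hyps unfolding carr by (auto intro: T.span_base)
      have cp: "fscale c ?p \<in> carrier (V \<otimes> W)" using VW(5)[OF p] by (simp add: sm)
      have "M (fscale c ?p + t) = M (fscale c ?p) + M t"
        using M cp add.IH unfolding linear_map_def by blast
      moreover have "M (fscale c ?p) = smul Z c (M ?p)"
        using M p unfolding linear_map_def sm by blast
      moreover have "M ?p = \<phi> a b" using M add.hyps by blast
      moreover have "fscale c ?p + t \<in> carrier (V \<otimes> W)" using VW(4)[OF cp] add.IH by blast
      ultimately show ?case using add.IH by (simp only: conj_absorb simp_thms)
    qed
    show "M = L"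
    proof
      fix t show "M t = L t"
        using M MG[OF LG, of t] by (cases "t \<in> carrier (V \<otimes> W)") (auto simp: L_def)
    qed
  qed
qed

section \<open>Maps between tensor products\<close>

definition tmap ::
  "('k::field, 'a::ab_group_add) vs \<Rightarrow> ('k, 'b::ab_group_add) vs \<Rightarrow> ('k, 'c::ab_group_add) vs
     \<Rightarrow> ('k, 'd::ab_group_add) vs \<Rightarrow> ('a \<Rightarrow> 'c) \<Rightarrow> ('b \<Rightarrow> 'd)
     \<Rightarrow> (('a \<Rightarrow> 'b \<Rightarrow> 'k) \<Rightarrow> 'k) \<Rightarrow> ('c \<Rightarrow> 'd \<Rightarrow> 'k) \<Rightarrow> 'k" where
  "tmap V W X Y f g = tlift V W (X \<otimes> Y) (\<lambda>a b. f a \<otimes>\<^bsub>X,Y\<^esub> g b)"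

text \<open>\<open>map_id X Y A f = f \<otimes> id : X \<otimes> A \<rightarrow> Y \<otimes> A\<close> and
  \<open>id_map A X Y f = id \<otimes> f : A \<otimes> X \<rightarrow> A \<otimes> Y\<close>.\<close>

definition "map_id X Y A f = tmap X A Y A f (\<lambda>a. a)"
definition "id_map A X Y f = tmap A X A Y (\<lambda>a. a) f"

text \<open>\<open>assoc X Y Z : (X \<otimes> Y) \<otimes> Z \<rightarrow> X \<otimes> (Y \<otimes> Z)\<close>, and \<open>unassoc\<close> in the
  other direction.  Threefold tensor products are nested to the right throughout.\<close>

definition "assoc X Y Z = tlift (X \<otimes> Y) Z (X \<otimes> (Y \<otimes> Z))
  (\<lambda>t z. tlift X Y (X \<otimes> (Y \<otimes> Z)) (\<lambda>x y. x \<otimes>\<^bsub>X,Y \<otimes> Z\<^esub> (y \<otimes>\<^bsub>Y,Z\<^esub> z)) t)"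

definition "unassoc X Y Z = tlift X (Y \<otimes> Z) ((X \<otimes> Y) \<otimes> Z)
  (\<lambda>x t. tlift Y Z ((X \<otimes> Y) \<otimes> Z) (\<lambda>y z. (x \<otimes>\<^bsub>X,Y\<^esub> y) \<otimes>\<^bsub>X \<otimes> Y,Z\<^esub> z) t)"

text \<open>The identifications \<open>\<bbbK> \<otimes> X = X\<close> and \<open>X \<otimes> \<bbbK> = X\<close>.\<close>

definition "lunit X = tlift ground X X (\<lambda>c x. smul X c x)"
definition "runit X = tlift X ground X (\<lambda>x c. smul X c x)"

text \<open>For \<open>\<Psi> : X \<otimes> Y \<rightarrow> Y \<otimes> X\<close>:
  \<open>leg12 X Y Z \<Psi> = \<Psi> \<otimes> id : X \<otimes> Y \<otimes> Z \<rightarrow> Y \<otimes> X \<otimes> Z\<close> and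
  \<open>leg23 Z X Y \<Psi> = id \<otimes> \<Psi> : Z \<otimes> X \<otimes> Y \<rightarrow> Z \<otimes> Y \<otimes> X\<close>.\<close>

definition "leg12 X Y Z \<Psi> = assoc Y X Z \<circ> map_id (X \<otimes> Y) (Y \<otimes> X) Z \<Psi> \<circ> unassoc X Y Z"
definition "leg23 Z X Y \<Psi> = id_map Z (X \<otimes> Y) (Y \<otimes> X) \<Psi>"

definition agree :: "('k, 'a) vs \<Rightarrow> ('a \<Rightarrow> 'b) \<Rightarrow> ('a \<Rightarrow> 'b) \<Rightarrow> bool" where
  "agree X f g \<longleftrightarrow> (\<forall>x\<in>carrier X. f x = g x)"

section \<open>Braidings\<close>

definition "braided V \<Psi> \<longleftrightarrow>
  vspace V \<and> linear_iso (V \<otimes> V) (V \<otimes> V) \<Psi> \<and>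
  agree (V \<otimes> V \<otimes> V)
    (leg12 V V V \<Psi> \<circ> leg23 V V V \<Psi> \<circ> leg12 V V V \<Psi>)
    (leg23 V V V \<Psi> \<circ> leg12 V V V \<Psi> \<circ> leg23 V V V \<Psi>)"

text \<open>\<open>W\<close> is a left \<open>V\<close>-braided vector space via \<open>\<Psi>VW : V \<otimes> W \<rightarrow> W \<otimes> V\<close>.\<close>

definition "left_braided V \<Psi>VV W \<Psi>VW \<longleftrightarrow>
  braided V \<Psi>VV \<and> vspace W \<and> linear_iso (V \<otimes> W) (W \<otimes> V) \<Psi>VW \<and>
  agree (V \<otimes> V \<otimes> W)
    (leg12 V W V \<Psi>VW \<circ> leg23 V V W \<Psi>VW \<circ> leg12 V V W \<Psi>VV)
    (leg23 W V V \<Psi>VV \<circ> leg12 V W V \<Psi>VW \<circ> leg23 V V W \<Psi>VW)"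

text \<open>\<open>V\<close> is a right \<open>W\<close>-braided vector space via \<open>\<Psi>VW : V \<otimes> W \<rightarrow> W \<otimes> V\<close>.\<close>

definition "right_braided W \<Psi>WW V \<Psi>VW \<longleftrightarrow>
  braided W \<Psi>WW \<and> vspace V \<and> linear_iso (V \<otimes> W) (W \<otimes> V) \<Psi>VW \<and>
  agree (V \<otimes> W \<otimes> W)
    (leg23 W V W \<Psi>VW \<circ> leg12 V W W \<Psi>VW \<circ> leg23 V W W \<Psi>WW)
    (leg12 W W V \<Psi>WW \<circ> leg23 W V W \<Psi>VW \<circ> leg12 V W W \<Psi>VW)"

section \<open>Algebras and coalgebras\<close>

definition "unital_algebra A m e \<longleftrightarrow>
  vspace A \<and> linear_map (A \<otimes> A) A m \<and> e \<in> carrier A \<and>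
  agree (A \<otimes> A \<otimes> A)
    (m \<circ> map_id (A \<otimes> A) A A m \<circ> unassoc A A A)
    (m \<circ> id_map A (A \<otimes> A) A m) \<and>
  (\<forall>a\<in>carrier A. m (e \<otimes>\<^bsub>A,A\<^esub> a) = a \<and> m (a \<otimes>\<^bsub>A,A\<^esub> e) = a)"

definition "coalgebra C \<Delta> \<epsilon> \<longleftrightarrow>
  vspace C \<and> linear_map C (C \<otimes> C) \<Delta> \<and> linear_map C ground \<epsilon> \<and>
  agree C
    (assoc C C C \<circ> map_id C (C \<otimes> C) C \<Delta> \<circ> \<Delta>)
    (id_map C C (C \<otimes> C) \<Delta> \<circ> \<Delta>) \<and>
  agree C (lunit C \<circ> map_id C ground C \<epsilon> \<circ> \<Delta>) (\<lambda>x. x) \<and>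
  agree C (runit C \<circ> id_map C C ground \<epsilon> \<circ> \<Delta>) (\<lambda>x. x)"

text \<open>Compatibility of \<open>\<Psi> : V \<otimes> W \<rightarrow> W \<otimes> V\<close> with the (co)multiplication of the
  left factor \<open>V\<close> respectively of the right factor \<open>W\<close>.\<close>

definition "mult_compat_left V m e W \<Psi> \<longleftrightarrow>
  agree (V \<otimes> V \<otimes> W)
    (\<Psi> \<circ> map_id (V \<otimes> V) V W m \<circ> unassoc V V W)
    (id_map W (V \<otimes> V) V m \<circ> leg12 V W V \<Psi> \<circ> leg23 V V W \<Psi>) \<and>
  (\<forall>w\<in>carrier W. \<Psi> (e \<otimes>\<^bsub>V,W\<^esub> w) = w \<otimes>\<^bsub>W,V\<^esub> e)"

definition "mult_compat_right W m e V \<Psi> \<longleftrightarrow>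
  agree (V \<otimes> W \<otimes> W)
    (\<Psi> \<circ> id_map V (W \<otimes> W) W m)
    (map_id (W \<otimes> W) W V m \<circ> unassoc W W V \<circ> leg23 W V W \<Psi> \<circ> leg12 V W W \<Psi>) \<and>
  (\<forall>v\<in>carrier V. \<Psi> (v \<otimes>\<^bsub>V,W\<^esub> e) = e \<otimes>\<^bsub>W,V\<^esub> v)"

definition "comult_compat_left V \<Delta> \<epsilon> W \<Psi> \<longleftrightarrow>
  agree (V \<otimes> W)
    (id_map W V (V \<otimes> V) \<Delta> \<circ> \<Psi>)
    (leg12 V W V \<Psi> \<circ> leg23 V V W \<Psi> \<circ> assoc V V W \<circ> map_id V (V \<otimes> V) W \<Delta>) \<and>
  agree (V \<otimes> W)
    (runit W \<circ> id_map W V ground \<epsilon> \<circ> \<Psi>)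
    (lunit W \<circ> map_id V ground W \<epsilon>)"

definition "comult_compat_right W \<Delta> \<epsilon> V \<Psi> \<longleftrightarrow>
  agree (V \<otimes> W)
    (assoc W W V \<circ> map_id W (W \<otimes> W) V \<Delta> \<circ> \<Psi>)
    (leg23 W V W \<Psi> \<circ> leg12 V W W \<Psi> \<circ> id_map V W (W \<otimes> W) \<Delta>) \<and>
  agree (V \<otimes> W)
    (lunit V \<circ> map_id W ground V \<epsilon> \<circ> \<Psi>)
    (runit V \<circ> id_map V W ground \<epsilon>)"

definition "braided_unital_algebra A m e \<Psi> \<longleftrightarrow>
  unital_algebra A m e \<and> braided A \<Psi> \<and>
  mult_compat_left A m e A \<Psi> \<and> mult_compat_right A m e A \<Psi>"

definition "braided_coalgebra C \<Delta> \<epsilon> \<Psi> \<longleftrightarrow>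
  coalgebra C \<Delta> \<epsilon> \<and> braided C \<Psi> \<and>
  comult_compat_left C \<Delta> \<epsilon> C \<Psi> \<and> comult_compat_right C \<Delta> \<epsilon> C \<Psi>"

section \<open>Braided modules and comodules\<close>

definition "braided_left_module A m e \<Psi>AA W \<Psi>AW \<nu> \<longleftrightarrow>
  braided_unital_algebra A m e \<Psi>AA \<and>
  left_braided A \<Psi>AA W \<Psi>AW \<and> mult_compat_left A m e W \<Psi>AW \<and>
  linear_map (A \<otimes> W) W \<nu> \<and>
  agree (A \<otimes> A \<otimes> W)
    (\<nu> \<circ> id_map A (A \<otimes> W) W \<nu>)
    (\<nu> \<circ> map_id (A \<otimes> A) A W m \<circ> unassoc A A W) \<and>
  (\<forall>w\<in>carrier W. \<nu> (e \<otimes>\<^bsub>A,W\<^esub> w) = w) \<and>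
  agree (A \<otimes> A \<otimes> W)
    (\<Psi>AW \<circ> id_map A (A \<otimes> W) W \<nu>)
    (map_id (A \<otimes> W) W A \<nu> \<circ> unassoc A W A \<circ> leg23 A A W \<Psi>AW \<circ> leg12 A A W \<Psi>AA)"

definition "braided_right_module A m e \<Psi>AA V \<Psi>VA \<nu> \<longleftrightarrow>
  braided_unital_algebra A m e \<Psi>AA \<and>
  right_braided A \<Psi>AA V \<Psi>VA \<and> mult_compat_right A m e V \<Psi>VA \<and>
  linear_map (V \<otimes> A) V \<nu> \<and>
  agree (V \<otimes> A \<otimes> A)
    (\<nu> \<circ> map_id (V \<otimes> A) V A \<nu> \<circ> unassoc V A A)
    (\<nu> \<circ> id_map V (A \<otimes> A) A m) \<and>
  (\<forall>v\<in>carrier V. \<nu> (v \<otimes>\<^bsub>V,A\<^esub> e) = v) \<and>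
  agree (V \<otimes> A \<otimes> A)
    (\<Psi>VA \<circ> map_id (V \<otimes> A) V A \<nu> \<circ> unassoc V A A)
    (id_map A (V \<otimes> A) V \<nu> \<circ> leg12 V A A \<Psi>VA \<circ> leg23 V A A \<Psi>AA)"

definition "braided_right_comodule H \<Delta> \<epsilon> \<Psi>HH V \<Psi>HV \<rho> \<longleftrightarrow>
  braided_coalgebra H \<Delta> \<epsilon> \<Psi>HH \<and>
  left_braided H \<Psi>HH V \<Psi>HV \<and> comult_compat_left H \<Delta> \<epsilon> V \<Psi>HV \<and>
  linear_map V (V \<otimes> H) \<rho> \<and>
  agree V
    (assoc V H H \<circ> map_id V (V \<otimes> H) H \<rho> \<circ> \<rho>)
    (id_map V H (H \<otimes> H) \<Delta> \<circ> \<rho>) \<and>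
  agree V (runit V \<circ> id_map V H ground \<epsilon> \<circ> \<rho>) (\<lambda>v. v) \<and>
  agree (H \<otimes> V)
    (assoc V H H \<circ> map_id V (V \<otimes> H) H \<rho> \<circ> \<Psi>HV)
    (leg23 V H H \<Psi>HH \<circ> leg12 H V H \<Psi>HV \<circ> id_map H V (V \<otimes> H) \<rho>)"

definition "braided_left_comodule H \<Delta> \<epsilon> \<Psi>HH V \<Psi>VH \<rho> \<longleftrightarrow>
  braided_coalgebra H \<Delta> \<epsilon> \<Psi>HH \<and>
  right_braided H \<Psi>HH V \<Psi>VH \<and> comult_compat_right H \<Delta> \<epsilon> V \<Psi>VH \<and>
  linear_map V (H \<otimes> V) \<rho> \<and>
  agree V
    (id_map H V (H \<otimes> V) \<rho> \<circ> \<rho>)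
    (assoc H H V \<circ> map_id H (H \<otimes> H) V \<Delta> \<circ> \<rho>) \<and>
  agree V (lunit V \<circ> map_id H ground V \<epsilon> \<circ> \<rho>) (\<lambda>v. v) \<and>
  agree (V \<otimes> H)
    (id_map H V (H \<otimes> V) \<rho> \<circ> \<Psi>VH)
    (leg12 H H V \<Psi>HH \<circ> leg23 H V H \<Psi>VH \<circ> assoc H V H \<circ> map_id V (H \<otimes> V) H \<rho>)"

section \<open>Duality\<close>

definition nondegenerate_subspace ::
  "('k::field, 'a::ab_group_add) vs \<Rightarrow> ('k, 'a \<Rightarrow> 'k) vs \<Rightarrow> bool" where
  "nondegenerate_subspace X U \<longleftrightarrow>
     vspace U \<and> smul U = smul (dual X) \<and> carrier U \<subseteq> carrier (dual X) \<and>
     (\<forall>x\<in>carrier X. \<forall>y\<in>carrier X. x \<noteq> y \<longrightarrow> (\<exists>f\<in>carrier U. f x \<noteq> f y))"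

text \<open>The two readings of the evaluation pairing, \<open>\<langle>f, a\<rangle>\<close> and \<open>\<langle>a, f\<rangle>\<close>.\<close>

abbreviation (input) ev :: "('a \<Rightarrow> 'k) \<Rightarrow> 'a \<Rightarrow> 'k" where "ev \<equiv> (\<lambda>f a. f a)"
abbreviation (input) coev :: "'a \<Rightarrow> ('a \<Rightarrow> 'k) \<Rightarrow> 'k" where "coev \<equiv> (\<lambda>a f. f a)"

text \<open>
  For pairings \<open>p\<close> of \<open>X\<close> with \<open>P\<close> and \<open>q\<close> of \<open>Y\<close> with \<open>Q\<close>, \<open>dual_embed X Y P Q p q\<close> is
  the map \<open>X \<otimes> Y \<rightarrow> (P \<otimes> Q)'\<close>, \<open>(\<xi> \<otimes> \<eta>)(x \<otimes> y) = p \<xi> x * q \<eta> y\<close>.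
  For pairings \<open>p\<close> of \<open>X\<close> with \<open>P\<close> and \<open>q\<close> of \<open>Y\<close> with \<open>Q\<close>, \<open>twisted X Y Q P p q\<close> is
  the map \<open>X \<otimes> Y \<rightarrow> (Q \<otimes> P)'\<close> given by the double-bracket pairing
  \<open>\<langle>\<langle>\<xi> \<otimes> \<eta>, x \<otimes> y\<rangle>\<rangle> = p \<xi> y * q \<eta> x\<close>.
\<close>

definition "dual_embed X Y P Q p q = tlift X Y (dual (P \<otimes> Q))
  (\<lambda>\<xi> \<eta>. tlift P Q ground (\<lambda>x y. p \<xi> x * q \<eta> y))"

definition "twisted X Y Q P p q = tlift X Y (dual (Q \<otimes> P))
  (\<lambda>\<xi> \<eta>. tlift Q P ground (\<lambda>x y. p \<xi> y * q \<eta> x))"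

text \<open>
  A map \<open>F\<close> with values in a dual space, into which \<open>Z\<close> is embedded by \<open>E\<close>: the corresponding
  map with values in \<open>Z\<close> (meaningful if \<open>F\<close> takes values in the image of \<open>E\<close>), and bijectivity
  of \<open>F : S \<rightarrow> Z\<close>.
\<close>

definition "corestrict Z E F = inv_into (carrier Z) E \<circ> F"

definition "bij_onto S Z E F \<longleftrightarrow> bij_betw F (carrier S) (E ` carrier Z)"

text \<open>The inverse of a bijection defined on \<open>X \<otimes> Y\<close>.\<close>

definition "tinv X Y \<Psi> = inv_into (carrier (X \<otimes> Y)) \<Psi>"

subsection \<open>The dual coalgebra\<close>

text \<open>\<open>is_Delta_circ H m \<Psi>HH U f t\<close>: the tensor \<open>t\<close> in \<open>U \<otimes> U\<close> represents the functional
  \<open>f \<circ> m \<circ> \<Psi>HH\<^sup>-\<^sup>1\<close> with respect to the double-bracket pairing.\<close>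

definition "is_Delta_circ H m \<Psi>HH U f t \<longleftrightarrow>
  t \<in> carrier (U \<otimes> U) \<and>
  (\<forall>a\<in>carrier H. \<forall>b\<in>carrier H.
     twisted U U H H ev ev t (a \<otimes>\<^bsub>H,H\<^esub> b) = f (m (tinv H H \<Psi>HH (a \<otimes>\<^bsub>H,H\<^esub> b))))"

definition "Delta_circ H m \<Psi>HH U f = (THE t. is_Delta_circ H m \<Psi>HH U f t)"

subsection \<open>Dual braidings\<close>

text \<open>Each braiding is given first with values in a dual space (suffix \<open>_dual\<close>), together with the
  embedding of the intended codomain in that dual space (suffix \<open>_emb\<close>).\<close>

definition "PsiUU_dual H \<Psi>HH U = tlift U U (dual (H \<otimes> H))
  (\<lambda>f g. tlift H H ground
     (\<lambda>b a. twisted U U H H ev ev (f \<otimes>\<^bsub>U,U\<^esub> g) (\<Psi>HH (a \<otimes>\<^bsub>H,H\<^esub> b))))"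
definition "PsiUU_emb H U = dual_embed U U H H ev ev"
definition "PsiUU_bij H \<Psi>HH U \<longleftrightarrow> bij_onto (U \<otimes> U) (U \<otimes> U) (PsiUU_emb H U) (PsiUU_dual H \<Psi>HH U)"
definition "PsiUU H \<Psi>HH U = corestrict (U \<otimes> U) (PsiUU_emb H U) (PsiUU_dual H \<Psi>HH U)"

text \<open>For \<open>V\<close> left \<open>H\<close>-braided.\<close>

definition "PsiHW_circ_dual H V \<Psi>HV W = tlift H W (dual (V \<otimes> dual H))
  (\<lambda>a e. tlift V (dual H) ground
     (\<lambda>v f. twisted W (dual H) H V ev ev (e \<otimes>\<^bsub>W,dual H\<^esub> f) (tinv H V \<Psi>HV (v \<otimes>\<^bsub>V,H\<^esub> a))))"
definition "PsiHW_circ_emb H V W = dual_embed W H V (dual H) ev coev"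
definition "PsiHW_circ_bij H V \<Psi>HV W \<longleftrightarrow>
  bij_onto (H \<otimes> W) (W \<otimes> H) (PsiHW_circ_emb H V W) (PsiHW_circ_dual H V \<Psi>HV W)"

definition "PsiUV_circ_dual H V \<Psi>HV U = tlift U V (dual (dual V \<otimes> H))
  (\<lambda>f v. tlift (dual V) H ground
     (\<lambda>e a. twisted (dual V) U H V ev ev (e \<otimes>\<^bsub>dual V,U\<^esub> f) (tinv H V \<Psi>HV (v \<otimes>\<^bsub>V,H\<^esub> a))))"
definition "PsiUV_circ_emb H V U = dual_embed V U (dual V) H coev ev"
definition "PsiUV_circ_bij H V \<Psi>HV U \<longleftrightarrow>
  bij_onto (U \<otimes> V) (V \<otimes> U) (PsiUV_circ_emb H V U) (PsiUV_circ_dual H V \<Psi>HV U)"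
definition "PsiUV_circ H V \<Psi>HV U =
  corestrict (V \<otimes> U) (PsiUV_circ_emb H V U) (PsiUV_circ_dual H V \<Psi>HV U)"

definition "PsiWU_bullet_dual H V \<Psi>HV U W = tlift W U (dual (H \<otimes> V))
  (\<lambda>e f. tlift H V ground
     (\<lambda>a v. twisted H W V U coev ev (a \<otimes>\<^bsub>H,W\<^esub> e) (PsiUV_circ H V \<Psi>HV U (f \<otimes>\<^bsub>U,V\<^esub> v))))"
definition "PsiWU_bullet_emb H V U W = dual_embed U W H V ev ev"
definition "PsiWU_bullet_bij H V \<Psi>HV U W \<longleftrightarrow>
  bij_onto (W \<otimes> U) (U \<otimes> W) (PsiWU_bullet_emb H V U W) (PsiWU_bullet_dual H V \<Psi>HV U W)"
definition "PsiWU_bullet H V \<Psi>HV U W =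
  corestrict (U \<otimes> W) (PsiWU_bullet_emb H V U W) (PsiWU_bullet_dual H V \<Psi>HV U W)"

text \<open>For \<open>V\<close> right \<open>H\<close>-braided.\<close>

definition "PsiWH_circ_dual H V \<Psi>VH W = tlift W H (dual (dual H \<otimes> V))
  (\<lambda>e a. tlift (dual H) V ground
     (\<lambda>f v. twisted (dual H) W V H ev ev (f \<otimes>\<^bsub>dual H,W\<^esub> e) (tinv V H \<Psi>VH (a \<otimes>\<^bsub>H,V\<^esub> v))))"
definition "PsiWH_circ_emb H V W = dual_embed H W (dual H) V coev ev"
definition "PsiWH_circ_bij H V \<Psi>VH W \<longleftrightarrow>
  bij_onto (W \<otimes> H) (H \<otimes> W) (PsiWH_circ_emb H V W) (PsiWH_circ_dual H V \<Psi>VH W)"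

definition "PsiVU_circ_dual H V \<Psi>VH U = tlift V U (dual (H \<otimes> dual V))
  (\<lambda>v f. tlift H (dual V) ground
     (\<lambda>a e. twisted U (dual V) V H ev ev (f \<otimes>\<^bsub>U,dual V\<^esub> e) (tinv V H \<Psi>VH (a \<otimes>\<^bsub>H,V\<^esub> v))))"
definition "PsiVU_circ_emb H V U = dual_embed U V H (dual V) ev coev"
definition "PsiVU_circ_bij H V \<Psi>VH U \<longleftrightarrow>
  bij_onto (V \<otimes> U) (U \<otimes> V) (PsiVU_circ_emb H V U) (PsiVU_circ_dual H V \<Psi>VH U)"
definition "PsiVU_circ H V \<Psi>VH U =
  corestrict (U \<otimes> V) (PsiVU_circ_emb H V U) (PsiVU_circ_dual H V \<Psi>VH U)"

definition "PsiUW_bullet_dual H V \<Psi>VH U W = tlift U W (dual (V \<otimes> H))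
  (\<lambda>f e. tlift V H ground
     (\<lambda>v a. twisted W H U V ev coev (e \<otimes>\<^bsub>W,H\<^esub> a) (PsiVU_circ H V \<Psi>VH U (v \<otimes>\<^bsub>V,U\<^esub> f))))"
definition "PsiUW_bullet_emb H V U W = dual_embed W U V H ev ev"
definition "PsiUW_bullet_bij H V \<Psi>VH U W \<longleftrightarrow>
  bij_onto (U \<otimes> W) (W \<otimes> U) (PsiUW_bullet_emb H V U W) (PsiUW_bullet_dual H V \<Psi>VH U W)"
definition "PsiUW_bullet H V \<Psi>VH U W =
  corestrict (W \<otimes> U) (PsiUW_bullet_emb H V U W) (PsiUW_bullet_dual H V \<Psi>VH U W)"

subsection \<open>Dual coactions\<close>

definition "rhoL_dual H V \<Psi>HV \<nu>L e = tlift H V ground (\<lambda>a v. e (\<nu>L (tinv H V \<Psi>HV (v \<otimes>\<^bsub>V,H\<^esub> a))))"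
definition "rhoL H V \<Psi>HV \<nu>L U W = corestrict (U \<otimes> W) (dual_embed U W H V ev ev) (rhoL_dual H V \<Psi>HV \<nu>L)"

definition "rhoR_dual H V \<Psi>VH \<nu>R e = tlift V H ground (\<lambda>v a. e (\<nu>R (tinv V H \<Psi>VH (a \<otimes>\<^bsub>H,V\<^esub> v))))"
definition "rhoR H V \<Psi>VH \<nu>R U W = corestrict (W \<otimes> U) (dual_embed W U V H ev ev) (rhoR_dual H V \<Psi>VH \<nu>R)"

end

theory Submission
  imports Defs
begin

text \<open>
  Everything becomes transparent once tensor powers are paired by the double bracket, which reverses
  the order of the factors: \<open>\<langle>\<langle>f \<otimes> g, x \<otimes> y\<rangle>\<rangle> = f y * g x\<close>, and likewise
  \<open>f \<otimes> g \<otimes> h\<close> against \<open>x \<otimes> y \<otimes> z\<close> gives \<open>f z * g y * h x\<close>.  With respect to this pairing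
  the structure maps on \<open>U\<close> and \<open>W\<close> are the transposes of maps on \<open>H\<close> and \<open>V\<close>:

  \<^item> the inverse of \<open>\<Psi>\<^sub>U\<^sub>U\<close> is the transpose of the inverse of \<open>\<Psi>\<^sub>H\<^sub>H\<close>
    (\<open>tinv_PsiUU_adjoint\<close>);
  \<^item> the bullet braiding of \<open>W\<close> and \<open>U\<close> is the transpose of the inverse of the braiding of
    \<open>H\<close> and \<open>V\<close> (\<open>PsiWU_bullet_adjoint\<close>, \<open>PsiUW_bullet_adjoint\<close>);
  \<^item> the comultiplication of \<open>U\<close> is the transpose of \<open>m \<circ> \<Psi>\<^sub>H\<^sub>H\<^sup>-\<^sup>1\<close>
    (\<open>Delta_circ_adjoint\<close>), and the coaction on \<open>W\<close> is the transpose of the action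
    composed with the inverse braiding (\<open>rhoL_adjoint\<close>, \<open>rhoR_adjoint\<close>).

  Transposition reverses the order of composition and, because of the reversal of tensor factors,
  turns a map acting on the first two legs into one acting on the last two.  Hence the axioms of a
  braided left comodule over \<open>(U, \<Delta>, \<epsilon>)\<close> are, one by one, the transposes of the axioms
  of a braided right module over an algebra (\<open>braided_left_comodule_dual\<close>), and the theorem
  reduces to two statements.

  First, a statement about \<open>H\<close> and \<open>V\<close> alone: replacing every braiding by its inverse
  and composing multiplication and action with the inverse braidings turns a braided algebra into a
  braided algebra and a braided left module into a braided right one
  (\<open>braided_unital_algebra_opposite\<close>, \<open>braided_right_module_opposite\<close>).  This is the braided
  version of passing to the opposite algebra.  Each axiom follows by sliding the inverse braidings
  through \<open>m\<close> or \<open>\<nu>\<close> by compatibility and then applying the braid relation of the inverse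
  braidings to what is left.

  Second, two maps with the same transpose are equal.  This needs that a tensor of
  functionals which vanishes on all pure tensors of vectors is zero, for threefold tensor
  products too (\<open>pairing_tensor_pair\<close>, \<open>pairing_triple\<close>).

  The second half of the theorem is the mirror image: left and right, and first and last legs,
  change places.
\<close>

section \<open>Linear and bilinear maps on carriers\<close>

lemma linear_mapD:
  assumes "linear_map V W f"
  shows "x \<in> carrier V \<Longrightarrow> f x \<in> carrier W"
    and "x \<in> carrier V \<Longrightarrow> y \<in> carrier V \<Longrightarrow> f (x + y) = f x + f y"
    and "x \<in> carrier V \<Longrightarrow> f (smul V c x) = smul W c (f x)"
  using assms by (auto simp: linear_map_def)

lemma linear_map_id: "linear_map V V (\<lambda>x. x)"
  by (simp add: linear_map_def)

lemma linear_map_comp: "linear_map V W f \<Longrightarrow> linear_map W Z g \<Longrightarrow> linear_map V Z (g \<circ> f)"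
  by (simp add: linear_map_def)

lemma linear_map_0:
  assumes "vspace V" "linear_map V W f"
  shows "f 0 = 0"
  using linear_mapD(2)[OF assms(2) vspaceD(3)[OF assms(1)] vspaceD(3)[OF assms(1)]] by simp

lemma vspace_sum:
  assumes "vspace V" "\<And>i. i \<in> T \<Longrightarrow> h i \<in> carrier V"
  shows "sum h T \<in> carrier V"
  using assms(2) by (induction T rule: infinite_finite_induct)
    (auto intro: vspaceD[OF assms(1)])

lemma linear_map_sum:
  assumes V: "vspace V" and f: "linear_map V W f" and h: "\<And>i. i \<in> T \<Longrightarrow> h i \<in> carrier V"
  shows "f (sum h T) = (\<Sum>i\<in>T. f (h i))"
  using h
proof (induction T rule: infinite_finite_induct)
  case (insert i T)
  then show ?case using linear_mapD(2)[OF f, of "h i" "sum h T"] vspace_sum[OF V, of T h] by simp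
qed (simp_all add: linear_map_0[OF V f])

lemma linear_isoD: "linear_iso V W f \<Longrightarrow> linear_map V W f"
  by (simp add: linear_iso_def)

lemma linear_iso_inv:
  assumes V: "vspace V" and f: "linear_iso V W f"
  shows "linear_iso W V (inv_into (carrier V) f)"
    and "x \<in> carrier V \<Longrightarrow> inv_into (carrier V) f (f x) = x"
    and "y \<in> carrier W \<Longrightarrow> f (inv_into (carrier V) f y) = y"
proof -
  let ?g = "inv_into (carrier V) f"
  have b: "bij_betw f (carrier V) (carrier W)" and l: "linear_map V W f"
    using f by (auto simp: linear_iso_def)
  have inv: "?g (f x) = x" if "x \<in> carrier V" for x
    using b that by (auto simp: bij_betw_def inv_into_f_f)
  have vni: "f (?g y) = y" "?g y \<in> carrier V" if "y \<in> carrier W" for y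
    using b that by (auto simp: bij_betw_def f_inv_into_f inv_into_into)
  show "x \<in> carrier V \<Longrightarrow> ?g (f x) = x" and "y \<in> carrier W \<Longrightarrow> f (?g y) = y"
    using inv vni by auto
  have "linear_map W V ?g"
    unfolding linear_map_def
  proof (intro conjI ballI allI)
    show "?g x \<in> carrier V" if "x \<in> carrier W" for x by (rule vni(2)[OF that])
    show "?g (x + y) = ?g x + ?g y" if "x \<in> carrier W" "y \<in> carrier W" for x y
      using inv[OF vspaceD(4)[OF V vni(2)[OF that(1)] vni(2)[OF that(2)]]]
        linear_mapD(2)[OF l vni(2)[OF that(1)] vni(2)[OF that(2)]] that by (simp add: vni)
    show "?g (smul W c x) = smul V c (?g x)" if "x \<in> carrier W" for c x
      using inv[OF vspaceD(5)[OF V vni(2)[OF that]], of c]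
        linear_mapD(3)[OF l vni(2)[OF that], of c] that by (simp add: vni)
  qed
  then show "linear_iso W V ?g"
    using bij_betw_inv_into[OF b] by (simp add: linear_iso_def)
qed

lemma vspace_ground: "vspace (ground :: ('k::field, 'k) vs)"
proof -
  have v: "vector_space ((*) :: 'k \<Rightarrow> 'k \<Rightarrow> 'k)"
    by unfold_locales (auto simp: algebra_simps)
  then interpret vector_space "(*) :: 'k \<Rightarrow> 'k \<Rightarrow> 'k" .
  show ?thesis using v by (simp add: vspace_def ground_def subspace_UNIV)
qed

lemma carrier_ground [simp]: "carrier ground = UNIV"
  by (simp add: ground_def)

lemma smul_ground [simp]: "smul ground = (*)"
  by (simp add: ground_def)

lemma smul_dual [simp]: "smul (dual V) = fscale"
  by (simp add: dual_def)

lemma vspace_dual: "vspace (dual V)"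
proof -
  interpret vector_space "fscale :: 'a::field \<Rightarrow> ('b \<Rightarrow> 'a) \<Rightarrow> _" by (rule vector_space_fscale)
  have "subspace (carrier (dual V))"
    by (auto simp: subspace_def dual_def linear_map_def fscale_def algebra_simps)
  then show ?thesis by (simp add: vspace_def vector_space_fscale)
qed

lemma dual_eqI:
  assumes "f \<in> carrier (dual V)" "g \<in> carrier (dual V)" "\<And>x. x \<in> carrier V \<Longrightarrow> f x = g x"
  shows "f = g"
proof
  fix x show "f x = g x"
    using assms by (cases "x \<in> carrier V") (auto simp: dual_def)
qed

lemma bilinear_mapD:
  assumes "bilinear_map V W Z \<phi>"
  shows "a \<in> carrier V \<Longrightarrow> linear_map W Z (\<phi> a)" 
    and "b \<in> carrier W \<Longrightarrow> linear_map V Z (\<lambda>a. \<phi> a b)"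
  using assms by (auto simp: bilinear_map_def)

lemma bilinear_map_pre:
  assumes "bilinear_map X Y Z \<phi>" "linear_map V X f" "linear_map W Y g"
  shows "bilinear_map V W Z (\<lambda>a b. \<phi> (f a) (g b))"
  using assms by (auto simp: bilinear_map_def linear_map_def)

lemma bilinear_map_post:
  assumes "bilinear_map V W Z \<phi>" "linear_map Z Z' h"
  shows "bilinear_map V W Z' (\<lambda>a b. h (\<phi> a b))"
  using assms by (auto simp: bilinear_map_def linear_map_def)

lemma bilinear_map_swap: "bilinear_map V W Z \<phi> \<Longrightarrow> bilinear_map W V Z (\<lambda>b a. \<phi> a b)"
  by (auto simp: bilinear_map_def)

lemma bilinear_smul: "vspace X \<Longrightarrow> bilinear_map ground X X (smul X)"
  using vspaceD[of X]
  by (auto simp: bilinear_map_def linear_map_def module_def mult.commute)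

section \<open>Maps out of a tensor product\<close>

declare vspace_tensor [simp]

lemma smul_tensor [simp]: "smul (V \<otimes> W) = fscale"
  by (simp add: tensor_def)

lemma pure_in_tensor: "a \<in> carrier V \<Longrightarrow> b \<in> carrier W \<Longrightarrow> a \<otimes>\<^bsub>V,W\<^esub> b \<in> carrier (V \<otimes> W)"
  unfolding tensor_def by (auto intro!: module.span_base[OF module_fscale])

lemma tensor_induct [consumes 1, case_names zero add]:
  fixes V :: "('k::field, 'a::ab_group_add) vs" and W :: "('k, 'b::ab_group_add) vs"
  assumes "t \<in> carrier (V \<otimes> W)" and "P 0"
    and "\<And>c a b t. a \<in> carrier V \<Longrightarrow> b \<in> carrier W \<Longrightarrow> t \<in> carrier (V \<otimes> W) \<Longrightarrow> P t
      \<Longrightarrow> P (fscale c (a \<otimes>\<^bsub>V,W\<^esub> b) + t)"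
  shows "P t"
proof -
  interpret T: module "fscale :: 'k \<Rightarrow> (('a \<Rightarrow> 'b \<Rightarrow> 'k) \<Rightarrow> 'k) \<Rightarrow> _" by (rule module_fscale)
  let ?S = "{a \<otimes>\<^bsub>V,W\<^esub> b | a b. a \<in> carrier V \<and> b \<in> carrier W}"
  have "t \<in> T.span ?S" using assms(1) by (simp add: tensor_def)
  then have "t \<in> carrier (V \<otimes> W) \<and> P t"
  proof (induction rule: T.span_induct_alt)
    case base
    then show ?case using assms(2) vspaceD(3)[OF vspace_tensor] by blast
  next
    case (step c x y)
    then obtain a b where ab: "x = a \<otimes>\<^bsub>V,W\<^esub> b" "a \<in> carrier V" "b \<in> carrier W" by blast
    have "fscale c x \<in> carrier (V \<otimes> W)"
      using vspaceD(5)[OF vspace_tensor pure_in_tensor[OF ab(2,3)]] ab(1) by simp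
    then show ?case using step ab assms(3) vspaceD(4)[OF vspace_tensor] by blast
  qed
  then show ?thesis ..
qed

lemma tensor_ext:
  assumes f: "linear_map (V \<otimes> W) Z f" and g: "linear_map (V \<otimes> W) Z g"
    and eq: "\<And>a b. a \<in> carrier V \<Longrightarrow> b \<in> carrier W \<Longrightarrow> f (a \<otimes>\<^bsub>V,W\<^esub> b) = g (a \<otimes>\<^bsub>V,W\<^esub> b)"
    and t: "t \<in> carrier (V \<otimes> W)"
  shows "f t = g t"
  using t
proof (induction rule: tensor_induct)
  case zero
  then show ?case using linear_map_0[OF vspace_tensor] f g by metis
next
  case (add c a b t)
  have p: "a \<otimes>\<^bsub>V,W\<^esub> b \<in> carrier (V \<otimes> W)" by (rule pure_in_tensor[OF add(1,2)])
  have sp: "fscale c (a \<otimes>\<^bsub>V,W\<^esub> b) \<in> carrier (V \<otimes> W)"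
    using vspaceD(5)[OF vspace_tensor p] by simp
  show ?case
    using linear_mapD(2)[OF f sp add(3)] linear_mapD(2)[OF g sp add(3)]
      linear_mapD(3)[OF f p, of c] linear_mapD(3)[OF g p, of c] add(4) eq[OF add(1,2)]
    by (simp only: smul_tensor)
qed

lemma linear_map_pure_left:
  assumes "vspace V" "vspace W" "linear_map (V \<otimes> W) Z f" "b \<in> carrier W"
  shows "linear_map V Z (\<lambda>a. f (a \<otimes>\<^bsub>V,W\<^esub> b))"
  using bilinear_mapD(2)[OF bilinear_map_post[OF bilinear_pure_tensor[OF assms(1,2)] assms(3)] assms(4)] .

lemma linear_map_pure_right:
  assumes "vspace V" "vspace W" "linear_map (V \<otimes> W) Z f" "a \<in> carrier V"
  shows "linear_map W Z (\<lambda>b. f (a \<otimes>\<^bsub>V,W\<^esub> b))"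
  using bilinear_mapD(1)[OF bilinear_map_post[OF bilinear_pure_tensor[OF assms(1,2)] assms(3)] assms(4)] .

lemma tensor3_ext:
  assumes V: "vspace X" "vspace Y" "vspace Z"
    and f: "linear_map (X \<otimes> Y \<otimes> Z) T f" and g: "linear_map (X \<otimes> Y \<otimes> Z) T g"
    and eq: "\<And>x y z. x \<in> carrier X \<Longrightarrow> y \<in> carrier Y \<Longrightarrow> z \<in> carrier Z
      \<Longrightarrow> f (x \<otimes>\<^bsub>X,Y \<otimes> Z\<^esub> (y \<otimes>\<^bsub>Y,Z\<^esub> z)) = g (x \<otimes>\<^bsub>X,Y \<otimes> Z\<^esub> (y \<otimes>\<^bsub>Y,Z\<^esub> z))"
    and t: "t \<in> carrier (X \<otimes> Y \<otimes> Z)"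
  shows "f t = g t"
proof (rule tensor_ext[OF f g _ t])
  fix x s assume x: "x \<in> carrier X" and s: "s \<in> carrier (Y \<otimes> Z)"
  show "f (x \<otimes>\<^bsub>X,Y \<otimes> Z\<^esub> s) = g (x \<otimes>\<^bsub>X,Y \<otimes> Z\<^esub> s)"
    by (rule tensor_ext[OF linear_map_pure_right[OF V(1) vspace_tensor f x]
          linear_map_pure_right[OF V(1) vspace_tensor g x] eq[OF x] s])
qed

lemma tensor3_ext_left:
  assumes V: "vspace X" "vspace Y" "vspace Z"
    and f: "linear_map ((X \<otimes> Y) \<otimes> Z) T f" and g: "linear_map ((X \<otimes> Y) \<otimes> Z) T g"
    and eq: "\<And>x y z. x \<in> carrier X \<Longrightarrow> y \<in> carrier Y \<Longrightarrow> z \<in> carrier Z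
      \<Longrightarrow> f ((x \<otimes>\<^bsub>X,Y\<^esub> y) \<otimes>\<^bsub>X \<otimes> Y,Z\<^esub> z) = g ((x \<otimes>\<^bsub>X,Y\<^esub> y) \<otimes>\<^bsub>X \<otimes> Y,Z\<^esub> z)"
    and t: "t \<in> carrier ((X \<otimes> Y) \<otimes> Z)"
  shows "f t = g t"
proof (rule tensor_ext[OF f g _ t])
  fix s z assume s: "s \<in> carrier (X \<otimes> Y)" and z: "z \<in> carrier Z"
  show "f (s \<otimes>\<^bsub>X \<otimes> Y,Z\<^esub> z) = g (s \<otimes>\<^bsub>X \<otimes> Y,Z\<^esub> z)"
    by (rule tensor_ext[OF linear_map_pure_left[OF vspace_tensor V(3) f z]
          linear_map_pure_left[OF vspace_tensor V(3) g z] eq[OF _ _ z] s])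
qed

lemma tlift:
  assumes "vspace V" "vspace W" "vspace Z" "bilinear_map V W Z \<phi>"
  shows linear_map_tlift: "linear_map (V \<otimes> W) Z (tlift V W Z \<phi>)"
    and tlift_pure: "a \<in> carrier V \<Longrightarrow> b \<in> carrier W \<Longrightarrow> tlift V W Z \<phi> (a \<otimes>\<^bsub>V,W\<^esub> b) = \<phi> a b"
    and tlift_outside: "t \<notin> carrier (V \<otimes> W) \<Longrightarrow> tlift V W Z \<phi> t = 0"
  using theI'[OF tensor_universal[OF assms]] unfolding tlift_def[symmetric] by auto

lemma tlift_cong:
  assumes "\<And>a b. a \<in> carrier V \<Longrightarrow> b \<in> carrier W \<Longrightarrow> \<phi> a b = \<psi> a b"
  shows "tlift V W Z \<phi> = tlift V W Z \<psi>"
  unfolding tlift_def using assms by (simp cong: ball_cong)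

lemma linear_map_add:
  "vspace W \<Longrightarrow> linear_map V W f \<Longrightarrow> linear_map V W g \<Longrightarrow> linear_map V W (\<lambda>x. f x + g x)"
  using vspaceD[of W]
  by (auto simp: linear_map_def module_def algebra_simps)

lemma linear_map_smul:
  "vspace W \<Longrightarrow> linear_map V W f \<Longrightarrow> linear_map V W (\<lambda>x. smul W c (f x))"
  using vspaceD[of W]
  by (auto simp: linear_map_def module_def algebra_simps)

text \<open>Linear dependence of a lifted map on a parameter.  This is what makes maps defined by nested
  lifts, such as \<open>assoc\<close> or the double bracket, linear in the outer argument.\<close>

lemma linear_map_tlift_param:
  assumes V: "vspace X" "vspace Y" "vspace T"
    and b: "\<And>z. z \<in> carrier Z \<Longrightarrow> bilinear_map X Y T (\<phi> z)"
    and l: "\<And>x y. x \<in> carrier X \<Longrightarrow> y \<in> carrier Y \<Longrightarrow> linear_map Z T (\<lambda>z. \<phi> z x y)"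
    and Z: "vspace Z" and t: "t \<in> carrier (X \<otimes> Y)"
  shows "linear_map Z T (\<lambda>z. tlift X Y T (\<phi> z) t)"
  unfolding linear_map_def
proof (intro conjI ballI allI)
  note L = linear_map_tlift[OF V b] and P = tlift_pure[OF V b]
  show "tlift X Y T (\<phi> z) t \<in> carrier T" if "z \<in> carrier Z" for z
    by (rule linear_mapD(1)[OF L[OF that] t])
  show "tlift X Y T (\<phi> (z + w)) t = tlift X Y T (\<phi> z) t + tlift X Y T (\<phi> w) t"
    if zw: "z \<in> carrier Z" "w \<in> carrier Z" for z w
    by (rule tensor_ext[OF L linear_map_add[OF V(3) L L] _ t])
      (use zw vspaceD(4)[OF Z zw] linear_mapD(2)[OF l zw] in \<open>simp_all add: P\<close>)
  show "tlift X Y T (\<phi> (smul Z c z)) t = smul T c (tlift X Y T (\<phi> z) t)"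
    if z: "z \<in> carrier Z" for c z
    by (rule tensor_ext[OF L linear_map_smul[OF V(3) L] _ t])
      (use z vspaceD(5)[OF Z z] linear_mapD(3)[OF l z] in \<open>simp_all add: P\<close>)
qed

section \<open>Tensor products of maps and reassociation\<close>

lemma tmap:
  assumes V: "vspace V" "vspace W" "vspace X" "vspace Y"
    and f: "linear_map V X f" and g: "linear_map W Y g"
  shows linear_map_tmap: "linear_map (V \<otimes> W) (X \<otimes> Y) (tmap V W X Y f g)"
    and tmap_pure: "a \<in> carrier V \<Longrightarrow> b \<in> carrier W
      \<Longrightarrow> tmap V W X Y f g (a \<otimes>\<^bsub>V,W\<^esub> b) = f a \<otimes>\<^bsub>X,Y\<^esub> g b"
  using tlift[OF V(1,2) vspace_tensor
      bilinear_map_pre[OF bilinear_pure_tensor[OF V(3,4)] f g]]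
  by (auto simp: tmap_def)

lemma tmap_comp:
  assumes V: "vspace V" "vspace W" "vspace X" "vspace Y" "vspace X'" "vspace Y'"
    and f: "linear_map V X f" "linear_map X X' f'" and g: "linear_map W Y g" "linear_map Y Y' g'"
    and t: "t \<in> carrier (V \<otimes> W)"
  shows "tmap X Y X' Y' f' g' (tmap V W X Y f g t) = tmap V W X' Y' (f' \<circ> f) (g' \<circ> g) t"
proof -
  note l = linear_map_comp[OF f] linear_map_comp[OF g]
  have "(tmap X Y X' Y' f' g' \<circ> tmap V W X Y f g) t = tmap V W X' Y' (f' \<circ> f) (g' \<circ> g) t"
    by (rule tensor_ext[OF linear_map_comp[OF linear_map_tmap linear_map_tmap] linear_map_tmap _ t])
      (use V f g l in \<open>simp_all add: tmap_pure linear_mapD(1)[OF f(1)] linear_mapD(1)[OF g(1)]\<close>)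
  then show ?thesis by simp
qed

lemma tmap_id:
  assumes V: "vspace V" "vspace W" 
    and f: "\<And>x. x \<in> carrier V \<Longrightarrow> f x = x" and g: "\<And>x. x \<in> carrier W \<Longrightarrow> g x = x"
    and t: "t \<in> carrier (V \<otimes> W)"
  shows "tmap V W V W f g t = t"
proof -
  have "linear_map V V f" "linear_map W W g"
    using f g vspaceD[OF V(1)] vspaceD[OF V(2)] by (auto simp: linear_map_def)
  then show ?thesis
    by (intro tensor_ext[OF linear_map_tmap linear_map_id _ t])
      (use V f g in \<open>simp_all add: tmap_pure\<close>)
qed

lemma assoc:
  assumes V: "vspace X" "vspace Y" "vspace Z"
  shows linear_map_assoc: "linear_map ((X \<otimes> Y) \<otimes> Z) (X \<otimes> Y \<otimes> Z) (assoc X Y Z)"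
    and assoc_pure: "x \<in> carrier X \<Longrightarrow> y \<in> carrier Y \<Longrightarrow> z \<in> carrier Z
      \<Longrightarrow> assoc X Y Z ((x \<otimes>\<^bsub>X,Y\<^esub> y) \<otimes>\<^bsub>X \<otimes> Y,Z\<^esub> z) = x \<otimes>\<^bsub>X,Y \<otimes> Z\<^esub> (y \<otimes>\<^bsub>Y,Z\<^esub> z)"
proof -
  let ?T = "X \<otimes> Y \<otimes> Z" and ?\<phi> = "\<lambda>z x y. x \<otimes>\<^bsub>X,Y \<otimes> Z\<^esub> (y \<otimes>\<^bsub>Y,Z\<^esub> z)"
  note bX = bilinear_pure_tensor[OF V(1) vspace_tensor[of Y Z]] 
    and bY = bilinear_pure_tensor[OF V(2,3)]
  have b: "bilinear_map X Y ?T (?\<phi> z)" if "z \<in> carrier Z" for z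
    by (rule bilinear_map_pre[OF bX linear_map_id bilinear_mapD(2)[OF bY that]])
  have l: "linear_map Z ?T (\<lambda>z. ?\<phi> z x y)" if "x \<in> carrier X" "y \<in> carrier Y" for x y
    using linear_map_comp[OF bilinear_mapD(1)[OF bY that(2)] bilinear_mapD(1)[OF bX that(1)]]
    by (simp add: o_def)
  have "bilinear_map (X \<otimes> Y) Z ?T (\<lambda>t z. tlift X Y ?T (?\<phi> z) t)"
    unfolding bilinear_map_def[of "X \<otimes> Y"]
    using linear_map_tlift[OF V(1,2) vspace_tensor b]
      linear_map_tlift_param[OF V(1,2) vspace_tensor b l V(3)] by blast
  note t = tlift[OF vspace_tensor V(3) vspace_tensor this]
  show "linear_map ((X \<otimes> Y) \<otimes> Z) ?T (assoc X Y Z)" using t(1) by (simp add: assoc_def)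
  show "assoc X Y Z ((x \<otimes>\<^bsub>X,Y\<^esub> y) \<otimes>\<^bsub>X \<otimes> Y,Z\<^esub> z) = x \<otimes>\<^bsub>X,Y \<otimes> Z\<^esub> (y \<otimes>\<^bsub>Y,Z\<^esub> z)"
    if "x \<in> carrier X" "y \<in> carrier Y" "z \<in> carrier Z"
    using t(2)[OF pure_in_tensor[OF that(1,2)] that(3)]
      tlift_pure[OF V(1,2) vspace_tensor b[OF that(3)] that(1,2)]
    by (simp add: assoc_def)
qed

lemma unassoc:
  assumes V: "vspace X" "vspace Y" "vspace Z"
  shows linear_map_unassoc: "linear_map (X \<otimes> Y \<otimes> Z) ((X \<otimes> Y) \<otimes> Z) (unassoc X Y Z)"
    and unassoc_pure: "x \<in> carrier X \<Longrightarrow> y \<in> carrier Y \<Longrightarrow> z \<in> carrier Z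
      \<Longrightarrow> unassoc X Y Z (x \<otimes>\<^bsub>X,Y \<otimes> Z\<^esub> (y \<otimes>\<^bsub>Y,Z\<^esub> z)) = (x \<otimes>\<^bsub>X,Y\<^esub> y) \<otimes>\<^bsub>X \<otimes> Y,Z\<^esub> z"
proof -
  let ?T = "(X \<otimes> Y) \<otimes> Z" and ?\<phi> = "\<lambda>x y z. (x \<otimes>\<^bsub>X,Y\<^esub> y) \<otimes>\<^bsub>X \<otimes> Y,Z\<^esub> z"
  note bZ = bilinear_pure_tensor[OF vspace_tensor[of X Y] V(3)] 
    and bX = bilinear_pure_tensor[OF V(1,2)]
  have b: "bilinear_map Y Z ?T (?\<phi> x)" if "x \<in> carrier X" for x
    by (rule bilinear_map_pre[OF bZ bilinear_mapD(1)[OF bX that] linear_map_id])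
  have l: "linear_map X ?T (\<lambda>x. ?\<phi> x y z)" if "y \<in> carrier Y" "z \<in> carrier Z" for y z
    using linear_map_comp[OF bilinear_mapD(2)[OF bX that(1)] bilinear_mapD(2)[OF bZ that(2)]]
    by (simp add: o_def)
  have "bilinear_map X (Y \<otimes> Z) ?T (\<lambda>x t. tlift Y Z ?T (?\<phi> x) t)"
    unfolding bilinear_map_def[of _ "Y \<otimes> Z"]
    using linear_map_tlift[OF V(2,3) vspace_tensor b]
      linear_map_tlift_param[OF V(2,3) vspace_tensor b l V(1)] by blast
  note t = tlift[OF V(1) vspace_tensor vspace_tensor this]
  show "linear_map (X \<otimes> Y \<otimes> Z) ?T (unassoc X Y Z)" using t(1) by (simp add: unassoc_def)
  show "unassoc X Y Z (x \<otimes>\<^bsub>X,Y \<otimes> Z\<^esub> (y \<otimes>\<^bsub>Y,Z\<^esub> z)) = (x \<otimes>\<^bsub>X,Y\<^esub> y) \<otimes>\<^bsub>X \<otimes> Y,Z\<^esub> z"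
    if "x \<in> carrier X" "y \<in> carrier Y" "z \<in> carrier Z"
    using t(2)[OF that(1) pure_in_tensor[OF that(2,3)]]
      tlift_pure[OF V(2,3) vspace_tensor b[OF that(1)] that(2,3)]
    by (simp add: unassoc_def)
qed

lemma unassoc_assoc:
  assumes V: "vspace X" "vspace Y" "vspace Z" and t: "t \<in> carrier ((X \<otimes> Y) \<otimes> Z)"
  shows "unassoc X Y Z (assoc X Y Z t) = t"
  using tensor3_ext_left[OF V linear_map_comp[OF linear_map_assoc linear_map_unassoc] linear_map_id _ t]
    V by (simp add: assoc_pure unassoc_pure)

lemma assoc_unassoc:
  assumes V: "vspace X" "vspace Y" "vspace Z" and t: "t \<in> carrier (X \<otimes> Y \<otimes> Z)"
  shows "assoc X Y Z (unassoc X Y Z t) = t"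
  using tensor3_ext[OF V linear_map_comp[OF linear_map_unassoc linear_map_assoc] linear_map_id _ t]
    V by (simp add: assoc_pure unassoc_pure)

lemma map_id:
  assumes "vspace X" "vspace Y" "vspace A" "linear_map X Y f"
  shows linear_map_map_id: "linear_map (X \<otimes> A) (Y \<otimes> A) (map_id X Y A f)"
    and map_id_pure: "x \<in> carrier X \<Longrightarrow> a \<in> carrier A
      \<Longrightarrow> map_id X Y A f (x \<otimes>\<^bsub>X,A\<^esub> a) = f x \<otimes>\<^bsub>Y,A\<^esub> a"
  using tmap[OF assms(1,3,2,3,4) linear_map_id] by (auto simp: map_id_def)

lemma id_map:
  assumes "vspace X" "vspace Y" "vspace A" "linear_map X Y f"
  shows linear_map_id_map: "linear_map (A \<otimes> X) (A \<otimes> Y) (id_map A X Y f)"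
    and id_map_pure: "a \<in> carrier A \<Longrightarrow> x \<in> carrier X
      \<Longrightarrow> id_map A X Y f (a \<otimes>\<^bsub>A,X\<^esub> x) = a \<otimes>\<^bsub>A,Y\<^esub> f x"
  using tmap[OF assms(3,1,3,2) linear_map_id assms(4)] by (auto simp: id_map_def)

lemma map_id_comp:
  assumes "vspace X" "vspace Y" "vspace Z" "vspace A" "linear_map X Y f" "linear_map Y Z g"
    "t \<in> carrier (X \<otimes> A)"
  shows "map_id Y Z A g (map_id X Y A f t) = map_id X Z A (g \<circ> f) t"
  using tmap_comp[OF assms(1,4,2,4,3,4,5,6) linear_map_id linear_map_id assms(7)]
  by (simp add: map_id_def o_def)

lemma id_map_comp:
  assumes "vspace X" "vspace Y" "vspace Z" "vspace A" "linear_map X Y f" "linear_map Y Z g"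
    "t \<in> carrier (A \<otimes> X)"
  shows "id_map A Y Z g (id_map A X Y f t) = id_map A X Z (g \<circ> f) t"
  using tmap_comp[OF assms(4,1,4,2,4,3) linear_map_id linear_map_id assms(5-7)]
  by (simp add: id_map_def o_def)

lemma lunit:
  assumes "vspace X"
  shows linear_map_lunit: "linear_map (ground \<otimes> X) X (lunit X)"
    and lunit_pure: "x \<in> carrier X \<Longrightarrow> lunit X (c \<otimes>\<^bsub>ground,X\<^esub> x) = smul X c x"
  using tlift[OF vspace_ground assms assms bilinear_smul[OF assms]] by (auto simp: lunit_def)

lemma runit:
  assumes "vspace X"
  shows linear_map_runit: "linear_map (X \<otimes> ground) X (runit X)"
    and runit_pure: "x \<in> carrier X \<Longrightarrow> runit X (x \<otimes>\<^bsub>X,ground\<^esub> c) = smul X c x"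
  using tlift[OF assms vspace_ground assms bilinear_map_swap[OF bilinear_smul[OF assms]]]
  by (auto simp: runit_def)

section \<open>Forms in four variables\<close>

text \<open>The dual braidings are all given by scalars depending on four vectors, grouped as two arguments
  and two test vectors.  Linearity in each of the four, in the form below, is exactly what the
  doubly nested lift needs.\<close>

definition quadrilinear where
  "quadrilinear A B P Q \<phi> \<longleftrightarrow>
     (\<forall>a\<in>carrier A. \<forall>b\<in>carrier B. bilinear_map P Q ground (\<phi> a b)) \<and>
     (\<forall>x\<in>carrier P. \<forall>y\<in>carrier Q. bilinear_map A B ground (\<lambda>a b. \<phi> a b x y))"

lemma quadrilinear_pre:
  assumes "bilinear_map S T ground \<beta>" "bilinear_map A B S f" "bilinear_map P Q T g"
  shows "quadrilinear A B P Q (\<lambda>a b x y. \<beta> (f a b) (g x y))"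
  using assms unfolding quadrilinear_def
  by (auto simp: bilinear_map_def linear_map_def)

text \<open>The \<open>\<circ>\<close>-braidings pair one argument together with one test vector against the remaining
  argument and test vector, so the grouping differs from that of \<open>quadrilinear_pre\<close>.\<close>

lemma quadrilinear_mixed:
  assumes "bilinear_map S T ground \<beta>" "bilinear_map C A S \<alpha>" "bilinear_map B D T \<gamma>"
  shows "quadrilinear A B C D (\<lambda>a b c d. \<beta> (\<alpha> c a) (\<gamma> b d))"
    and "quadrilinear B A D C (\<lambda>b a d c. \<beta> (\<alpha> c a) (\<gamma> b d))"
  using assms unfolding quadrilinear_def
  by (auto simp: bilinear_map_def linear_map_def)

lemma quadrilinear_product:
  assumes "bilinear_map A P ground p" "bilinear_map B Q ground q"
  shows "quadrilinear A B P Q (\<lambda>a b x y. p a x * q b y)"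
    and "quadrilinear A B Q P (\<lambda>a b y x. p a x * q b y)"
  using assms unfolding quadrilinear_def
  by (auto simp: bilinear_map_def linear_map_def algebra_simps)

context
  fixes A :: "('k::field, 'a::ab_group_add) vs" and B :: "('k, 'b::ab_group_add) vs"
    and P :: "('k, 'p::ab_group_add) vs" and Q :: "('k, 'q::ab_group_add) vs" and \<phi>
  assumes V: "vspace A" "vspace B" "vspace P" "vspace Q" and \<phi>: "quadrilinear A B P Q \<phi>"
begin

lemma bilinear_tlift_dual:
  "bilinear_map A B (dual (P \<otimes> Q)) (\<lambda>a b. tlift P Q ground (\<phi> a b))"
proof -
  have b: "bilinear_map P Q ground (\<phi> a b)" if "a \<in> carrier A" "b \<in> carrier B" for a b
    using \<phi> that by (auto simp: quadrilinear_def)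
  have c: "bilinear_map A B ground (\<lambda>a b. \<phi> a b x y)" if "x \<in> carrier P" "y \<in> carrier Q" for x y
    using \<phi> that by (auto simp: quadrilinear_def)
  note t = tlift[OF V(3,4) vspace_ground b]
  have 1: "linear_map Z (dual (P \<otimes> Q)) (\<lambda>z. tlift P Q ground (\<psi> z))"
    if Z: "vspace Z" and b: "\<And>z. z \<in> carrier Z \<Longrightarrow> bilinear_map P Q ground (\<psi> z)"
      and l: "\<And>x y. x \<in> carrier P \<Longrightarrow> y \<in> carrier Q \<Longrightarrow> linear_map Z ground (\<lambda>z. \<psi> z x y)"
    for Z :: "('k, 'z::ab_group_add) vs" and \<psi>
  proof -
    note o = tlift_outside[OF V(3,4) vspace_ground b]
    note p = linear_map_tlift_param[OF V(3,4) vspace_ground b l Z]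
    show ?thesis
      unfolding linear_map_def
    proof (intro conjI ballI allI)
      show "tlift P Q ground (\<psi> z) \<in> carrier (dual (P \<otimes> Q))" if "z \<in> carrier Z" for z
        using linear_map_tlift[OF V(3,4) vspace_ground b[OF that]] o[OF that] by (simp add: dual_def)
      show "tlift P Q ground (\<psi> (z + w)) = tlift P Q ground (\<psi> z) + tlift P Q ground (\<psi> w)"
        if "z \<in> carrier Z" "w \<in> carrier Z" for z w
      proof
        fix t
        show "tlift P Q ground (\<psi> (z + w)) t = (tlift P Q ground (\<psi> z) + tlift P Q ground (\<psi> w)) t"
          using linear_mapD(2)[OF p that, of t] o that vspaceD(4)[OF Z that]
          by (cases "t \<in> carrier (P \<otimes> Q)") simp_all
      qed
      show "tlift P Q ground (\<psi> (smul Z c z)) = smul (dual (P \<otimes> Q)) c (tlift P Q ground (\<psi> z))"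
        if "z \<in> carrier Z" for c z
      proof
        fix t
        show "tlift P Q ground (\<psi> (smul Z c z)) t = smul (dual (P \<otimes> Q)) c (tlift P Q ground (\<psi> z)) t"
          using linear_mapD(3)[OF p that, of t c] o that vspaceD(5)[OF Z that]
          by (cases "t \<in> carrier (P \<otimes> Q)") (simp_all add: fscale_def)
      qed
    qed
  qed
  show ?thesis
    unfolding bilinear_map_def[of A B]
    using 1[OF V(2)] 1[OF V(1)] b bilinear_mapD[OF c] by simp
qed

lemma tlift_dual:
  shows linear_map_tlift_dual: "linear_map (A \<otimes> B) (dual (P \<otimes> Q))
      (tlift A B (dual (P \<otimes> Q)) (\<lambda>a b. tlift P Q ground (\<phi> a b)))" (is ?L)
    and bilinear_tlift_dual_eval: "bilinear_map (A \<otimes> B) (P \<otimes> Q) ground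
      (tlift A B (dual (P \<otimes> Q)) (\<lambda>a b. tlift P Q ground (\<phi> a b)))" (is ?B)
    and tlift_dual_pure: "a \<in> carrier A \<Longrightarrow> b \<in> carrier B \<Longrightarrow> x \<in> carrier P \<Longrightarrow> y \<in> carrier Q \<Longrightarrow>
      tlift A B (dual (P \<otimes> Q)) (\<lambda>a b. tlift P Q ground (\<phi> a b)) (a \<otimes>\<^bsub>A,B\<^esub> b) (x \<otimes>\<^bsub>P,Q\<^esub> y) = \<phi> a b x y"
proof -
  note t = tlift[OF V(1,2) vspace_dual bilinear_tlift_dual]
  show l: ?L by (rule t(1))
  then show ?B
    by (auto simp: bilinear_map_def linear_map_def dual_def fscale_def)
  show "a \<in> carrier A \<Longrightarrow> b \<in> carrier B \<Longrightarrow> x \<in> carrier P \<Longrightarrow> y \<in> carrier Q \<Longrightarrow>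
      tlift A B (dual (P \<otimes> Q)) (\<lambda>a b. tlift P Q ground (\<phi> a b)) (a \<otimes>\<^bsub>A,B\<^esub> b) (x \<otimes>\<^bsub>P,Q\<^esub> y) = \<phi> a b x y"
    using t(2) tlift_pure[OF V(3,4) vspace_ground] \<phi> by (auto simp: quadrilinear_def)
qed

end

lemma twisted:
  assumes V: "vspace X" "vspace Y" "vspace Q" "vspace P"
    and p: "bilinear_map X P ground p" and q: "bilinear_map Y Q ground q"
  shows bilinear_twisted: "bilinear_map (X \<otimes> Y) (Q \<otimes> P) ground (twisted X Y Q P p q)"
    and twisted_pure: "\<xi> \<in> carrier X \<Longrightarrow> \<eta> \<in> carrier Y \<Longrightarrow> x \<in> carrier Q \<Longrightarrow> y \<in> carrier P
      \<Longrightarrow> twisted X Y Q P p q (\<xi> \<otimes>\<^bsub>X,Y\<^esub> \<eta>) (x \<otimes>\<^bsub>Q,P\<^esub> y) = p \<xi> y * q \<eta> x"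
  using tlift_dual[OF V quadrilinear_product(2)[OF p q]] unfolding twisted_def by auto

lemma dual_embed:
  assumes V: "vspace X" "vspace Y" "vspace P" "vspace Q"
    and p: "bilinear_map X P ground p" and q: "bilinear_map Y Q ground q"
  shows bilinear_dual_embed: "bilinear_map (X \<otimes> Y) (P \<otimes> Q) ground (dual_embed X Y P Q p q)"
    and dual_embed_pure: "\<xi> \<in> carrier X \<Longrightarrow> \<eta> \<in> carrier Y \<Longrightarrow> x \<in> carrier P \<Longrightarrow> y \<in> carrier Q
      \<Longrightarrow> dual_embed X Y P Q p q (\<xi> \<otimes>\<^bsub>X,Y\<^esub> \<eta>) (x \<otimes>\<^bsub>P,Q\<^esub> y) = p \<xi> x * q \<eta> y"
  using tlift_dual[OF V quadrilinear_product(1)[OF p q]] unfolding dual_embed_def by auto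

text \<open>Values in a dual space are tested against the untwisted embedding, whereas transposition is governed
  by the double bracket.  The two differ by the flip of the test vectors.\<close>

lemma twisted_flip:
  assumes V: "vspace X" "vspace Y" "vspace Q" "vspace P"
    and p: "bilinear_map X P ground p" and q: "bilinear_map Y Q ground q"
    and s: "s \<in> carrier (X \<otimes> Y)" and x: "x \<in> carrier P" and y: "y \<in> carrier Q"
  shows "twisted X Y Q P p q s (y \<otimes>\<^bsub>Q,P\<^esub> x) = dual_embed X Y P Q p q s (x \<otimes>\<^bsub>P,Q\<^esub> y)"
  by (rule tensor_ext[OF bilinear_mapD(2)[OF bilinear_twisted[OF V p q] pure_in_tensor[OF y x]]
        bilinear_mapD(2)[OF bilinear_dual_embed[OF V(1,2,4,3) p q] pure_in_tensor[OF x y]] _ s])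
    (use x y in \<open>simp add: twisted_pure[OF V p q] dual_embed_pure[OF V(1,2,4,3) p q]\<close>)

section \<open>Dual pairs\<close>

text \<open>Bundling the two spaces with their bracket keeps track of which bracket a transpose refers to:
  the same space \<open>H\<close>, for instance, occurs inside several tensor powers.\<close>

record ('k, 'a, 'x) dual_pair =
  functionals :: "('k, 'a) vs"
  vectors :: "('k, 'x) vs"
  bracket :: "'a \<Rightarrow> 'x \<Rightarrow> 'k"

text \<open>Nondegeneracy is demanded on the side of the functionals only: equality of functionals, and of tensors
  of functionals, is what is tested by vectors.\<close>

definition pairing :: "('k::field, 'a::ab_group_add, 'x::ab_group_add) dual_pair \<Rightarrow> bool" where
  "pairing P \<longleftrightarrow> vspace (functionals P) \<and> vspace (vectors P) \<and>
     bilinear_map (functionals P) (vectors P) ground (bracket P) \<and>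
     (\<forall>a\<in>carrier (functionals P). (\<forall>x\<in>carrier (vectors P). bracket P a x = 0) \<longrightarrow> a = 0)"

lemma pairingD:
  assumes "pairing P"
  shows "vspace (functionals P)" "vspace (vectors P)"
    "bilinear_map (functionals P) (vectors P) ground (bracket P)"
    "a \<in> carrier (functionals P) \<Longrightarrow> (\<And>x. x \<in> carrier (vectors P) \<Longrightarrow> bracket P a x = 0) \<Longrightarrow> a = 0"
  using assms by (auto simp: pairing_def)

lemma pairing_eqI:
  assumes P: "pairing P" and a: "a \<in> carrier (functionals P)" and b: "b \<in> carrier (functionals P)"
    and eq: "\<And>x. x \<in> carrier (vectors P) \<Longrightarrow> bracket P a x = bracket P b x"
  shows "a = b"
proof -
  interpret module "smul (functionals P)" by (rule vspaceD(2)[OF pairingD(1)[OF P]])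
  let ?d = "a + smul (functionals P) (-1) b"
  have nb: "smul (functionals P) (-1) b \<in> carrier (functionals P)"
    by (rule vspaceD(5)[OF pairingD(1)[OF P] b])
  have "bracket P ?d x = 0" if x: "x \<in> carrier (vectors P)" for x
    using linear_mapD(2)[OF bilinear_mapD(2)[OF pairingD(3)[OF P] x] a nb]
      linear_mapD(3)[OF bilinear_mapD(2)[OF pairingD(3)[OF P] x] b, of "-1"] eq[OF x] by simp
  then have "?d = 0" using pairingD(4)[OF P vspaceD(4)[OF pairingD(1)[OF P] a nb]] by blast
  then show ?thesis by simp
qed

text \<open>A tensor over a field can be written with linearly independent left factors: when a new left factor
  depends on the old ones, it is expanded and its coefficients are absorbed into the right factors.\<close>

lemma tensor_independent_expansion:
  fixes A :: "('k::field, 'a::ab_group_add) vs" and B :: "('k, 'b::ab_group_add) vs"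
  assumes A: "vspace A" and B: "vspace B" and t: "t \<in> carrier (A \<otimes> B)"
  shows "\<exists>S g. finite S \<and> S \<subseteq> carrier A \<and> \<not> module.dependent (smul A) S \<and>
    g ` S \<subseteq> carrier B \<and> t = (\<Sum>s\<in>S. s \<otimes>\<^bsub>A,B\<^esub> g s)"
  using t
proof (induction rule: tensor_induct)
  case zero
  interpret vector_space "smul A" by (rule vspaceD(1)[OF A])
  show ?case by (rule exI[of _ "{}"]) (simp add: independent_empty)
next
  case (add c a b t)
  interpret a: vector_space "smul A" by (rule vspaceD(1)[OF A])
  note bil = bilinear_pure_tensor[OF A B]
  from add.IH obtain S g where S: "finite S" "S \<subseteq> carrier A" "\<not> a.dependent S" "g ` S \<subseteq> carrier B"
    and t: "t = (\<Sum>s\<in>S. s \<otimes>\<^bsub>A,B\<^esub> g s)" by blast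
  have cb: "smul B c b \<in> carrier B" by (rule vspaceD(5)[OF B add.hyps(2)])
  have ab: "fscale c (a \<otimes>\<^bsub>A,B\<^esub> b) = a \<otimes>\<^bsub>A,B\<^esub> smul B c b"
    using linear_mapD(3)[OF bilinear_mapD(1)[OF bil add.hyps(1)] add.hyps(2)] by simp
  show ?case
  proof (cases "a \<in> a.span S")
    case False
    then have aS: "a \<notin> S" using a.span_base by blast
    have "(\<Sum>s\<in>insert a S. s \<otimes>\<^bsub>A,B\<^esub> (g(a := smul B c b)) s)
        = a \<otimes>\<^bsub>A,B\<^esub> smul B c b + (\<Sum>s\<in>S. s \<otimes>\<^bsub>A,B\<^esub> (g(a := smul B c b)) s)"
      using S(1) aS by simp
    also have "(\<Sum>s\<in>S. s \<otimes>\<^bsub>A,B\<^esub> (g(a := smul B c b)) s) = t"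
      unfolding t by (rule sum.cong) (use aS in auto)
    finally have "fscale c (a \<otimes>\<^bsub>A,B\<^esub> b) + t = (\<Sum>s\<in>insert a S. s \<otimes>\<^bsub>A,B\<^esub> (g(a := smul B c b)) s)"
      by (simp only: ab)
    then show ?thesis
      using S cb add.hyps a.independent_insertI[OF False S(3)]
      by (intro exI[of _ "insert a S"] exI[of _ "g(a := smul B c b)"]) auto
  next
    case True
    then obtain u where u: "a = (\<Sum>s\<in>S. smul A (u s) s)"
      unfolding a.span_finite[OF S(1)] by blast
    let ?g = "\<lambda>s. g s + smul B (u s) (smul B c b)"
    have lin: "linear_map A (A \<otimes> B) (\<lambda>a. a \<otimes>\<^bsub>A,B\<^esub> smul B c b)" by (rule bilinear_mapD(2)[OF bil cb])
    have "a \<otimes>\<^bsub>A,B\<^esub> smul B c b = (\<Sum>s\<in>S. smul A (u s) s \<otimes>\<^bsub>A,B\<^esub> smul B c b)"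
      unfolding u by (rule linear_map_sum[OF A lin]) (use S(2) vspaceD(5)[OF A] in blast)
    also have "\<dots> = (\<Sum>s\<in>S. fscale (u s) (s \<otimes>\<^bsub>A,B\<^esub> smul B c b))"
      by (rule sum.cong) (use S(2) linear_mapD(3)[OF lin] in auto)
    finally have "a \<otimes>\<^bsub>A,B\<^esub> smul B c b = (\<Sum>s\<in>S. fscale (u s) (s \<otimes>\<^bsub>A,B\<^esub> smul B c b))" .
    moreover have "(\<Sum>s\<in>S. fscale (u s) (s \<otimes>\<^bsub>A,B\<^esub> smul B c b)) + t = (\<Sum>s\<in>S. s \<otimes>\<^bsub>A,B\<^esub> ?g s)"
      unfolding t sum.distrib[symmetric]
    proof (rule sum.cong[OF refl])
      fix s assume s: "s \<in> S"
      then have sA: "s \<in> carrier A" and gs: "g s \<in> carrier B" using S by auto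
      note l = bilinear_mapD(1)[OF bil sA]
      show "fscale (u s) (s \<otimes>\<^bsub>A,B\<^esub> smul B c b) + s \<otimes>\<^bsub>A,B\<^esub> g s = s \<otimes>\<^bsub>A,B\<^esub> ?g s"
        using linear_mapD(2)[OF l gs vspaceD(5)[OF B cb]] linear_mapD(3)[OF l cb, of "u s"]
        by (simp only: smul_tensor add.commute)
    qed
    ultimately have "fscale c (a \<otimes>\<^bsub>A,B\<^esub> b) + t = (\<Sum>s\<in>S. s \<otimes>\<^bsub>A,B\<^esub> ?g s)" by (simp only: ab)
    moreover have "?g ` S \<subseteq> carrier B" using S(4) vspaceD(4)[OF B] vspaceD(5)[OF B cb] by auto
    ultimately show ?thesis using S(1-3) by blast
  qed
qed

text \<open>The tensor product of dual pairs, with the vectors in reverse order; its bracket is the double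
  bracket.\<close>

definition tensor_pair (infixr "\<odot>" 70) where
  "P \<odot> Q = \<lparr>functionals = functionals P \<otimes> functionals Q, vectors = vectors Q \<otimes> vectors P,
     bracket = twisted (functionals P) (functionals Q) (vectors Q) (vectors P) (bracket P) (bracket Q)\<rparr>"

lemma tensor_pair_sel [simp]:
  "functionals (P \<odot> Q) = functionals P \<otimes> functionals Q"
  "vectors (P \<odot> Q) = vectors Q \<otimes> vectors P"
  "bracket (P \<odot> Q) =
     twisted (functionals P) (functionals Q) (vectors Q) (vectors P) (bracket P) (bracket Q)"
  by (simp_all add: tensor_pair_def)

text \<open>Write the tensor of functionals as \<open>\<Sum> s \<otimes> g s\<close> with independent \<open>s\<close>.  If it vanishes
  on all \<open>y \<otimes> x\<close>, then for fixed \<open>y\<close> the functional \<open>\<Sum> \<langle>g s, y\<rangle> s\<close> vanishes on all \<open>x\<close>, so all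
  coefficients \<open>\<langle>g s, y\<rangle>\<close> are zero; as \<open>y\<close> is arbitrary, every \<open>g s\<close> is zero.\<close>

lemma pairing_tensor_pair:
  assumes P: "pairing P" and Q: "pairing Q"
  shows "pairing (P \<odot> Q)"
proof -
  let ?A = "functionals P" and ?B = "functionals Q" and ?X = "vectors P" and ?Y = "vectors Q"
  let ?b = "twisted ?A ?B ?Y ?X (bracket P) (bracket Q)"
  note V = pairingD(1)[OF P] pairingD(1)[OF Q] pairingD(2)[OF Q] pairingD(2)[OF P]
    and b = pairingD(3)[OF P] pairingD(3)[OF Q]
  note tw = twisted[OF V b]
  interpret a: vector_space "smul ?A" by (rule vspaceD(1)[OF V(1)])
  have "t = 0" if t: "t \<in> carrier (?A \<otimes> ?B)" and 0: "\<And>z. z \<in> carrier (?Y \<otimes> ?X) \<Longrightarrow> ?b t z = 0" for t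
  proof -
    obtain S g where S: "finite S" "S \<subseteq> carrier ?A" "\<not> a.dependent S" "g ` S \<subseteq> carrier ?B"
      and t: "t = (\<Sum>s\<in>S. s \<otimes>\<^bsub>?A,?B\<^esub> g s)" using tensor_independent_expansion[OF V(1,2) t] by blast
    have g0: "bracket Q (g s) y = 0" if s: "s \<in> S" and y: "y \<in> carrier ?Y" for s y
    proof -
      let ?c = "\<Sum>s\<in>S. smul ?A (bracket Q (g s) y) s"
      have c: "smul ?A (bracket Q (g s) y) s \<in> carrier ?A" if "s \<in> S" for s
        using vspaceD(5)[OF V(1)] that S(2) by blast
      have c0: "bracket P ?c x = 0" if x: "x \<in> carrier ?X" for x
      proof -
        note lP = bilinear_mapD(2)[OF b(1) x]
          and lb = bilinear_mapD(2)[OF tw(1) pure_in_tensor[OF y x]]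
        have "bracket P ?c x = (\<Sum>s\<in>S. bracket P (smul ?A (bracket Q (g s) y) s) x)"
          by (rule linear_map_sum[OF V(1) lP c])
        also have "\<dots> = (\<Sum>s\<in>S. ?b (s \<otimes>\<^bsub>?A,?B\<^esub> g s) (y \<otimes>\<^bsub>?Y,?X\<^esub> x))"
        proof (rule sum.cong[OF refl])
          fix s assume "s \<in> S"
          then have s: "s \<in> carrier ?A" "g s \<in> carrier ?B" using S(2,4) by auto
          show "bracket P (smul ?A (bracket Q (g s) y) s) x = ?b (s \<otimes>\<^bsub>?A,?B\<^esub> g s) (y \<otimes>\<^bsub>?Y,?X\<^esub> x)"
            by (simp only: linear_mapD(3)[OF lP s(1)] tw(2)[OF s y x] smul_ground mult.commute)
        qed
        also have "\<dots> = ?b t (y \<otimes>\<^bsub>?Y,?X\<^esub> x)"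
          unfolding t by (rule linear_map_sum[OF vspace_tensor lb, symmetric])
            (use S(2,4) in \<open>auto intro: pure_in_tensor\<close>)
        finally show ?thesis using 0[OF pure_in_tensor[OF y x]] by simp
      qed
      have "?c \<in> carrier ?A" by (rule vspace_sum[OF V(1) c])
      then have "?c = 0" by (rule pairingD(4)[OF P _ c0])
      from a.independentD[OF S(3,1) subset_refl this s] show ?thesis .
    qed
    have "g s = 0" if "s \<in> S" for s
      by (rule pairingD(4)[OF Q _ g0[OF that]]) (use S(4) that in auto)
    moreover have "s \<otimes>\<^bsub>?A,?B\<^esub> 0 = 0" if "s \<in> S" for s
      by (rule linear_map_0[OF V(2) bilinear_mapD(1)[OF bilinear_pure_tensor[OF V(1,2)]]])
        (use that S(2) in auto)
    ultimately show ?thesis unfolding t by (simp cong: sum.cong)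
  qed
  then show ?thesis using tw(1) unfolding pairing_def by simp
qed

text \<open>Iterating the tensor product of dual pairs nests the functionals to the right and hence, because of
  the reversal, the vectors to the left.  Since all threefold tensor products are to be nested to the right, the
  vectors are reassociated.\<close>

definition triple where
  "triple P Q R = \<lparr>functionals = functionals P \<otimes> functionals Q \<otimes> functionals R,
     vectors = vectors R \<otimes> vectors Q \<otimes> vectors P,
     bracket = (\<lambda>s x. bracket (P \<odot> Q \<odot> R) s (unassoc (vectors R) (vectors Q) (vectors P) x))\<rparr>"

lemma triple_sel [simp]:
  "functionals (triple P Q R) = functionals P \<otimes> functionals Q \<otimes> functionals R"
  "vectors (triple P Q R) = vectors R \<otimes> vectors Q \<otimes> vectors P"
  "bracket (triple P Q R) s x = bracket (P \<odot> Q \<odot> R) s (unassoc (vectors R) (vectors Q) (vectors P) x)"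
  by (simp_all add: triple_def)

lemma pairing_triple:
  assumes P: "pairing P" and Q: "pairing Q" and R: "pairing R"
  shows "pairing (triple P Q R)"
proof -
  note V = pairingD(2)[OF R] pairingD(2)[OF Q] pairingD(2)[OF P]
  note PQR = pairing_tensor_pair[OF P pairing_tensor_pair[OF Q R]]
  have "t = 0" if t: "t \<in> carrier (functionals (triple P Q R))"
    and 0: "\<And>x. x \<in> carrier (vectors (triple P Q R)) \<Longrightarrow> bracket (triple P Q R) t x = 0" for t
  proof (rule pairingD(4)[OF PQR])
    show "t \<in> carrier (functionals (P \<odot> Q \<odot> R))" using t by simp
    fix x assume "x \<in> carrier (vectors (P \<odot> Q \<odot> R))"
    then have x: "x \<in> carrier ((vectors R \<otimes> vectors Q) \<otimes> vectors P)" by simp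
    show "bracket (P \<odot> Q \<odot> R) t x = 0"
      using 0[of "assoc (vectors R) (vectors Q) (vectors P) x"] linear_mapD(1)[OF linear_map_assoc[OF V] x]
      by (simp only: triple_sel unassoc_assoc[OF V x])
  qed
  moreover have "bilinear_map (functionals (triple P Q R)) (vectors (triple P Q R)) ground (bracket (triple P Q R))"
    using bilinear_map_pre[OF pairingD(3)[OF PQR] linear_map_id, of "vectors (triple P Q R)"]
      linear_map_unassoc[OF V] unfolding triple_def by simp
  ultimately show ?thesis unfolding pairing_def[of "triple P Q R"] by simp
qed

section \<open>Adjoint maps\<close>

text \<open>\<open>F\<close> is the transpose of \<open>G\<close>.\<close>

definition adjoint ::
  "('k::field, 'a::ab_group_add, 'x::ab_group_add) dual_pair \<Rightarrow>
   ('k, 'b::ab_group_add, 'y::ab_group_add) dual_pair \<Rightarrow> ('a \<Rightarrow> 'b) \<Rightarrow> ('y \<Rightarrow> 'x) \<Rightarrow> bool" where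
  "adjoint P Q F G \<longleftrightarrow> linear_map (functionals P) (functionals Q) F \<and>
     linear_map (vectors Q) (vectors P) G \<and>
     (\<forall>a\<in>carrier (functionals P). \<forall>y\<in>carrier (vectors Q). bracket Q (F a) y = bracket P a (G y))"

lemma adjointD:
  assumes "adjoint P Q F G"
  shows "linear_map (functionals P) (functionals Q) F" "linear_map (vectors Q) (vectors P) G"
    "a \<in> carrier (functionals P) \<Longrightarrow> y \<in> carrier (vectors Q) \<Longrightarrow> bracket Q (F a) y = bracket P a (G y)"
  using assms by (auto simp: adjoint_def)

lemma adjoint_id: "adjoint P P (\<lambda>x. x) (\<lambda>x. x)"
  by (simp add: adjoint_def linear_map_id)

lemma adjoint_comp:
  assumes F: "adjoint P Q F G" and F': "adjoint Q R F' G'"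
  shows "adjoint P R (F' \<circ> F) (G \<circ> G')"
  using linear_map_comp[OF adjointD(1)[OF F] adjointD(1)[OF F']]
    linear_map_comp[OF adjointD(2)[OF F'] adjointD(2)[OF F]]
  by (simp add: adjoint_def adjointD(3)[OF F] adjointD(3)[OF F']
      linear_mapD(1)[OF adjointD(1)[OF F]] linear_mapD(1)[OF adjointD(2)[OF F']])

lemma linear_map_agree: "linear_map V W f \<Longrightarrow> agree V f g \<Longrightarrow> vspace V \<Longrightarrow> linear_map V W g"
  using vspaceD[of V] by (auto simp: linear_map_def agree_def)

text \<open>The principle by which every axiom for functionals is deduced from an identity between maps of
  vectors.\<close>

lemma adjoint_agree:
  assumes Q: "pairing Q" and F: "adjoint P Q F G" and F': "adjoint P Q F' G'"
    and eq: "agree (vectors Q) G G'"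
  shows "agree (functionals P) F F'"
  unfolding agree_def
proof
  fix a assume a: "a \<in> carrier (functionals P)"
  show "F a = F' a"
    by (rule pairing_eqI[OF Q linear_mapD(1)[OF adjointD(1)[OF F] a] linear_mapD(1)[OF adjointD(1)[OF F'] a]])
      (use adjointD(3)[OF F a] adjointD(3)[OF F' a] eq in \<open>simp add: agree_def\<close>)
qed

lemma adjoint_cong:
  assumes "pairing P" "pairing Q" and F: "adjoint P Q F G" 
    and "agree (functionals P) F F'" "agree (vectors Q) G G'"
  shows "adjoint P Q F' G'"
  using linear_map_agree[OF adjointD(1)[OF F] assms(4) pairingD(1)[OF assms(1)]]
    linear_map_agree[OF adjointD(2)[OF F] assms(5) pairingD(2)[OF assms(2)]] adjointD(3)[OF F] assms(4,5)
  by (auto simp: adjoint_def agree_def)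

text \<open>A map which satisfies the adjunction identity is automatically linear, by nondegeneracy.  So
  linearity need not be checked for maps obtained by corestriction or by a description operator.\<close>

lemma adjointI:
  assumes P: "pairing P" and Q: "pairing Q" and G: "linear_map (vectors Q) (vectors P) G"
    and F: "\<And>a. a \<in> carrier (functionals P) \<Longrightarrow> F a \<in> carrier (functionals Q)"
    and eq: "\<And>a y. a \<in> carrier (functionals P) \<Longrightarrow> y \<in> carrier (vectors Q)
      \<Longrightarrow> bracket Q (F a) y = bracket P a (G y)"
  shows "adjoint P Q F G"
proof -
  note VP = vspaceD[OF pairingD(1)[OF P]] and VQ = vspaceD[OF pairingD(1)[OF Q]]
  note bP = bilinear_mapD(2)[OF pairingD(3)[OF P] linear_mapD(1)[OF G]]
    and bQ = bilinear_mapD(2)[OF pairingD(3)[OF Q]]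
  have "linear_map (functionals P) (functionals Q) F"
    unfolding linear_map_def
  proof (intro conjI ballI allI)
    fix a assume a: "a \<in> carrier (functionals P)"
    show "F a \<in> carrier (functionals Q)" by (rule F[OF a])
    show "F (a + b) = F a + F b" if b: "b \<in> carrier (functionals P)" for b
      by (rule pairing_eqI[OF Q F[OF VP(4)[OF a b]] VQ(4)[OF F[OF a] F[OF b]]])
        (simp add: eq a b VP(4) linear_mapD(2)[OF bQ] linear_mapD(2)[OF bP] F)
    show "F (smul (functionals P) c a) = smul (functionals Q) c (F a)" for c
      by (rule pairing_eqI[OF Q F[OF VP(5)[OF a]] VQ(5)[OF F[OF a]]])
        (simp add: eq a VP(5) linear_mapD(3)[OF bQ] linear_mapD(3)[OF bP] F)
  qed
  then show ?thesis using G eq by (simp add: adjoint_def)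
qed

lemma adjoint_inverse:
  assumes P: "pairing P" and Q: "pairing Q" and F: "adjoint P Q F G"
    and iF: "linear_iso (functionals P) (functionals Q) F" and iG: "linear_iso (vectors Q) (vectors P) G"
  shows "adjoint Q P (inv_into (carrier (functionals P)) F) (inv_into (carrier (vectors Q)) G)"
proof -
  note vF = linear_iso_inv[OF pairingD(1)[OF P] iF] and vG = linear_iso_inv[OF pairingD(2)[OF Q] iG]
  show ?thesis
    unfolding adjoint_def
    using linear_isoD[OF vF(1)] linear_isoD[OF vG(1)]
      adjointD(3)[OF F linear_mapD(1)[OF linear_isoD[OF vF(1)]] linear_mapD(1)[OF linear_isoD[OF vG(1)]]]
    by (simp add: vF(3) vG(3))
qed

lemma adjoint_tmap:
  assumes P: "pairing P" "pairing Q" "pairing P'" "pairing Q'"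
    and F: "adjoint P P' F G" and F': "adjoint Q Q' F' G'"
  shows "adjoint (P \<odot> Q) (P' \<odot> Q')
    (tmap (functionals P) (functionals Q) (functionals P') (functionals Q') F F')
    (tmap (vectors Q') (vectors P') (vectors Q) (vectors P) G' G)" (is "adjoint _ _ ?F ?G")
proof -
  let ?A = "functionals P" and ?B = "functionals Q" and ?X = "vectors P" and ?Y = "vectors Q"
  let ?A' = "functionals P'" and ?B' = "functionals Q'" and ?X' = "vectors P'" and ?Y' = "vectors Q'"
  note V = P[THEN pairingD(1)] P[THEN pairingD(2)]
  note b = pairingD(3)[OF P(1)] pairingD(3)[OF P(2)] pairingD(3)[OF P(3)] pairingD(3)[OF P(4)]
  note tF = tmap[OF V(1-4) adjointD(1)[OF F] adjointD(1)[OF F']]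
    and tG = tmap[OF V(8,7,6,5) adjointD(2)[OF F'] adjointD(2)[OF F]]
  note tw = twisted[OF V(1,2,6,5) b(1,2)] and tw' = twisted[OF V(3,4,8,7) b(3,4)]
  let ?t = "bracket (P \<odot> Q)" and ?t' = "bracket (P' \<odot> Q')"
  have "?t' (?F s) z = ?t s (?G z)" if s: "s \<in> carrier (?A \<otimes> ?B)" and z: "z \<in> carrier (?Y' \<otimes> ?X')" for s z
  proof -
    have "(\<lambda>s. ?t' (?F s) z) s = (\<lambda>s. ?t s (?G z)) s"
    proof (rule tensor_ext[OF _ _ _ s])
      show "linear_map (?A \<otimes> ?B) ground (\<lambda>s. ?t' (?F s) z)"
        using linear_map_comp[OF tF(1) bilinear_mapD(2)[OF tw'(1) z]] by (simp add: o_def)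
      show "linear_map (?A \<otimes> ?B) ground (\<lambda>s. ?t s (?G z))"
        using bilinear_mapD(2)[OF tw(1) linear_mapD(1)[OF tG(1) z]] by simp
      fix a b assume a: "a \<in> carrier ?A" and b: "b \<in> carrier ?B"
      have l: "?F (a \<otimes>\<^bsub>?A,?B\<^esub> b) \<in> carrier (?A' \<otimes> ?B')" 
        by (rule linear_mapD(1)[OF tF(1) pure_in_tensor[OF a b]])
      show "?t' (?F (a \<otimes>\<^bsub>?A,?B\<^esub> b)) z = ?t (a \<otimes>\<^bsub>?A,?B\<^esub> b) (?G z)"
      proof (rule tensor_ext[OF _ _ _ z])
        show "linear_map (?Y' \<otimes> ?X') ground (?t' (?F (a \<otimes>\<^bsub>?A,?B\<^esub> b)))"
          using bilinear_mapD(1)[OF tw'(1) l] by simp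
        show "linear_map (?Y' \<otimes> ?X') ground (\<lambda>z. ?t (a \<otimes>\<^bsub>?A,?B\<^esub> b) (?G z))"
          using linear_map_comp[OF tG(1) bilinear_mapD(1)[OF tw(1) pure_in_tensor[OF a b]]] by (simp add: o_def)
        fix y x assume y: "y \<in> carrier ?Y'" and x: "x \<in> carrier ?X'"
        show "?t' (?F (a \<otimes>\<^bsub>?A,?B\<^esub> b)) (y \<otimes>\<^bsub>?Y',?X'\<^esub> x) = ?t (a \<otimes>\<^bsub>?A,?B\<^esub> b) (?G (y \<otimes>\<^bsub>?Y',?X'\<^esub> x))"
          using a b x y linear_mapD(1)[OF adjointD(1)[OF F]] linear_mapD(1)[OF adjointD(1)[OF F']]
            linear_mapD(1)[OF adjointD(2)[OF F]] linear_mapD(1)[OF adjointD(2)[OF F']]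
          by (simp add: tF(2) tG(2) tw(2) tw'(2) adjointD(3)[OF F] adjointD(3)[OF F'])
      qed
    qed
    then show ?thesis .
  qed
  then show ?thesis using tF(1) tG(1) unfolding adjoint_def by simp
qed

lemma adjoint_id_map:
  assumes "pairing P" "pairing Q" "pairing R" "adjoint P Q F G"
  shows "adjoint (R \<odot> P) (R \<odot> Q) (id_map (functionals R) (functionals P) (functionals Q) F)
    (map_id (vectors Q) (vectors P) (vectors R) G)"
  using adjoint_tmap[OF assms(3,1,3,2) adjoint_id assms(4)] by (simp add: id_map_def map_id_def)

lemma adjoint_map_id:
  assumes "pairing P" "pairing Q" "pairing R" "adjoint P Q F G"
  shows "adjoint (P \<odot> R) (Q \<odot> R) (map_id (functionals P) (functionals Q) (functionals R) F)
    (id_map (vectors R) (vectors Q) (vectors P) G)"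
  using adjoint_tmap[OF assms(1,3,2,3,4) adjoint_id] by (simp add: id_map_def map_id_def)

context
  fixes P :: "('k::field, 'a::ab_group_add, 'x::ab_group_add) dual_pair"
    and Q :: "('k, 'b::ab_group_add, 'y::ab_group_add) dual_pair"
    and R :: "('k, 'c::ab_group_add, 'z::ab_group_add) dual_pair"
  assumes P: "pairing P" and Q: "pairing Q" and R: "pairing R"
begin

lemma adjoint_assoc:
  "adjoint ((P \<odot> Q) \<odot> R) (P \<odot> Q \<odot> R)
    (assoc (functionals P) (functionals Q) (functionals R)) (assoc (vectors R) (vectors Q) (vectors P))"
proof -
  let ?A = "functionals P" and ?B = "functionals Q" and ?C = "functionals R"
  let ?X = "vectors P" and ?Y = "vectors Q" and ?Z = "vectors R"
  note V = pairingD(1)[OF P] pairingD(1)[OF Q] pairingD(1)[OF R]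
    and V' = pairingD(2)[OF R] pairingD(2)[OF Q] pairingD(2)[OF P]
  note PQ = pairing_tensor_pair[OF P Q] and QR = pairing_tensor_pair[OF Q R]
  note l = pairingD(3)[OF pairing_tensor_pair[OF PQ R], simplified]
    and r = pairingD(3)[OF pairing_tensor_pair[OF P QR], simplified]
  note tw = twisted_pure[OF V(1,2) V'(2,3) pairingD(3)[OF P] pairingD(3)[OF Q]]
    twisted_pure[OF V(2,3) V'(1,2) pairingD(3)[OF Q] pairingD(3)[OF R]]
    twisted_pure[OF V(1) vspace_tensor vspace_tensor V'(3) pairingD(3)[OF P] pairingD(3)[OF QR, simplified]]
    twisted_pure[OF vspace_tensor V(3) V'(1) vspace_tensor pairingD(3)[OF PQ, simplified] pairingD(3)[OF R]]
  let ?l = "bracket ((P \<odot> Q) \<odot> R)" and ?r = "bracket (P \<odot> Q \<odot> R)"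
  let ?F = "assoc ?A ?B ?C" and ?G = "assoc ?Z ?Y ?X"
  have "?r (?F s) z = ?l s (?G z)"
    if s: "s \<in> carrier ((?A \<otimes> ?B) \<otimes> ?C)" and z: "z \<in> carrier ((?Z \<otimes> ?Y) \<otimes> ?X)" for s z
  proof -
    have "(\<lambda>s. ?r (?F s) z) s = (\<lambda>s. ?l s (?G z)) s"
    proof (rule tensor3_ext_left[OF V _ _ _ s])
      show "linear_map ((?A \<otimes> ?B) \<otimes> ?C) ground (\<lambda>s. ?r (?F s) z)"
        using linear_map_comp[OF linear_map_assoc[OF V] bilinear_mapD(2)[OF r z]] by (simp add: o_def)
      show "linear_map ((?A \<otimes> ?B) \<otimes> ?C) ground (\<lambda>s. ?l s (?G z))"
        using bilinear_mapD(2)[OF l linear_mapD(1)[OF linear_map_assoc[OF V'] z]] by simp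
      fix a b c assume abc: "a \<in> carrier ?A" "b \<in> carrier ?B" "c \<in> carrier ?C"
      let ?s = "(a \<otimes>\<^bsub>?A,?B\<^esub> b) \<otimes>\<^bsub>?A \<otimes> ?B,?C\<^esub> c"
      have s: "?s \<in> carrier ((?A \<otimes> ?B) \<otimes> ?C)" by (intro pure_in_tensor abc)
      show "?r (?F ?s) z = ?l ?s (?G z)"
      proof (rule tensor3_ext_left[OF V' _ _ _ z])
        show "linear_map ((?Z \<otimes> ?Y) \<otimes> ?X) ground (?r (?F ?s))"
          using bilinear_mapD(1)[OF r linear_mapD(1)[OF linear_map_assoc[OF V] s]] by simp
        show "linear_map ((?Z \<otimes> ?Y) \<otimes> ?X) ground (\<lambda>z. ?l ?s (?G z))"
          using linear_map_comp[OF linear_map_assoc[OF V'] bilinear_mapD(1)[OF l s]] by (simp add: o_def)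
        fix z y x assume "z \<in> carrier ?Z" "y \<in> carrier ?Y" "x \<in> carrier ?X"
        then show "?r (?F ?s) ((z \<otimes>\<^bsub>?Z,?Y\<^esub> y) \<otimes>\<^bsub>?Z \<otimes> ?Y,?X\<^esub> x)
            = ?l ?s (?G ((z \<otimes>\<^bsub>?Z,?Y\<^esub> y) \<otimes>\<^bsub>?Z \<otimes> ?Y,?X\<^esub> x))"
          using abc by (simp add: assoc_pure[OF V] assoc_pure[OF V'] tw pure_in_tensor)
      qed
    qed
    then show ?thesis .
  qed
  then show ?thesis using linear_map_assoc[OF V] linear_map_assoc[OF V'] by (simp add: adjoint_def)
qed

lemma adjoint_unassoc:
  "adjoint (P \<odot> Q \<odot> R) ((P \<odot> Q) \<odot> R)
    (unassoc (functionals P) (functionals Q) (functionals R)) (unassoc (vectors R) (vectors Q) (vectors P))"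
proof -
  note V = pairingD(1)[OF P] pairingD(1)[OF Q] pairingD(1)[OF R]
    and V' = pairingD(2)[OF R] pairingD(2)[OF Q] pairingD(2)[OF P]
  note u = linear_map_unassoc[OF V] linear_map_unassoc[OF V']
  show ?thesis
    unfolding adjoint_def
    using adjointD(3)[OF adjoint_assoc linear_mapD(1)[OF u(1), folded tensor_pair_sel] linear_mapD(1)[OF u(2), folded tensor_pair_sel]] u
    by (simp add: assoc_unassoc[OF V] assoc_unassoc[OF V'])
qed

lemma adjoint_triple:
  shows "adjoint (triple P Q R) (P \<odot> Q \<odot> R) (\<lambda>s. s) (assoc (vectors R) (vectors Q) (vectors P))"
    and "adjoint (P \<odot> Q \<odot> R) (triple P Q R) (\<lambda>s. s) (unassoc (vectors R) (vectors Q) (vectors P))"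
proof -
  note V' = pairingD(2)[OF R] pairingD(2)[OF Q] pairingD(2)[OF P]
  show "adjoint (triple P Q R) (P \<odot> Q \<odot> R) (\<lambda>s. s) (assoc (vectors R) (vectors Q) (vectors P))"
    using linear_map_assoc[OF V'] by (simp add: adjoint_def linear_map_id unassoc_assoc[OF V'])
  show "adjoint (P \<odot> Q \<odot> R) (triple P Q R) (\<lambda>s. s) (unassoc (vectors R) (vectors Q) (vectors P))"
    using linear_map_unassoc[OF V'] by (simp add: adjoint_def linear_map_id)
qed

end

text \<open>Transposition exchanges splitting the right factor in two with merging the first two legs, and
  (next lemma) splitting the left factor with merging the last two.  This is how comultiplications and
  coactions correspond to multiplications and actions.\<close>

lemma adjoint_to_triple_right:
  assumes R: "pairing R" and P: "pairing P" and Q: "pairing Q1" "pairing Q2"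
    and F: "adjoint P (Q1 \<odot> Q2) F G"
  shows "adjoint (R \<odot> P) (triple R Q1 Q2)
    (id_map (functionals R) (functionals P) (functionals Q1 \<otimes> functionals Q2) F)
    (map_id (vectors Q2 \<otimes> vectors Q1) (vectors P) (vectors R) G \<circ> unassoc (vectors Q2) (vectors Q1) (vectors R))"
  using adjoint_comp[OF adjoint_id_map[OF P pairing_tensor_pair[OF Q] R F] adjoint_triple(2)[OF R Q]]
  by (simp add: o_def)

lemma adjoint_to_triple_left:
  assumes R: "pairing R" and P: "pairing P" and Q: "pairing Q1" "pairing Q2"
    and F: "adjoint P (Q1 \<odot> Q2) F G"
  shows "adjoint (P \<odot> R) (triple Q1 Q2 R)
    (assoc (functionals Q1) (functionals Q2) (functionals R) \<circ>
       map_id (functionals P) (functionals Q1 \<otimes> functionals Q2) (functionals R) F)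
    (id_map (vectors R) (vectors Q2 \<otimes> vectors Q1) (vectors P) G)"
proof (rule adjoint_cong)
  note V' = pairingD(2)[OF R] pairingD(2)[OF Q(2)] pairingD(2)[OF Q(1)]
  let ?as = "assoc (functionals Q1) (functionals Q2) (functionals R)" and ?m = "map_id (functionals P) (functionals Q1 \<otimes> functionals Q2) (functionals R) F"
  show "adjoint (P \<odot> R) (triple Q1 Q2 R) ((\<lambda>s. s) \<circ> (?as \<circ> ?m))
     (id_map (vectors R) (vectors Q2 \<otimes> vectors Q1) (vectors P) G \<circ> assoc (vectors R) (vectors Q2) (vectors Q1)
       \<circ> unassoc (vectors R) (vectors Q2) (vectors Q1))"
    using adjoint_comp[OF adjoint_comp[OF adjoint_map_id[OF P pairing_tensor_pair[OF Q] R F]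
         adjoint_assoc[OF Q R]] adjoint_triple(2)[OF Q R]] by simp
  show "agree (vectors (triple Q1 Q2 R))
     (id_map (vectors R) (vectors Q2 \<otimes> vectors Q1) (vectors P) G \<circ> assoc (vectors R) (vectors Q2) (vectors Q1)
       \<circ> unassoc (vectors R) (vectors Q2) (vectors Q1))
     (id_map (vectors R) (vectors Q2 \<otimes> vectors Q1) (vectors P) G)"
    by (simp add: agree_def assoc_unassoc[OF V'])
qed (use pairing_tensor_pair pairing_triple P Q R in \<open>simp_all add: agree_def\<close>)

text \<open>Since the order of the factors is reversed, the last two legs on one side are the first two on
  the other.\<close>

lemma adjoint_leg23:
  assumes P: "pairing P" and Q: "pairing Q" and R: "pairing R" and F: "adjoint (P \<odot> Q) (Q \<odot> P) F G"
  shows "adjoint (triple R P Q) (triple R Q P) (leg23 (functionals R) (functionals P) (functionals Q) F)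
    (leg12 (vectors P) (vectors Q) (vectors R) G)"
  using adjoint_comp[OF adjoint_triple(1)[OF R P Q]
      adjoint_to_triple_right[OF R pairing_tensor_pair[OF P Q] Q P F]]
  by (simp add: leg12_def leg23_def o_def)

lemma adjoint_leg12:
  assumes P: "pairing P" and Q: "pairing Q" and R: "pairing R" and F: "adjoint (P \<odot> Q) (Q \<odot> P) F G"
  shows "adjoint (triple P Q R) (triple Q P R) (leg12 (functionals P) (functionals Q) (functionals R) F)
    (leg23 (vectors R) (vectors P) (vectors Q) G)"
proof (rule adjoint_cong)
  note V' = pairingD(2)[OF R] pairingD(2)[OF Q] pairingD(2)[OF P]
  let ?F = "assoc (functionals Q) (functionals P) (functionals R) \<circ> map_id (functionals P \<otimes> functionals Q) (functionals Q \<otimes> functionals P) (functionals R) F"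
  let ?G = "id_map (vectors R) (vectors P \<otimes> vectors Q) (vectors Q \<otimes> vectors P) G"
  have lG: "linear_map (vectors R \<otimes> vectors P \<otimes> vectors Q) (vectors R \<otimes> vectors Q \<otimes> vectors P) ?G"
    using linear_map_id_map[OF vspace_tensor vspace_tensor V'(1) adjointD(2)[OF F, simplified]] .
  show "adjoint (triple P Q R) (triple Q P R) (?F \<circ> (unassoc (functionals P) (functionals Q) (functionals R) \<circ> (\<lambda>s. s)))
     (assoc (vectors R) (vectors Q) (vectors P) \<circ> unassoc (vectors R) (vectors Q) (vectors P) \<circ> ?G)"
    using adjoint_comp[OF adjoint_comp[OF adjoint_triple(1)[OF P Q R] adjoint_unassoc[OF P Q R]]
        adjoint_to_triple_left[OF R pairing_tensor_pair[OF P Q] Q P F]] by simp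
  show "agree (vectors (triple Q P R)) (assoc (vectors R) (vectors Q) (vectors P) \<circ> unassoc (vectors R) (vectors Q) (vectors P) \<circ> ?G)
     (leg23 (vectors R) (vectors P) (vectors Q) G)"
    using linear_mapD(1)[OF lG] by (simp add: agree_def assoc_unassoc[OF V'] leg23_def)
qed (use pairing_triple P Q R in \<open>simp_all add: agree_def leg12_def\<close>)

text \<open>The ground field as a dual pair, so that counits, as maps into it, can be transposed as well.\<close>

definition scalars :: "('k::field, 'k, 'k) dual_pair" where
  "scalars = \<lparr>functionals = ground, vectors = ground, bracket = (*)\<rparr>"

lemma scalars_sel [simp]: "functionals scalars = ground" "vectors scalars = ground" "bracket scalars = (*)"
  by (simp_all add: scalars_def)

lemma pairing_scalars: "pairing scalars"
  unfolding pairing_def scalars_sel using vspace_ground bilinear_smul[OF vspace_ground] 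
  by (auto dest: spec[of _ 1])

text \<open>Identifying \<open>\<bbbK> \<otimes> X\<close> with \<open>X\<close> is transpose to inserting the scalar 1 on the other side.\<close>

lemma adjoint_lunit:
  assumes P: "pairing P"
  shows "adjoint (scalars \<odot> P) P (lunit (functionals P)) (\<lambda>x. x \<otimes>\<^bsub>vectors P,ground\<^esub> 1)"
proof -
  note V = pairingD(1,2)[OF P] and b = pairingD(3)[OF P]
  note tw = twisted[OF vspace_ground V vspace_ground pairingD(3)[OF pairing_scalars, simplified] b]
  have "bracket P (lunit (functionals P) s) x = bracket (scalars \<odot> P) s (x \<otimes>\<^bsub>vectors P,ground\<^esub> 1)"
    if s: "s \<in> carrier (ground \<otimes> functionals P)" and x: "x \<in> carrier (vectors P)" for s x
    unfolding tensor_pair_sel scalars_sel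
    by (rule tensor_ext[OF linear_map_comp[OF linear_map_lunit[OF V(1)] bilinear_mapD(2)[OF b x], unfolded o_def]
          bilinear_mapD(2)[OF tw(1) pure_in_tensor[OF x]] _ s])
      (use x in \<open>simp_all add: tw(2) lunit_pure[OF V(1)] linear_mapD(3)[OF bilinear_mapD(2)[OF b x]]\<close>)
  then show ?thesis
    using linear_map_lunit[OF V(1)] bilinear_mapD(2)[OF bilinear_pure_tensor[OF V(2) vspace_ground], of 1]
    by (simp add: adjoint_def)
qed

lemma adjoint_runit:
  assumes P: "pairing P"
  shows "adjoint (P \<odot> scalars) P (runit (functionals P)) (\<lambda>x. 1 \<otimes>\<^bsub>ground,vectors P\<^esub> x)"
proof -
  note V = pairingD(1,2)[OF P] and b = pairingD(3)[OF P]
  note tw = twisted[OF V(1) vspace_ground vspace_ground V(2) b pairingD(3)[OF pairing_scalars, simplified]]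
  have "bracket P (runit (functionals P) s) x = bracket (P \<odot> scalars) s (1 \<otimes>\<^bsub>ground,vectors P\<^esub> x)"
    if s: "s \<in> carrier (functionals P \<otimes> ground)" and x: "x \<in> carrier (vectors P)" for s x
    unfolding tensor_pair_sel scalars_sel
    by (rule tensor_ext[OF linear_map_comp[OF linear_map_runit[OF V(1)] bilinear_mapD(2)[OF b x], unfolded o_def]
          bilinear_mapD(2)[OF tw(1) pure_in_tensor[OF _ x]] _ s])
      (use x in \<open>simp_all add: tw(2) runit_pure[OF V(1)] linear_mapD(3)[OF bilinear_mapD(2)[OF b x]]\<close>)
  then show ?thesis
    using linear_map_runit[OF V(1)] bilinear_mapD(1)[OF bilinear_pure_tensor[OF vspace_ground V(2)], of 1]
    by (simp add: adjoint_def)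
qed

lemma adjoint_eval:
  assumes P: "pairing P" and e: "e \<in> carrier (vectors P)"
  shows "adjoint P scalars (\<lambda>a. bracket P a e) (\<lambda>c. smul (vectors P) c e)"
  using bilinear_mapD(2)[OF pairingD(3)[OF P] e] linear_mapD(3)[OF bilinear_mapD(1)[OF pairingD(3)[OF P]] e]
    bilinear_mapD(2)[OF bilinear_smul[OF pairingD(2)[OF P]] e]
  by (simp add: adjoint_def mult.commute)

section \<open>Inverse braidings\<close>

lemma linear_map_leg12:
  assumes "vspace X" "vspace Y" "vspace Z" "linear_map (X \<otimes> Y) (Y \<otimes> X) \<Psi>"
  shows "linear_map (X \<otimes> Y \<otimes> Z) (Y \<otimes> X \<otimes> Z) (leg12 X Y Z \<Psi>)"
  unfolding leg12_def
  by (rule linear_map_comp[OF linear_map_unassoc[OF assms(1-3)]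
        linear_map_comp[OF linear_map_map_id[OF vspace_tensor vspace_tensor assms(3,4)]
          linear_map_assoc[OF assms(2,1,3)]]])

lemma linear_map_leg23:
  assumes "vspace X" "vspace Y" "vspace Z" "linear_map (X \<otimes> Y) (Y \<otimes> X) \<Psi>"
  shows "linear_map (Z \<otimes> X \<otimes> Y) (Z \<otimes> Y \<otimes> X) (leg23 Z X Y \<Psi>)"
  unfolding leg23_def by (intro linear_map_id_map vspace_tensor assms)

text \<open>Braiding two legs before merging them amounts to merging with the composed map.  Read from right to
  left, this extracts the inverse braidings from \<open>m \<circ> \<Psi>\<^sup>-\<^sup>1\<close> and \<open>\<nu> \<circ> \<Psi>\<^sup>-\<^sup>1\<close>.\<close>

lemma contract_leg12:
  assumes V: "vspace X" "vspace Y" "vspace Z" "vspace A" and \<Psi>: "linear_map (X \<otimes> Y) (Y \<otimes> X) \<Psi>"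
    and f: "linear_map (Y \<otimes> X) A f" and t: "t \<in> carrier (X \<otimes> Y \<otimes> Z)"
  shows "map_id (Y \<otimes> X) A Z f (unassoc Y X Z (leg12 X Y Z \<Psi> t))
    = map_id (X \<otimes> Y) A Z (f \<circ> \<Psi>) (unassoc X Y Z t)"
proof -
  have u: "unassoc X Y Z t \<in> carrier ((X \<otimes> Y) \<otimes> Z)"
    by (rule linear_mapD(1)[OF linear_map_unassoc[OF V(1-3)] t])
  show ?thesis
    using unassoc_assoc[OF V(2,1,3) linear_mapD(1)[OF linear_map_map_id[OF vspace_tensor vspace_tensor V(3) \<Psi>] u]]
      map_id_comp[OF vspace_tensor vspace_tensor V(4,3) \<Psi> f u] by (simp add: leg12_def)
qed

lemma contract_leg23:
  assumes V: "vspace X" "vspace Y" "vspace Z" "vspace A" and \<Psi>: "linear_map (X \<otimes> Y) (Y \<otimes> X) \<Psi>"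
    and f: "linear_map (Y \<otimes> X) A f" and t: "t \<in> carrier (Z \<otimes> X \<otimes> Y)"
  shows "id_map Z (Y \<otimes> X) A f (leg23 Z X Y \<Psi> t) = id_map Z (X \<otimes> Y) A (f \<circ> \<Psi>) t"
  using id_map_comp[OF vspace_tensor vspace_tensor V(4,3) \<Psi> f t] by (simp add: leg23_def)

lemma linear_map_contract12:
  assumes "vspace X" "vspace Y" "vspace Z" "vspace A" "linear_map (X \<otimes> Y) A f"
  shows "linear_map (X \<otimes> Y \<otimes> Z) (A \<otimes> Z) (map_id (X \<otimes> Y) A Z f \<circ> unassoc X Y Z)"
  by (intro linear_map_comp[OF linear_map_unassoc linear_map_map_id] vspace_tensor assms)

lemma map_id_ident:
  assumes "vspace X" "vspace A" "\<And>x. x \<in> carrier X \<Longrightarrow> f x = x" "t \<in> carrier (X \<otimes> A)"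
  shows "map_id X X A f t = t"
  unfolding map_id_def by (rule tmap_id[OF assms(1,2,3) _ assms(4)]) simp_all

lemma id_map_ident:
  assumes "vspace X" "vspace A" "\<And>x. x \<in> carrier X \<Longrightarrow> f x = x" "t \<in> carrier (A \<otimes> X)"
  shows "id_map A X X f t = t"
  unfolding id_map_def by (rule tmap_id[OF assms(2,1) _ assms(3,4)]) simp_all

lemma leg12_inverse:
  assumes V: "vspace X" "vspace Y" "vspace Z"
    and f: "linear_map (X \<otimes> Y) (Y \<otimes> X) f" and g: "linear_map (Y \<otimes> X) (X \<otimes> Y) g"
    and gf: "\<And>x. x \<in> carrier (X \<otimes> Y) \<Longrightarrow> g (f x) = x" and t: "t \<in> carrier (X \<otimes> Y \<otimes> Z)"
  shows "leg12 Y X Z g (leg12 X Y Z f t) = t"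
proof -
  have u: "unassoc X Y Z t \<in> carrier ((X \<otimes> Y) \<otimes> Z)"
    by (rule linear_mapD(1)[OF linear_map_unassoc[OF V] t])
  have "leg12 Y X Z g (leg12 X Y Z f t) = assoc X Y Z (map_id (X \<otimes> Y) (X \<otimes> Y) Z (g \<circ> f) (unassoc X Y Z t))"
    using contract_leg12[OF V vspace_tensor f g t] by (simp add: leg12_def[of Y X Z g])
  also have "\<dots> = t"
    using map_id_ident[OF vspace_tensor V(3) _ u, of "g \<circ> f"] gf assoc_unassoc[OF V t] by simp
  finally show ?thesis .
qed

lemma leg23_inverse:
  assumes V: "vspace X" "vspace Y" "vspace Z"
    and f: "linear_map (X \<otimes> Y) (Y \<otimes> X) f" and g: "linear_map (Y \<otimes> X) (X \<otimes> Y) g"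
    and gf: "\<And>x. x \<in> carrier (X \<otimes> Y) \<Longrightarrow> g (f x) = x" and t: "t \<in> carrier (Z \<otimes> X \<otimes> Y)"
  shows "leg23 Z Y X g (leg23 Z X Y f t) = t"
  using contract_leg23[OF V vspace_tensor f g t] id_map_ident[OF vspace_tensor V(3) _ t, of "g \<circ> f"] gf
  by (simp add: leg23_def)

context
  fixes X :: "('k::field, 'x::ab_group_add) vs" and Y :: "('k, 'y::ab_group_add) vs" and \<Psi>
  assumes X: "vspace X" and Y: "vspace Y" and \<Psi>: "linear_iso (X \<otimes> Y) (Y \<otimes> X) \<Psi>"
begin

lemmas tinv = linear_iso_inv[OF vspace_tensor \<Psi>, folded tinv_def]
lemmas linear_tinv = linear_isoD[OF tinv(1)]

lemma leg12_tinv: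
  assumes "vspace Z"
  shows "t \<in> carrier (X \<otimes> Y \<otimes> Z) \<Longrightarrow> leg12 Y X Z (tinv X Y \<Psi>) (leg12 X Y Z \<Psi> t) = t"
    and "s \<in> carrier (Y \<otimes> X \<otimes> Z) \<Longrightarrow> leg12 X Y Z \<Psi> (leg12 Y X Z (tinv X Y \<Psi>) s) = s"
    and "t \<in> carrier (X \<otimes> Y \<otimes> Z) \<Longrightarrow> leg12 X Y Z \<Psi> t \<in> carrier (Y \<otimes> X \<otimes> Z)"
    and "s \<in> carrier (Y \<otimes> X \<otimes> Z) \<Longrightarrow> leg12 Y X Z (tinv X Y \<Psi>) s \<in> carrier (X \<otimes> Y \<otimes> Z)"
  using leg12_inverse[OF X Y assms linear_isoD[OF \<Psi>] linear_tinv, OF tinv(2)]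
    leg12_inverse[OF Y X assms linear_tinv linear_isoD[OF \<Psi>], OF tinv(3)]
    linear_mapD(1)[OF linear_map_leg12[OF X Y assms linear_isoD[OF \<Psi>]]]
    linear_mapD(1)[OF linear_map_leg12[OF Y X assms linear_tinv]] by auto

lemma leg23_tinv:
  assumes "vspace Z"
  shows "t \<in> carrier (Z \<otimes> X \<otimes> Y) \<Longrightarrow> leg23 Z Y X (tinv X Y \<Psi>) (leg23 Z X Y \<Psi> t) = t"
    and "s \<in> carrier (Z \<otimes> Y \<otimes> X) \<Longrightarrow> leg23 Z X Y \<Psi> (leg23 Z Y X (tinv X Y \<Psi>) s) = s"
    and "t \<in> carrier (Z \<otimes> X \<otimes> Y) \<Longrightarrow> leg23 Z X Y \<Psi> t \<in> carrier (Z \<otimes> Y \<otimes> X)"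
    and "s \<in> carrier (Z \<otimes> Y \<otimes> X) \<Longrightarrow> leg23 Z Y X (tinv X Y \<Psi>) s \<in> carrier (Z \<otimes> X \<otimes> Y)"
  using leg23_inverse[OF X Y assms linear_isoD[OF \<Psi>] linear_tinv, OF tinv(2)]
    leg23_inverse[OF Y X assms linear_tinv linear_isoD[OF \<Psi>], OF tinv(3)]
    linear_mapD(1)[OF linear_map_leg23[OF X Y assms linear_isoD[OF \<Psi>]]]
    linear_mapD(1)[OF linear_map_leg23[OF Y X assms linear_tinv]] by auto

end

lemma braidedD:
  assumes "braided V \<Psi>"
  shows "vspace V" "linear_iso (V \<otimes> V) (V \<otimes> V) \<Psi>"
    and "t \<in> carrier (V \<otimes> V \<otimes> V) \<Longrightarrow> leg12 V V V \<Psi> (leg23 V V V \<Psi> (leg12 V V V \<Psi> t))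
      = leg23 V V V \<Psi> (leg12 V V V \<Psi> (leg23 V V V \<Psi> t))"
  using assms by (auto simp: braided_def agree_def)

lemma left_braidedD:
  assumes "left_braided H \<Psi> V \<Phi>"
  shows "braided H \<Psi>" "vspace V" "linear_iso (H \<otimes> V) (V \<otimes> H) \<Phi>"
    and "t \<in> carrier (H \<otimes> H \<otimes> V) \<Longrightarrow> leg12 H V H \<Phi> (leg23 H H V \<Phi> (leg12 H H V \<Psi> t))
      = leg23 V H H \<Psi> (leg12 H V H \<Phi> (leg23 H H V \<Phi> t))"
  using assms by (auto simp: left_braided_def agree_def)

lemma right_braidedD:
  assumes "right_braided H \<Psi> V \<Phi>"
  shows "braided H \<Psi>" "vspace V" "linear_iso (V \<otimes> H) (H \<otimes> V) \<Phi>"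
    and "t \<in> carrier (V \<otimes> H \<otimes> H) \<Longrightarrow> leg23 H V H \<Phi> (leg12 V H H \<Phi> (leg23 V H H \<Psi> t))
      = leg12 H H V \<Psi> (leg23 H V H \<Phi> (leg12 V H H \<Phi> t))"
  using assms by (auto simp: right_braided_def agree_def)

lemma braided_tinv:
  assumes "braided V \<Psi>"
  shows "braided V (tinv V V \<Psi>)"
proof -
  note b = braidedD[OF assms]
  note l12 = leg12_tinv[OF b(1,1,2,1)] and l23 = leg23_tinv[OF b(1,1,2,1)]
  let ?R12 = "leg12 V V V (tinv V V \<Psi>)" and ?R23 = "leg23 V V V (tinv V V \<Psi>)"
  have "?R12 (?R23 (?R12 t)) = ?R23 (?R12 (?R23 t))" if t: "t \<in> carrier (V \<otimes> V \<otimes> V)" for t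
  proof -
    \<comment> \<open>The relation for \<open>\<Psi>\<close>, applied to \<open>r\<close>, has \<open>t\<close> on its left-hand side; the three braidings on the
      other side are then peeled off by their inverses.\<close>
    define r where "r = ?R12 (?R23 (?R12 t))"
    have r: "r \<in> carrier (V \<otimes> V \<otimes> V)" using t by (simp add: r_def l12 l23)
    have "t = leg23 V V V \<Psi> (leg12 V V V \<Psi> (leg23 V V V \<Psi> r))"
      using b(3)[OF r] t by (simp add: r_def l12 l23)
    then have "?R23 (?R12 (?R23 t)) = r" using r by (simp add: l12 l23)
    then show ?thesis by (simp add: r_def)
  qed
  then show ?thesis using b(1) tinv(1)[OF b(1,1,2)] by (simp add: braided_def agree_def)
qed

text \<open>Inverting the mixed braid relation reverses the order of the three braidings, and it exchanges the two
  sides on which \<open>V\<close> stands relative to \<open>H\<close>.\<close>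

lemma right_braided_tinv:
  assumes "left_braided H \<Psi> V \<Phi>"
  shows "right_braided H (tinv H H \<Psi>) V (tinv H V \<Phi>)"
proof -
  note b = left_braidedD[OF assms]
  note bH = braidedD[OF b(1)]
  note l = leg12_tinv[OF bH(1,1,2)] leg23_tinv[OF bH(1,1,2)] leg12_tinv[OF bH(1) b(2,3)] leg23_tinv[OF bH(1) b(2,3)]
  note l = l[OF bH(1)] l[OF b(2)]
  let ?R = "tinv H H \<Psi>" and ?S = "tinv H V \<Phi>"
  have "leg23 H V H ?S (leg12 V H H ?S (leg23 V H H ?R t)) = leg12 H H V ?R (leg23 H V H ?S (leg12 V H H ?S t))"
    (is "?l = ?r") if t: "t \<in> carrier (V \<otimes> H \<otimes> H)" for t
  proof -
    define r where "r = ?r"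
    have r: "r \<in> carrier (H \<otimes> H \<otimes> V)" using t by (simp add: r_def l)
    have "t = leg23 V H H \<Psi> (leg12 H V H \<Phi> (leg23 H H V \<Phi> r))"
      using b(4)[OF r] t by (simp add: r_def l)
    then have "?l = r" using r by (simp add: l)
    then show ?thesis by (simp add: r_def)
  qed
  then show ?thesis
    using braided_tinv[OF b(1)] b(2) tinv(1)[OF bH(1) b(2,3)] by (simp add: right_braided_def agree_def)
qed

lemma left_braided_tinv:
  assumes "right_braided H \<Psi> V \<Phi>"
  shows "left_braided H (tinv H H \<Psi>) V (tinv V H \<Phi>)"
proof -
  note b = right_braidedD[OF assms]
  note bH = braidedD[OF b(1)]
  note l = leg12_tinv[OF bH(1,1,2)] leg23_tinv[OF bH(1,1,2)] leg12_tinv[OF b(2) bH(1) b(3)] leg23_tinv[OF b(2) bH(1) b(3)]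
  note l = l[OF bH(1)] l[OF b(2)]
  let ?R = "tinv H H \<Psi>" and ?S = "tinv V H \<Phi>"
  have "leg12 H V H ?S (leg23 H H V ?S (leg12 H H V ?R t)) = leg23 V H H ?R (leg12 H V H ?S (leg23 H H V ?S t))"
    (is "?l = ?r") if t: "t \<in> carrier (H \<otimes> H \<otimes> V)" for t
  proof -
    define r where "r = ?r"
    have r: "r \<in> carrier (V \<otimes> H \<otimes> H)" using t by (simp add: r_def l)
    have "t = leg12 H H V \<Psi> (leg23 H V H \<Phi> (leg12 V H H \<Phi> r))"
      using b(4)[OF r] t by (simp add: r_def l)
    then have "?l = r" using r by (simp add: l)
    then show ?thesis by (simp add: r_def)
  qed
  then show ?thesis
    using braided_tinv[OF b(1)] b(2) tinv(1)[OF b(2) bH(1) b(3)] by (simp add: left_braided_def agree_def)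
qed

lemma unital_algebraD:
  assumes "unital_algebra A m e"
  shows "vspace A" "linear_map (A \<otimes> A) A m" "e \<in> carrier A"
    and "t \<in> carrier (A \<otimes> A \<otimes> A) \<Longrightarrow>
      m (map_id (A \<otimes> A) A A m (unassoc A A A t)) = m (id_map A (A \<otimes> A) A m t)"
    and "a \<in> carrier A \<Longrightarrow> m (e \<otimes>\<^bsub>A,A\<^esub> a) = a" "a \<in> carrier A \<Longrightarrow> m (a \<otimes>\<^bsub>A,A\<^esub> e) = a"
  using assms by (auto simp: unital_algebra_def agree_def)

lemma mult_compat_leftD:
  assumes "mult_compat_left H m e V \<Phi>"
  shows "t \<in> carrier (H \<otimes> H \<otimes> V) \<Longrightarrow> \<Phi> (map_id (H \<otimes> H) H V m (unassoc H H V t))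
      = id_map V (H \<otimes> H) H m (leg12 H V H \<Phi> (leg23 H H V \<Phi> t))"
    and "v \<in> carrier V \<Longrightarrow> \<Phi> (e \<otimes>\<^bsub>H,V\<^esub> v) = v \<otimes>\<^bsub>V,H\<^esub> e"
  using assms by (auto simp: mult_compat_left_def agree_def)

lemma mult_compat_rightD:
  assumes "mult_compat_right H m e V \<Phi>"
  shows "t \<in> carrier (V \<otimes> H \<otimes> H) \<Longrightarrow> \<Phi> (id_map V (H \<otimes> H) H m t)
      = map_id (H \<otimes> H) H V m (unassoc H H V (leg23 H V H \<Phi> (leg12 V H H \<Phi> t)))"
    and "v \<in> carrier V \<Longrightarrow> \<Phi> (v \<otimes>\<^bsub>V,H\<^esub> e) = e \<otimes>\<^bsub>H,V\<^esub> v"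
  using assms by (auto simp: mult_compat_right_def agree_def)

context
  fixes H :: "('k::field, 'h::ab_group_add) vs" and V :: "('k, 'v::ab_group_add) vs" and m e
  assumes H: "vspace H" and m: "linear_map (H \<otimes> H) H m" and e: "e \<in> carrier H"
    and V: "vspace V"
begin

text \<open>The inverse braiding carries \<open>V\<close> past \<open>H\<close> in the other direction, so compatibility with
  the left factor becomes compatibility with the right factor.\<close>

lemma mult_compat_tinv_left:
  assumes \<Phi>: "linear_iso (H \<otimes> V) (V \<otimes> H) \<Phi>" and c: "mult_compat_left H m e V \<Phi>"
  shows "mult_compat_right H m e V (tinv H V \<Phi>)"
proof -
  note c = mult_compat_leftD[OF c] and T = tinv[OF H V \<Phi>]
  note l = leg12_tinv[OF H V \<Phi> H] leg23_tinv[OF H V \<Phi> H]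
  let ?S = "tinv H V \<Phi>" and ?m12 = "\<lambda>t. map_id (H \<otimes> H) H V m (unassoc H H V t)"
  have m12: "?m12 t \<in> carrier (H \<otimes> V)" if "t \<in> carrier (H \<otimes> H \<otimes> V)" for t
    using linear_mapD(1)[OF linear_map_contract12[OF H H V H m] that] by simp
  have "?S (id_map V (H \<otimes> H) H m t) = ?m12 (leg23 H V H ?S (leg12 V H H ?S t))" (is "_ = map_id (H \<otimes> H) H V m (unassoc H H V ?t)")
    if t: "t \<in> carrier (V \<otimes> H \<otimes> H)" for t
    using t c(1)[of ?t] T(2)[OF m12, of ?t] by (simp add: l)
  moreover have "?S (v \<otimes>\<^bsub>V,H\<^esub> e) = e \<otimes>\<^bsub>H,V\<^esub> v" if "v \<in> carrier V" for v
    using c(2)[OF that] T(2)[OF pure_in_tensor[OF e that]] by simp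
  ultimately show ?thesis by (simp add: mult_compat_right_def agree_def)
qed

lemma mult_compat_tinv_right:
  assumes \<Phi>: "linear_iso (V \<otimes> H) (H \<otimes> V) \<Phi>" and c: "mult_compat_right H m e V \<Phi>"
  shows "mult_compat_left H m e V (tinv V H \<Phi>)"
proof -
  note c = mult_compat_rightD[OF c] and T = tinv[OF V H \<Phi>]
  note l = leg12_tinv[OF V H \<Phi> H] leg23_tinv[OF V H \<Phi> H]
  let ?S = "tinv V H \<Phi>" and ?m12 = "\<lambda>t. map_id (H \<otimes> H) H V m (unassoc H H V t)"
  have m23: "id_map V (H \<otimes> H) H m t \<in> carrier (V \<otimes> H)" if "t \<in> carrier (V \<otimes> H \<otimes> H)" for t
    using linear_mapD(1)[OF linear_map_id_map[OF vspace_tensor H V m] that] .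
  have "?S (?m12 t) = id_map V (H \<otimes> H) H m (leg12 H V H ?S (leg23 H H V ?S t))" (is "_ = id_map V (H \<otimes> H) H m ?t")
    if t: "t \<in> carrier (H \<otimes> H \<otimes> V)" for t
    using t c(1)[of ?t] T(2)[OF m23, of ?t] by (simp add: l)
  moreover have "?S (e \<otimes>\<^bsub>H,V\<^esub> v) = v \<otimes>\<^bsub>V,H\<^esub> e" if "v \<in> carrier V" for v
    using c(2)[OF that] T(2)[OF pure_in_tensor[OF that e]] by simp
  ultimately show ?thesis by (simp add: mult_compat_left_def agree_def)
qed

text \<open>Compatibility survives the passage to \<open>m \<circ> R\<close>, because the braid relation moves \<open>R\<close> from
  the two algebra legs before \<open>S\<close> to the two algebra legs after it.\<close>

lemma mult_compat_right_opposite: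
  assumes b: "right_braided H R V S" and c: "mult_compat_right H m e V S"
  shows "mult_compat_right H (m \<circ> R) e V S"
proof -
  note b = right_braidedD[OF b] and c = mult_compat_rightD[OF c]
  note R = linear_isoD[OF braidedD(2)[OF b(1)]] and S = linear_isoD[OF b(3)]
  note l = linear_mapD(1)[OF linear_map_leg12[OF V H H S]] linear_mapD(1)[OF linear_map_leg23[OF V H H S]]
     linear_mapD(1)[OF linear_map_leg23[OF H H V R]]
  have "S (id_map V (H \<otimes> H) H (m \<circ> R) t)
      = map_id (H \<otimes> H) H V (m \<circ> R) (unassoc H H V (leg23 H V H S (leg12 V H H S t)))"
    if t: "t \<in> carrier (V \<otimes> H \<otimes> H)" for t
    using t c(1)[of "leg23 V H H R t"] b(4)[OF t] contract_leg23[OF H H V H R m t]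
      contract_leg12[OF H H V H R m, of "leg23 H V H S (leg12 V H H S t)"]
    by (simp add: l)
  then show ?thesis using c(2) by (simp add: mult_compat_right_def agree_def)
qed

lemma mult_compat_left_opposite:
  assumes b: "left_braided H R V S" and c: "mult_compat_left H m e V S"
  shows "mult_compat_left H (m \<circ> R) e V S"
proof -
  note b = left_braidedD[OF b] and c = mult_compat_leftD[OF c]
  note R = linear_isoD[OF braidedD(2)[OF b(1)]] and S = linear_isoD[OF b(3)]
  note l = linear_mapD(1)[OF linear_map_leg12[OF H V H S]] linear_mapD(1)[OF linear_map_leg23[OF H V H S]]
     linear_mapD(1)[OF linear_map_leg12[OF H H V R]]
  have "S (map_id (H \<otimes> H) H V (m \<circ> R) (unassoc H H V t))
      = id_map V (H \<otimes> H) H (m \<circ> R) (leg12 H V H S (leg23 H H V S t))"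
    if t: "t \<in> carrier (H \<otimes> H \<otimes> V)" for t
    using t c(1)[of "leg12 H H V R t"] b(4)[OF t] contract_leg12[OF H H V H R m t]
      contract_leg23[OF H H V H R m, of "leg12 H V H S (leg23 H H V S t)"]
    by (simp add: l)
  then show ?thesis using c(2) by (simp add: mult_compat_left_def agree_def)
qed

end

lemma braided_imp_left_right_braided:
  assumes "braided H \<Psi>"
  shows "left_braided H \<Psi> H \<Psi>" "right_braided H \<Psi> H \<Psi>"
  using assms by (auto simp: left_braided_def right_braided_def braided_def agree_def)

text \<open>With \<open>R = \<Psi>\<^sup>-\<^sup>1\<close>, compatibility of \<open>R\<close> with \<open>m\<close> reduces the two sides of the associativity
  law for \<open>m \<circ> R\<close> to the two products of three factors, preceded by \<open>R\<^sub>1\<^sub>2 R\<^sub>2\<^sub>3 R\<^sub>1\<^sub>2\<close> and by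
  \<open>R\<^sub>2\<^sub>3 R\<^sub>1\<^sub>2 R\<^sub>2\<^sub>3\<close>.  These agree by the braid relation.\<close>

theorem braided_unital_algebra_opposite:
  assumes A: "braided_unital_algebra H m e \<Psi>"
  shows "braided_unital_algebra H (m \<circ> tinv H H \<Psi>) e (tinv H H \<Psi>)"
proof -
  let ?R = "tinv H H \<Psi>"
  have u: "unital_algebra H m e" and b: "braided H \<Psi>"
    and c: "mult_compat_left H m e H \<Psi>" "mult_compat_right H m e H \<Psi>"
    using A by (auto simp: braided_unital_algebra_def)
  note u = unital_algebraD[OF u] and \<Psi> = braidedD(2)[OF b]
  note bR = braided_tinv[OF b]
  note c' = mult_compat_tinv_right[OF u(1-3,1) \<Psi> c(2)] mult_compat_tinv_left[OF u(1-3,1) \<Psi> c(1)]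
  note d = mult_compat_leftD[OF c'(1)] mult_compat_rightD[OF c'(2)]
  note R = linear_isoD[OF braidedD(2)[OF bR]]
  note l = linear_mapD(1)[OF linear_map_leg12[OF u(1,1,1) R]] linear_mapD(1)[OF linear_map_leg23[OF u(1,1,1) R]]
  have "unital_algebra H (m \<circ> ?R) e"
    unfolding unital_algebra_def
  proof (intro conjI ballI)
    show "vspace H" "e \<in> carrier H" by (fact u)+
    show "linear_map (H \<otimes> H) H (m \<circ> ?R)" by (rule linear_map_comp[OF R u(2)])
    show "(m \<circ> ?R) (e \<otimes>\<^bsub>H,H\<^esub> a) = a" "(m \<circ> ?R) (a \<otimes>\<^bsub>H,H\<^esub> e) = a" if "a \<in> carrier H" for a
      using d(2,4)[OF that] u(5,6)[OF that] by simp_all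
    have "(m \<circ> ?R) (map_id (H \<otimes> H) H H (m \<circ> ?R) (unassoc H H H t)) = (m \<circ> ?R) (id_map H (H \<otimes> H) H (m \<circ> ?R) t)"
      if t: "t \<in> carrier (H \<otimes> H \<otimes> H)" for t
      using t by (simp add: contract_leg12[OF u(1,1,1,1) R u(2), symmetric]
          contract_leg23[OF u(1,1,1,1) R u(2), symmetric] d(1,3) l u(4) braidedD(3)[OF bR])
    then show "agree (H \<otimes> H \<otimes> H) (m \<circ> ?R \<circ> map_id (H \<otimes> H) H H (m \<circ> ?R) \<circ> unassoc H H H)
        (m \<circ> ?R \<circ> id_map H (H \<otimes> H) H (m \<circ> ?R))" by (simp add: agree_def)
  qed
  then show ?thesis
    using bR mult_compat_left_opposite[OF u(1-3,1) braided_imp_left_right_braided(1)[OF bR] c'(1)]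
      mult_compat_right_opposite[OF u(1-3,1) braided_imp_left_right_braided(2)[OF bR] c'(2)]
    by (simp add: braided_unital_algebra_def)
qed

text \<open>Let \<open>R\<close> and \<open>S\<close> be the inverse braidings.  Solving the module compatibility for the inverse
  braiding gives \<open>S (\<nu> \<otimes> id) = (id \<otimes> \<nu>) R\<^sub>1\<^sub>2 S\<^sub>2\<^sub>3\<close>.  Applying \<open>S\<close> on the first two legs beforehand and using
  the braid relation yields
  \<open>S ((\<nu> \<circ> S) \<otimes> id) = (id \<otimes> \<nu>) S\<^sub>2\<^sub>3 S\<^sub>1\<^sub>2 R\<^sub>2\<^sub>3\<close>,
  from which both the action law and the compatibility of the new action follow.\<close>

theorem braided_right_module_opposite:
  assumes M: "braided_left_module H m e \<Psi> V \<Phi> \<nu>"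
  shows "braided_right_module H (m \<circ> tinv H H \<Psi>) e (tinv H H \<Psi>) V (tinv H V \<Phi>) (\<nu> \<circ> tinv H V \<Phi>)"
proof -
  let ?R = "tinv H H \<Psi>" and ?S = "tinv H V \<Phi>"
  have A: "braided_unital_algebra H m e \<Psi>" and lb: "left_braided H \<Psi> V \<Phi>"
    and c: "mult_compat_left H m e V \<Phi>" and \<nu>: "linear_map (H \<otimes> V) V \<nu>"
    and act: "\<And>t. t \<in> carrier (H \<otimes> H \<otimes> V) \<Longrightarrow>
      \<nu> (id_map H (H \<otimes> V) V \<nu> t) = \<nu> (map_id (H \<otimes> H) H V m (unassoc H H V t))"
    and unit: "\<And>v. v \<in> carrier V \<Longrightarrow> \<nu> (e \<otimes>\<^bsub>H,V\<^esub> v) = v"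
    and comp: "\<And>t. t \<in> carrier (H \<otimes> H \<otimes> V) \<Longrightarrow> \<Phi> (id_map H (H \<otimes> V) V \<nu> t)
      = map_id (H \<otimes> V) V H \<nu> (unassoc H V H (leg23 H H V \<Phi> (leg12 H H V \<Psi> t)))"
    using M by (auto simp: braided_left_module_def agree_def)
  have u: "unital_algebra H m e" and b: "braided H \<Psi>"
    using A by (auto simp: braided_unital_algebra_def)
  note u = unital_algebraD[OF u] and \<Psi> = braidedD(2)[OF b] and V = left_braidedD(2)[OF lb] and \<Phi> = left_braidedD(3)[OF lb]
  note rb = right_braided_tinv[OF lb]
  note c' = mult_compat_tinv_left[OF u(1-3) V \<Phi> c]
  note d = mult_compat_rightD[OF c'] and yb = right_braidedD(4)[OF rb]
  note R = linear_tinv[OF u(1,1) \<Psi>] and S = linear_tinv[OF u(1) V \<Phi>]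
  note l = leg12_tinv[OF u(1,1) \<Psi> V] leg23_tinv[OF u(1,1) \<Psi> V]
    leg12_tinv[OF u(1) V \<Phi> u(1)] leg23_tinv[OF u(1) V \<Phi> u(1)]
  have \<nu>23: "id_map H (H \<otimes> V) V \<nu> t \<in> carrier (H \<otimes> V)" if "t \<in> carrier (H \<otimes> H \<otimes> V)" for t
    by (rule linear_mapD(1)[OF linear_map_id_map[OF vspace_tensor V u(1) \<nu>] that])
  \<comment> \<open>The compatibility of braiding and action, solved for the inverse braiding.\<close>
  have comp': "?S (map_id (H \<otimes> V) V H \<nu> (unassoc H V H t))
      = id_map H (H \<otimes> V) V \<nu> (leg12 H H V ?R (leg23 H V H ?S t))" (is "_ = id_map H (H \<otimes> V) V \<nu> ?t")
    if t: "t \<in> carrier (H \<otimes> V \<otimes> H)" for t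
    using t comp[of ?t] tinv(2)[OF u(1) V \<Phi> \<nu>23, of ?t] by (simp add: l)
  note simps = contract_leg12[OF V u(1,1) V S \<nu>, symmetric] contract_leg23[OF V u(1,1) V S \<nu>, symmetric]
    contract_leg23[OF u(1,1) V u(1) R u(2), symmetric] 
  show ?thesis
    unfolding braided_right_module_def
  proof (intro conjI ballI)
    show "braided_unital_algebra H (m \<circ> ?R) e ?R" by (rule braided_unital_algebra_opposite[OF A])
    show "right_braided H ?R V ?S" by (rule rb)
    show "mult_compat_right H (m \<circ> ?R) e V ?S"
      by (rule mult_compat_right_opposite[OF u(1-3) V rb c'])
    show "linear_map (V \<otimes> H) V (\<nu> \<circ> ?S)" by (rule linear_map_comp[OF S \<nu>])
    show "(\<nu> \<circ> ?S) (v \<otimes>\<^bsub>V,H\<^esub> e) = v" if "v \<in> carrier V" for v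
      using d(2)[OF that] unit[OF that] by simp
    have key: "?S (map_id (V \<otimes> H) V H (\<nu> \<circ> ?S) (unassoc V H H t))
        = id_map H (H \<otimes> V) V \<nu> (leg23 H V H ?S (leg12 V H H ?S (leg23 V H H ?R t)))"
      if t: "t \<in> carrier (V \<otimes> H \<otimes> H)" for t
      using comp'[OF l(12)[OF t]] yb[OF t] t by (simp add: simps)
    have "?S (map_id (V \<otimes> H) V H (\<nu> \<circ> ?S) (unassoc V H H t))
        = id_map H (V \<otimes> H) V (\<nu> \<circ> ?S) (leg12 V H H ?S (leg23 V H H ?R t))"
      if t: "t \<in> carrier (V \<otimes> H \<otimes> H)" for t
      unfolding key[OF t] using t by (simp only: simps l)
    then show "agree (V \<otimes> H \<otimes> H) (?S \<circ> map_id (V \<otimes> H) V H (\<nu> \<circ> ?S) \<circ> unassoc V H H)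
        (id_map H (V \<otimes> H) V (\<nu> \<circ> ?S) \<circ> leg12 V H H ?S \<circ> leg23 V H H ?R)"
      by (simp add: agree_def)
    have "\<nu> (?S (map_id (V \<otimes> H) V H (\<nu> \<circ> ?S) (unassoc V H H t)))
        = \<nu> (?S (id_map V (H \<otimes> H) H (m \<circ> ?R) t))"
      if t: "t \<in> carrier (V \<otimes> H \<otimes> H)" for t
      unfolding key[OF t] using t by (simp add: simps l act d)
    then show "agree (V \<otimes> H \<otimes> H) (\<nu> \<circ> ?S \<circ> map_id (V \<otimes> H) V H (\<nu> \<circ> ?S) \<circ> unassoc V H H)
        (\<nu> \<circ> ?S \<circ> id_map V (H \<otimes> H) H (m \<circ> ?R))"
      by (simp add: agree_def)
  qed
qed

text \<open>The mirror image: now \<open>S (id \<otimes> (\<nu> \<circ> S)) = (\<nu> \<otimes> id) S\<^sub>1\<^sub>2 S\<^sub>2\<^sub>3 R\<^sub>1\<^sub>2\<close>.\<close>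

theorem braided_left_module_opposite:
  assumes M: "braided_right_module H m e \<Psi> V \<Phi> \<nu>"
  shows "braided_left_module H (m \<circ> tinv H H \<Psi>) e (tinv H H \<Psi>) V (tinv V H \<Phi>) (\<nu> \<circ> tinv V H \<Phi>)"
proof -
  let ?R = "tinv H H \<Psi>" and ?S = "tinv V H \<Phi>"
  have A: "braided_unital_algebra H m e \<Psi>" and rb: "right_braided H \<Psi> V \<Phi>"
    and c: "mult_compat_right H m e V \<Phi>" and \<nu>: "linear_map (V \<otimes> H) V \<nu>"
    and act: "\<And>t. t \<in> carrier (V \<otimes> H \<otimes> H) \<Longrightarrow>
      \<nu> (map_id (V \<otimes> H) V H \<nu> (unassoc V H H t)) = \<nu> (id_map V (H \<otimes> H) H m t)"
    and unit: "\<And>v. v \<in> carrier V \<Longrightarrow> \<nu> (v \<otimes>\<^bsub>V,H\<^esub> e) = v"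
    and comp: "\<And>t. t \<in> carrier (V \<otimes> H \<otimes> H) \<Longrightarrow> \<Phi> (map_id (V \<otimes> H) V H \<nu> (unassoc V H H t))
      = id_map H (V \<otimes> H) V \<nu> (leg12 V H H \<Phi> (leg23 V H H \<Psi> t))"
    using M by (auto simp: braided_right_module_def agree_def)
  have u: "unital_algebra H m e" and b: "braided H \<Psi>"
    using A by (auto simp: braided_unital_algebra_def)
  note u = unital_algebraD[OF u] and \<Psi> = braidedD(2)[OF b] and V = right_braidedD(2)[OF rb] and \<Phi> = right_braidedD(3)[OF rb]
  note lb = left_braided_tinv[OF rb]
  note c' = mult_compat_tinv_right[OF u(1-3) V \<Phi> c]
  note d = mult_compat_leftD[OF c'] and yb = left_braidedD(4)[OF lb]
  note R = linear_tinv[OF u(1,1) \<Psi>] and S = linear_tinv[OF V u(1) \<Phi>]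
  note l = leg12_tinv[OF u(1,1) \<Psi> V] leg23_tinv[OF u(1,1) \<Psi> V]
    leg12_tinv[OF V u(1) \<Phi> u(1)] leg23_tinv[OF V u(1) \<Phi> u(1)]
  have \<nu>12: "map_id (V \<otimes> H) V H \<nu> (unassoc V H H t) \<in> carrier (V \<otimes> H)" if "t \<in> carrier (V \<otimes> H \<otimes> H)" for t
    using linear_mapD(1)[OF linear_map_contract12[OF V u(1,1) V \<nu>] that] by simp
  \<comment> \<open>The compatibility of braiding and action, solved for the inverse braiding.\<close>
  have comp': "?S (id_map H (V \<otimes> H) V \<nu> t)
      = map_id (V \<otimes> H) V H \<nu> (unassoc V H H (leg23 V H H ?R (leg12 H V H ?S t)))"
     (is "_ = map_id (V \<otimes> H) V H \<nu> (unassoc V H H ?t)")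
    if t: "t \<in> carrier (H \<otimes> V \<otimes> H)" for t
    using t comp[of ?t] tinv(2)[OF V u(1) \<Phi> \<nu>12, of ?t] by (simp add: l)
  note simps = contract_leg12[OF u(1) V u(1) V S \<nu>, symmetric] contract_leg23[OF u(1) V u(1) V S \<nu>, symmetric]
    contract_leg12[OF u(1,1) V u(1) R u(2), symmetric] 
  show ?thesis
    unfolding braided_left_module_def
  proof (intro conjI ballI)
    show "braided_unital_algebra H (m \<circ> ?R) e ?R" by (rule braided_unital_algebra_opposite[OF A])
    show "left_braided H ?R V ?S" by (rule lb)
    show "mult_compat_left H (m \<circ> ?R) e V ?S"
      by (rule mult_compat_left_opposite[OF u(1-3) V lb c'])
    show "linear_map (H \<otimes> V) V (\<nu> \<circ> ?S)" by (rule linear_map_comp[OF S \<nu>])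
    show "(\<nu> \<circ> ?S) (e \<otimes>\<^bsub>H,V\<^esub> v) = v" if "v \<in> carrier V" for v
      using d(2)[OF that] unit[OF that] by simp
    have key: "?S (id_map H (H \<otimes> V) V (\<nu> \<circ> ?S) t)
        = map_id (V \<otimes> H) V H \<nu> (unassoc V H H (leg12 H V H ?S (leg23 H H V ?S (leg12 H H V ?R t))))"
      if t: "t \<in> carrier (H \<otimes> H \<otimes> V)" for t
      using comp'[OF l(16)[OF t]] yb[OF t] t by (simp add: simps)
    have "?S (id_map H (H \<otimes> V) V (\<nu> \<circ> ?S) t)
        = map_id (H \<otimes> V) V H (\<nu> \<circ> ?S) (unassoc H V H (leg23 H H V ?S (leg12 H H V ?R t)))"
      if t: "t \<in> carrier (H \<otimes> H \<otimes> V)" for t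
      unfolding key[OF t] using t by (simp only: simps l)
    then show "agree (H \<otimes> H \<otimes> V) (?S \<circ> id_map H (H \<otimes> V) V (\<nu> \<circ> ?S))
        (map_id (H \<otimes> V) V H (\<nu> \<circ> ?S) \<circ> unassoc H V H \<circ> leg23 H H V ?S \<circ> leg12 H H V ?R)"
      by (simp add: agree_def)
    have "\<nu> (?S (id_map H (H \<otimes> V) V (\<nu> \<circ> ?S) t))
        = \<nu> (?S (map_id (H \<otimes> H) H V (m \<circ> ?R) (unassoc H H V t)))"
      if t: "t \<in> carrier (H \<otimes> H \<otimes> V)" for t
      unfolding key[OF t] using t by (simp add: simps l act d)
    then show "agree (H \<otimes> H \<otimes> V) (\<nu> \<circ> ?S \<circ> id_map H (H \<otimes> V) V (\<nu> \<circ> ?S))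
        (\<nu> \<circ> ?S \<circ> map_id (H \<otimes> H) H V (m \<circ> ?R) \<circ> unassoc H H V)"
      by (simp add: agree_def)
  qed
qed

section \<open>Dualising braided algebras and modules\<close>

context
  fixes P :: "('k::field, 'u::ab_group_add, 'h::ab_group_add) dual_pair"
    and e \<epsilon>
  assumes P: "pairing P" and e: "e \<in> carrier (vectors P)" and \<epsilon>: "\<epsilon> = (\<lambda>f. bracket P f e)"
begin

text \<open>Evaluation at the unit is the transpose of \<open>c \<mapsto> c e\<close>, the unit map of the algebra; hence counit
  axioms are transposes of unit axioms.\<close>

lemma counit_adjoint: "adjoint P scalars \<epsilon> (\<lambda>c. smul (vectors P) c e)"
  unfolding \<epsilon> by (rule adjoint_eval[OF P e])

lemma smul_1: "smul (vectors P) 1 e = e"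
proof -
  interpret module "smul (vectors P)" by (rule vspaceD(2)[OF pairingD(2)[OF P]])
  show ?thesis by simp
qed

lemma unit_map_pure:
  assumes "vspace V" "v \<in> carrier V"
  shows "id_map V ground (vectors P) (\<lambda>c. smul (vectors P) c e) (v \<otimes>\<^bsub>V,ground\<^esub> 1) = v \<otimes>\<^bsub>V,vectors P\<^esub> e"
    and "map_id ground (vectors P) V (\<lambda>c. smul (vectors P) c e) (1 \<otimes>\<^bsub>ground,V\<^esub> v) = e \<otimes>\<^bsub>vectors P,V\<^esub> v"
proof -
  have l: "linear_map ground (vectors P) (\<lambda>c. smul (vectors P) c e)"
    using adjointD(2)[OF counit_adjoint] by simp
  note V = vspace_ground pairingD(2)[OF P] assms(1) l
  show "id_map V ground (vectors P) (\<lambda>c. smul (vectors P) c e) (v \<otimes>\<^bsub>V,ground\<^esub> 1) = v \<otimes>\<^bsub>V,vectors P\<^esub> e"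
    using id_map_pure[OF V assms(2), of 1] by (simp add: smul_1)
  show "map_id ground (vectors P) V (\<lambda>c. smul (vectors P) c e) (1 \<otimes>\<^bsub>ground,V\<^esub> v) = e \<otimes>\<^bsub>vectors P,V\<^esub> v"
    using map_id_pure[OF V _ assms(2), of 1] by (simp add: smul_1)
qed

lemma adjoint_counit:
  assumes Q: "pairing Q"
  shows "adjoint (P \<odot> Q) (scalars \<odot> Q) (map_id (functionals P) ground (functionals Q) \<epsilon>)
      (id_map (vectors Q) ground (vectors P) (\<lambda>c. smul (vectors P) c e))"
    and "adjoint (Q \<odot> P) (Q \<odot> scalars) (id_map (functionals Q) (functionals P) ground \<epsilon>)
      (map_id ground (vectors P) (vectors Q) (\<lambda>c. smul (vectors P) c e))"
  using adjoint_map_id[OF P pairing_scalars Q counit_adjoint]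
    adjoint_id_map[OF P pairing_scalars Q counit_adjoint] by simp_all

context
  fixes m \<Delta>
  assumes \<Delta>: "adjoint P (P \<odot> P) \<Delta> m"
begin

lemma coalgebra_dual:
  assumes A: "unital_algebra (vectors P) m e"
  shows "coalgebra (functionals P) \<Delta> \<epsilon>"
proof -
  let ?U = "functionals P" and ?H = "vectors P"
  note A = unital_algebraD[OF A] and PP = pairing_tensor_pair[OF P P]
  have "agree ?U (assoc ?U ?U ?U \<circ> map_id ?U (?U \<otimes> ?U) ?U \<Delta> \<circ> \<Delta>) (id_map ?U ?U (?U \<otimes> ?U) \<Delta> \<circ> \<Delta>)"
    by (rule adjoint_agree[OF pairing_triple[OF P P P]
          adjoint_comp[OF \<Delta> adjoint_to_triple_left[OF P P P P \<Delta>]]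
          adjoint_comp[OF \<Delta> adjoint_to_triple_right[OF P P P P \<Delta>]]])
      (simp add: agree_def A(4))
  moreover have "agree ?U (lunit ?U \<circ> map_id ?U ground ?U \<epsilon> \<circ> \<Delta>) (\<lambda>x. x)"
    unfolding comp_assoc
    by (rule adjoint_agree[OF P adjoint_comp[OF
          adjoint_comp[OF \<Delta> adjoint_counit(1)[OF P]] adjoint_lunit[OF P]]
          adjoint_id])
      (simp add: agree_def A(6) unit_map_pure[OF pairingD(2)[OF P]])
  moreover have "agree ?U (runit ?U \<circ> id_map ?U ?U ground \<epsilon> \<circ> \<Delta>) (\<lambda>x. x)"
    unfolding comp_assoc
    by (rule adjoint_agree[OF P adjoint_comp[OF
          adjoint_comp[OF \<Delta> adjoint_counit(2)[OF P]] adjoint_runit[OF P]]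
          adjoint_id])
      (simp add: agree_def A(5) unit_map_pure[OF pairingD(2)[OF P]])
  ultimately show ?thesis
    using pairingD(1)[OF P] adjointD(1)[OF \<Delta>] adjointD(1)[OF counit_adjoint]
    by (simp add: coalgebra_def)
qed

context
  fixes Q :: "('k, 'w::ab_group_add, 'v::ab_group_add) dual_pair"
  assumes Q: "pairing Q"
begin

text \<open>Here \<open>S\<close> runs from \<open>H \<otimes> V\<close> to \<open>V \<otimes> H\<close> and its transpose \<open>F\<close> from \<open>U \<otimes> W\<close> to
  \<open>W \<otimes> U\<close>: both the direction and the order of the factors are reversed, so left stays left.\<close>

lemma comult_compat_left_dual:
  assumes F: "adjoint (P \<odot> Q) (Q \<odot> P) F S" and c: "mult_compat_left (vectors P) m e (vectors Q) S"
  shows "comult_compat_left (functionals P) \<Delta> \<epsilon> (functionals Q) F"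
proof -
  let ?U = "functionals P" and ?W = "functionals Q"
  note c = mult_compat_leftD[OF c]
  have "agree (functionals (P \<odot> Q)) (id_map ?W ?U (?U \<otimes> ?U) \<Delta> \<circ> F)
      (leg12 ?U ?W ?U F \<circ> (leg23 ?U ?U ?W F \<circ> (assoc ?U ?U ?W \<circ> map_id ?U (?U \<otimes> ?U) ?W \<Delta>)))"
    by (rule adjoint_agree[OF pairing_triple[OF Q P P]
          adjoint_comp[OF F adjoint_to_triple_right[OF Q P P P \<Delta>]]
          adjoint_comp[OF adjoint_comp[OF adjoint_to_triple_left[OF Q P P P \<Delta>] adjoint_leg23[OF P Q P F]]
            adjoint_leg12[OF P Q P F]]])
      (simp add: agree_def c(1))
  moreover have "agree (functionals (P \<odot> Q)) (runit ?W \<circ> (id_map ?W ?U ground \<epsilon> \<circ> F)) (lunit ?W \<circ> map_id ?U ground ?W \<epsilon>)"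
    by (rule adjoint_agree[OF Q
          adjoint_comp[OF adjoint_comp[OF F adjoint_counit(2)[OF Q]] adjoint_runit[OF Q]]
          adjoint_comp[OF adjoint_counit(1)[OF Q] adjoint_lunit[OF Q]]])
      (simp add: agree_def c(2) unit_map_pure[OF pairingD(2)[OF Q]])
  ultimately show ?thesis by (simp add: comult_compat_left_def comp_assoc)
qed

lemma comult_compat_right_dual:
  assumes F: "adjoint (Q \<odot> P) (P \<odot> Q) F S" and c: "mult_compat_right (vectors P) m e (vectors Q) S"
  shows "comult_compat_right (functionals P) \<Delta> \<epsilon> (functionals Q) F"
proof -
  let ?U = "functionals P" and ?W = "functionals Q"
  note c = mult_compat_rightD[OF c]
  have "agree (functionals (Q \<odot> P)) (assoc ?U ?U ?W \<circ> map_id ?U (?U \<otimes> ?U) ?W \<Delta> \<circ> F)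
      (leg23 ?U ?W ?U F \<circ> (leg12 ?W ?U ?U F \<circ> id_map ?W ?U (?U \<otimes> ?U) \<Delta>))"
    by (rule adjoint_agree[OF pairing_triple[OF P P Q]
          adjoint_comp[OF F adjoint_to_triple_left[OF Q P P P \<Delta>]]
          adjoint_comp[OF adjoint_comp[OF adjoint_to_triple_right[OF Q P P P \<Delta>] adjoint_leg12[OF Q P P F]]
            adjoint_leg23[OF Q P P F]]])
      (simp add: agree_def c(1))
  moreover have "agree (functionals (Q \<odot> P)) (lunit ?W \<circ> (map_id ?U ground ?W \<epsilon> \<circ> F)) (runit ?W \<circ> id_map ?W ?U ground \<epsilon>)"
    by (rule adjoint_agree[OF Q
          adjoint_comp[OF adjoint_comp[OF F adjoint_counit(1)[OF Q]] adjoint_lunit[OF Q]]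
          adjoint_comp[OF adjoint_counit(2)[OF Q] adjoint_runit[OF Q]]])
      (simp add: agree_def c(2) unit_map_pure[OF pairingD(2)[OF Q]])
  ultimately show ?thesis by (simp add: comult_compat_right_def comp_assoc)
qed

end
end
end

lemma braided_dual:
  assumes P: "pairing P" and F: "adjoint (P \<odot> P) (P \<odot> P) F R"
    and iso: "linear_iso (functionals P \<otimes> functionals P) (functionals P \<otimes> functionals P) F"
    and b: "braided (vectors P) R"
  shows "braided (functionals P) F"
proof -
  let ?U = "functionals P"
  note l12 = adjoint_leg12[OF P P P F] and l23 = adjoint_leg23[OF P P P F]
  have "agree (functionals (triple P P P)) (leg12 ?U ?U ?U F \<circ> (leg23 ?U ?U ?U F \<circ> leg12 ?U ?U ?U F))
      (leg23 ?U ?U ?U F \<circ> (leg12 ?U ?U ?U F \<circ> leg23 ?U ?U ?U F))"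
    by (rule adjoint_agree[OF pairing_triple[OF P P P] adjoint_comp[OF adjoint_comp[OF l12 l23] l12]
          adjoint_comp[OF adjoint_comp[OF l23 l12] l23]])
      (simp add: agree_def braidedD(3)[OF b])
  then show ?thesis using iso pairingD(1)[OF P] by (simp add: braided_def comp_assoc)
qed

lemma left_braided_dual:
  assumes P: "pairing P" and Q: "pairing Q" and \<Psi>: "adjoint (P \<odot> P) (P \<odot> P) \<Psi> R"
    and iso\<Psi>: "linear_iso (functionals P \<otimes> functionals P) (functionals P \<otimes> functionals P) \<Psi>"
    and F: "adjoint (P \<odot> Q) (Q \<odot> P) F S"
    and isoF: "linear_iso (functionals P \<otimes> functionals Q) (functionals Q \<otimes> functionals P) F"
    and b: "left_braided (vectors P) R (vectors Q) S"
  shows "left_braided (functionals P) \<Psi> (functionals Q) F"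
proof -
  let ?U = "functionals P" and ?W = "functionals Q"
  have "agree (functionals (triple P P Q)) (leg12 ?U ?W ?U F \<circ> (leg23 ?U ?U ?W F \<circ> leg12 ?U ?U ?W \<Psi>))
      (leg23 ?W ?U ?U \<Psi> \<circ> (leg12 ?U ?W ?U F \<circ> leg23 ?U ?U ?W F))"
    by (rule adjoint_agree[OF pairing_triple[OF Q P P]
          adjoint_comp[OF adjoint_comp[OF adjoint_leg12[OF P P Q \<Psi>] adjoint_leg23[OF P Q P F]] adjoint_leg12[OF P Q P F]]
          adjoint_comp[OF adjoint_comp[OF adjoint_leg23[OF P Q P F] adjoint_leg12[OF P Q P F]] adjoint_leg23[OF P P Q \<Psi>]]])
      (simp add: agree_def left_braidedD(4)[OF b])
  then show ?thesis
    using isoF pairingD(1)[OF Q] braided_dual[OF P \<Psi> iso\<Psi> left_braidedD(1)[OF b]]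
    by (simp add: left_braided_def comp_assoc)
qed

lemma right_braided_dual:
  assumes P: "pairing P" and Q: "pairing Q" and \<Psi>: "adjoint (P \<odot> P) (P \<odot> P) \<Psi> R"
    and iso\<Psi>: "linear_iso (functionals P \<otimes> functionals P) (functionals P \<otimes> functionals P) \<Psi>"
    and F: "adjoint (Q \<odot> P) (P \<odot> Q) F S"
    and isoF: "linear_iso (functionals Q \<otimes> functionals P) (functionals P \<otimes> functionals Q) F"
    and b: "right_braided (vectors P) R (vectors Q) S"
  shows "right_braided (functionals P) \<Psi> (functionals Q) F"
proof -
  let ?U = "functionals P" and ?W = "functionals Q"
  have "agree (functionals (triple Q P P)) (leg23 ?U ?W ?U F \<circ> (leg12 ?W ?U ?U F \<circ> leg23 ?W ?U ?U \<Psi>))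
      (leg12 ?U ?U ?W \<Psi> \<circ> (leg23 ?U ?W ?U F \<circ> leg12 ?W ?U ?U F))"
    by (rule adjoint_agree[OF pairing_triple[OF P P Q]
          adjoint_comp[OF adjoint_comp[OF adjoint_leg23[OF P P Q \<Psi>] adjoint_leg12[OF Q P P F]] adjoint_leg23[OF Q P P F]]
          adjoint_comp[OF adjoint_comp[OF adjoint_leg12[OF Q P P F] adjoint_leg23[OF Q P P F]] adjoint_leg12[OF P P Q \<Psi>]]])
      (simp add: agree_def right_braidedD(4)[OF b])
  then show ?thesis
    using isoF pairingD(1)[OF Q] braided_dual[OF P \<Psi> iso\<Psi> right_braidedD(1)[OF b]]
    by (simp add: right_braided_def comp_assoc)
qed

theorem braided_coalgebra_dual:
  assumes P: "pairing P" and A: "braided_unital_algebra (vectors P) m e R"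
    and \<Delta>: "adjoint P (P \<odot> P) \<Delta> m" and \<Psi>: "adjoint (P \<odot> P) (P \<odot> P) \<Psi> R"
    and iso: "linear_iso (functionals P \<otimes> functionals P) (functionals P \<otimes> functionals P) \<Psi>"
  shows "braided_coalgebra (functionals P) \<Delta> (\<lambda>f. bracket P f e) \<Psi>"
proof -
  have A: "unital_algebra (vectors P) m e" "braided (vectors P) R"
      "mult_compat_left (vectors P) m e (vectors P) R" "mult_compat_right (vectors P) m e (vectors P) R"
    using A by (auto simp: braided_unital_algebra_def)
  note e = unital_algebraD(3)[OF A(1)]
  show ?thesis
    using coalgebra_dual[OF P e refl \<Delta> A(1)] braided_dual[OF P \<Psi> iso A(2)]
      comult_compat_left_dual[OF P e refl \<Delta> P \<Psi> A(3)] comult_compat_right_dual[OF P e refl \<Delta> P \<Psi> A(4)]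
    by (simp add: braided_coalgebra_def)
qed

text \<open>Transposing \<open>\<nu> : V \<otimes> H \<rightarrow> V\<close> gives \<open>\<rho> : W \<rightarrow> U \<otimes> W\<close>, since the factors are reversed; so a
  right module yields a left comodule, each axiom being the transpose of the corresponding one.\<close>

theorem braided_left_comodule_dual:
  assumes P: "pairing P" and Q: "pairing Q"
    and M: "braided_right_module (vectors P) m e R (vectors Q) S \<nu>"
    and \<Delta>: "adjoint P (P \<odot> P) \<Delta> m" and \<Psi>: "adjoint (P \<odot> P) (P \<odot> P) \<Psi> R"
    and iso\<Psi>: "linear_iso (functionals P \<otimes> functionals P) (functionals P \<otimes> functionals P) \<Psi>"
    and F: "adjoint (Q \<odot> P) (P \<odot> Q) F S"
    and isoF: "linear_iso (functionals Q \<otimes> functionals P) (functionals P \<otimes> functionals Q) F"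
    and \<rho>: "adjoint Q (P \<odot> Q) \<rho> \<nu>"
  shows "braided_left_comodule (functionals P) \<Delta> (\<lambda>f. bracket P f e) \<Psi> (functionals Q) F \<rho>"
proof -
  let ?U = "functionals P" and ?W = "functionals Q" and ?\<epsilon> = "\<lambda>f. bracket P f e"
  let ?H = "vectors P" and ?V = "vectors Q"
  have A: "braided_unital_algebra ?H m e R" and rb: "right_braided ?H R ?V S"
    and c: "mult_compat_right ?H m e ?V S"
    and act: "\<And>t. t \<in> carrier (?V \<otimes> ?H \<otimes> ?H) \<Longrightarrow>
      \<nu> (map_id (?V \<otimes> ?H) ?V ?H \<nu> (unassoc ?V ?H ?H t)) = \<nu> (id_map ?V (?H \<otimes> ?H) ?H m t)"
    and unit: "\<And>v. v \<in> carrier ?V \<Longrightarrow> \<nu> (v \<otimes>\<^bsub>?V,?H\<^esub> e) = v"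
    and comp: "\<And>t. t \<in> carrier (?V \<otimes> ?H \<otimes> ?H) \<Longrightarrow> S (map_id (?V \<otimes> ?H) ?V ?H \<nu> (unassoc ?V ?H ?H t))
      = id_map ?H (?V \<otimes> ?H) ?V \<nu> (leg12 ?V ?H ?H S (leg23 ?V ?H ?H R t))"
    using M by (auto simp: braided_right_module_def agree_def)
  have e: "e \<in> carrier ?H" using A by (simp add: braided_unital_algebra_def unital_algebra_def)
  have "agree ?W (id_map ?U ?W (?U \<otimes> ?W) \<rho> \<circ> \<rho>) (assoc ?U ?U ?W \<circ> map_id ?U (?U \<otimes> ?U) ?W \<Delta> \<circ> \<rho>)"
    by (rule adjoint_agree[OF pairing_triple[OF P P Q]
          adjoint_comp[OF \<rho> adjoint_to_triple_right[OF P Q P Q \<rho>]]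
          adjoint_comp[OF \<rho> adjoint_to_triple_left[OF Q P P P \<Delta>]]])
      (simp add: agree_def act)
  moreover have "agree ?W (lunit ?W \<circ> (map_id ?U ground ?W ?\<epsilon> \<circ> \<rho>)) (\<lambda>v. v)"
    by (rule adjoint_agree[OF Q adjoint_comp[OF
          adjoint_comp[OF \<rho> adjoint_counit(1)[OF P e refl Q]] adjoint_lunit[OF Q]] adjoint_id])
      (simp add: agree_def unit unit_map_pure[OF P e refl pairingD(2)[OF Q]])
  moreover have "agree (functionals (Q \<odot> P)) (id_map ?U ?W (?U \<otimes> ?W) \<rho> \<circ> F)
      (leg12 ?U ?U ?W \<Psi> \<circ> (leg23 ?U ?W ?U F \<circ> (assoc ?U ?W ?U \<circ> map_id ?W (?U \<otimes> ?W) ?U \<rho>)))"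
    by (rule adjoint_agree[OF pairing_triple[OF P P Q]
          adjoint_comp[OF F adjoint_to_triple_right[OF P Q P Q \<rho>]]
          adjoint_comp[OF adjoint_comp[OF adjoint_to_triple_left[OF P Q P Q \<rho>] adjoint_leg23[OF Q P P F]]
            adjoint_leg12[OF P P Q \<Psi>]]])
      (simp add: agree_def comp)
  ultimately show ?thesis
    using braided_coalgebra_dual[OF P A \<Delta> \<Psi> iso\<Psi>] right_braided_dual[OF P Q \<Psi> iso\<Psi> F isoF rb]
      comult_compat_right_dual[OF P e refl \<Delta> Q F c] adjointD(1)[OF \<rho>]
    by (simp add: braided_left_comodule_def comp_assoc)
qed

theorem braided_right_comodule_dual:
  assumes P: "pairing P" and Q: "pairing Q"
    and M: "braided_left_module (vectors P) m e R (vectors Q) S \<nu>"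
    and \<Delta>: "adjoint P (P \<odot> P) \<Delta> m" and \<Psi>: "adjoint (P \<odot> P) (P \<odot> P) \<Psi> R"
    and iso\<Psi>: "linear_iso (functionals P \<otimes> functionals P) (functionals P \<otimes> functionals P) \<Psi>"
    and F: "adjoint (P \<odot> Q) (Q \<odot> P) F S"
    and isoF: "linear_iso (functionals P \<otimes> functionals Q) (functionals Q \<otimes> functionals P) F"
    and \<rho>: "adjoint Q (Q \<odot> P) \<rho> \<nu>"
  shows "braided_right_comodule (functionals P) \<Delta> (\<lambda>f. bracket P f e) \<Psi> (functionals Q) F \<rho>"
proof -
  let ?U = "functionals P" and ?W = "functionals Q" and ?\<epsilon> = "\<lambda>f. bracket P f e"
  let ?H = "vectors P" and ?V = "vectors Q"
  have A: "braided_unital_algebra ?H m e R" and lb: "left_braided ?H R ?V S"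
    and c: "mult_compat_left ?H m e ?V S"
    and act: "\<And>t. t \<in> carrier (?H \<otimes> ?H \<otimes> ?V) \<Longrightarrow>
      \<nu> (id_map ?H (?H \<otimes> ?V) ?V \<nu> t) = \<nu> (map_id (?H \<otimes> ?H) ?H ?V m (unassoc ?H ?H ?V t))"
    and unit: "\<And>v. v \<in> carrier ?V \<Longrightarrow> \<nu> (e \<otimes>\<^bsub>?H,?V\<^esub> v) = v"
    and comp: "\<And>t. t \<in> carrier (?H \<otimes> ?H \<otimes> ?V) \<Longrightarrow> S (id_map ?H (?H \<otimes> ?V) ?V \<nu> t)
      = map_id (?H \<otimes> ?V) ?V ?H \<nu> (unassoc ?H ?V ?H (leg23 ?H ?H ?V S (leg12 ?H ?H ?V R t)))"
    using M by (auto simp: braided_left_module_def agree_def)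
  have e: "e \<in> carrier ?H" using A by (simp add: braided_unital_algebra_def unital_algebra_def)
  have "agree ?W (assoc ?W ?U ?U \<circ> map_id ?W (?W \<otimes> ?U) ?U \<rho> \<circ> \<rho>) (id_map ?W ?U (?U \<otimes> ?U) \<Delta> \<circ> \<rho>)"
    by (rule adjoint_agree[OF pairing_triple[OF Q P P]
          adjoint_comp[OF \<rho> adjoint_to_triple_left[OF P Q Q P \<rho>]]
          adjoint_comp[OF \<rho> adjoint_to_triple_right[OF Q P P P \<Delta>]]])
      (simp add: agree_def act)
  moreover have "agree ?W (runit ?W \<circ> (id_map ?W ?U ground ?\<epsilon> \<circ> \<rho>)) (\<lambda>v. v)"
    by (rule adjoint_agree[OF Q adjoint_comp[OF
          adjoint_comp[OF \<rho> adjoint_counit(2)[OF P e refl Q]] adjoint_runit[OF Q]] adjoint_id])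
      (simp add: agree_def unit unit_map_pure[OF P e refl pairingD(2)[OF Q]])
  moreover have "agree (functionals (P \<odot> Q)) (assoc ?W ?U ?U \<circ> map_id ?W (?W \<otimes> ?U) ?U \<rho> \<circ> F)
      (leg23 ?W ?U ?U \<Psi> \<circ> (leg12 ?U ?W ?U F \<circ> id_map ?U ?W (?W \<otimes> ?U) \<rho>))"
    by (rule adjoint_agree[OF pairing_triple[OF Q P P]
          adjoint_comp[OF F adjoint_to_triple_left[OF P Q Q P \<rho>]]
          adjoint_comp[OF adjoint_comp[OF adjoint_to_triple_right[OF P Q Q P \<rho>] adjoint_leg12[OF P Q P F]]
            adjoint_leg23[OF P P Q \<Psi>]]])
      (simp add: agree_def comp)
  ultimately show ?thesis
    using braided_coalgebra_dual[OF P A \<Delta> \<Psi> iso\<Psi>] left_braided_dual[OF P Q \<Psi> iso\<Psi> F isoF lb]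
      comult_compat_left_dual[OF P e refl \<Delta> Q F c] adjointD(1)[OF \<rho>]
    by (simp add: braided_right_comodule_def comp_assoc)
qed

section \<open>The dual structure maps as adjoints\<close>

definition function_pair :: "('k::field, 'x \<Rightarrow> 'k) vs \<Rightarrow> ('k, 'x::ab_group_add) vs \<Rightarrow> ('k, 'x \<Rightarrow> 'k, 'x) dual_pair" where
  "function_pair U X = \<lparr>functionals = U, vectors = X, bracket = (\<lambda>f x. f x)\<rparr>"

lemma function_pair_sel [simp]:
  "functionals (function_pair U X) = U" "vectors (function_pair U X) = X"
  "bracket (function_pair U X) = (\<lambda>f x. f x)"
  by (simp_all add: function_pair_def)

lemma bilinear_evaluation:
  assumes "smul U = fscale" "carrier U \<subseteq> carrier (dual X)"
  shows "bilinear_map U X ground (\<lambda>f x. f x)"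
  using assms by (auto simp: bilinear_map_def linear_map_def dual_def fscale_def)

lemma pairing_function_pair:
  assumes X: "vspace X" and U: "nondegenerate_subspace X U"
  shows "pairing (function_pair U X)"
  unfolding pairing_def function_pair_sel
proof (intro conjI ballI impI)
  have U: "vspace U" "smul U = fscale" "carrier U \<subseteq> carrier (dual X)"
    using U by (auto simp: nondegenerate_subspace_def)
  show "vspace U" "vspace X" by fact+
  show "bilinear_map U X ground (\<lambda>f x. f x)" by (rule bilinear_evaluation[OF U(2,3)])
  show "f = 0" if "f \<in> carrier U" "\<forall>x\<in>carrier X. f x = 0" for f
    by (rule dual_eqI[of f X 0]) (use that U(3) vspaceD(3)[OF vspace_dual[of X]] in auto)
qed

lemma corestrict:
  assumes "F s \<in> E ` carrier Z"
  shows "corestrict Z E F s \<in> carrier Z" and "E (corestrict Z E F s) = F s"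
  using assms by (simp_all add: corestrict_def inv_into_into f_inv_into_f)

lemma bij_betw_corestrict:
  assumes "inj_on E (carrier Z)" "bij_onto S Z E F"
  shows "bij_betw (corestrict Z E F) (carrier S) (carrier Z)"
  unfolding corestrict_def
  using bij_betw_trans[OF _ bij_betw_inv_into[OF inj_on_imp_bij_betw[OF assms(1)]]] assms(2)
  by (simp add: bij_onto_def)

text \<open>Defining identities of maps with values in a dual space are stated for pure tensors and the untwisted
  embedding; this turns them into adjunctions for the double bracket.\<close>

lemma adjoint_dual_embed:
  assumes P0: "pairing P0" and P: "pairing P" and Q: "pairing Q"
    and G: "linear_map (vectors Q \<otimes> vectors P) (vectors P0) G"
    and F: "\<And>s. s \<in> carrier (functionals P0) \<Longrightarrow> F s \<in> carrier (functionals P \<otimes> functionals Q)"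
    and eq: "\<And>s x y. s \<in> carrier (functionals P0) \<Longrightarrow> x \<in> carrier (vectors P) \<Longrightarrow> y \<in> carrier (vectors Q) \<Longrightarrow>
      dual_embed (functionals P) (functionals Q) (vectors P) (vectors Q) (bracket P) (bracket Q) (F s)
        (x \<otimes>\<^bsub>vectors P,vectors Q\<^esub> y) = bracket P0 s (G (y \<otimes>\<^bsub>vectors Q,vectors P\<^esub> x))"
  shows "adjoint P0 (P \<odot> Q) F G"
proof -
  note PQ = pairing_tensor_pair[OF P Q]
  note V = pairingD(1)[OF P] pairingD(1)[OF Q] pairingD(2)[OF Q] pairingD(2)[OF P] pairingD(3)[OF P] pairingD(3)[OF Q]
  show ?thesis
  proof (rule adjointI[OF P0 PQ])
    show "linear_map (vectors (P \<odot> Q)) (vectors P0) G" using G by simp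
    fix s assume s: "s \<in> carrier (functionals P0)"
    note Fs = F[OF s]
    show "F s \<in> carrier (functionals (P \<odot> Q))" using Fs by simp
    fix z assume "z \<in> carrier (vectors (P \<odot> Q))"
    then have z: "z \<in> carrier (vectors Q \<otimes> vectors P)" by simp
    have l: "linear_map (vectors Q \<otimes> vectors P) ground (bracket (P \<odot> Q) (F s))"
      using bilinear_mapD(1)[OF pairingD(3)[OF PQ]] Fs by simp
    have r: "linear_map (vectors Q \<otimes> vectors P) ground (\<lambda>z. bracket P0 s (G z))"
      using linear_map_comp[OF G bilinear_mapD(1)[OF pairingD(3)[OF P0] s]] by (simp add: o_def)
    show "bracket (P \<odot> Q) (F s) z = bracket P0 s (G z)"
      by (rule tensor_ext[OF l r _ z]) (simp add: twisted_flip[OF V Fs] eq[OF s])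
  qed
qed

lemma inj_dual_embed:
  assumes P: "pairing P" and Q: "pairing Q"
  shows "inj_on (dual_embed (functionals P) (functionals Q) (vectors P) (vectors Q) (bracket P) (bracket Q))
    (carrier (functionals P \<otimes> functionals Q))"
proof (rule inj_onI)
  let ?E = "dual_embed (functionals P) (functionals Q) (vectors P) (vectors Q) (bracket P) (bracket Q)"
  note PQ = pairing_tensor_pair[OF P Q]
  note V = pairingD(1)[OF P] pairingD(1)[OF Q] pairingD(2)[OF Q] pairingD(2)[OF P] pairingD(3)[OF P] pairingD(3)[OF Q]
  fix s t assume s: "s \<in> carrier (functionals P \<otimes> functionals Q)" and t: "t \<in> carrier (functionals P \<otimes> functionals Q)"
    and eq: "?E s = ?E t"
  show "s = t"
  proof (rule pairing_eqI[OF PQ])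
    show "s \<in> carrier (functionals (P \<odot> Q))" "t \<in> carrier (functionals (P \<odot> Q))" using s t by simp_all
    then have l: "linear_map (vectors Q \<otimes> vectors P) ground (bracket (P \<odot> Q) s)"
        "linear_map (vectors Q \<otimes> vectors P) ground (bracket (P \<odot> Q) t)"
      using bilinear_mapD(1)[OF pairingD(3)[OF PQ]] by simp_all
    fix z assume "z \<in> carrier (vectors (P \<odot> Q))"
    then have z: "z \<in> carrier (vectors Q \<otimes> vectors P)" by simp
    show "bracket (P \<odot> Q) s z = bracket (P \<odot> Q) t z"
      by (rule tensor_ext[OF l _ z]) (simp add: twisted_flip[OF V s] twisted_flip[OF V t] eq)
  qed
qed

text \<open>The common shape of all dual braidings: a map into a dual space, given by pairing with \<open>G\<close> of
  the flipped test vectors, and corestricted to the image of a tensor product.  It is the transpose of \<open>G\<close>.\<close>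

lemma corestrict_adjoint:
  fixes P Q P' Q' G
  defines "E \<equiv> dual_embed (functionals P') (functionals Q') (vectors P') (vectors Q') (bracket P') (bracket Q')"
    and "D \<equiv> tlift (functionals P) (functionals Q) (dual (vectors P' \<otimes> vectors Q'))
      (\<lambda>a b. tlift (vectors P') (vectors Q') ground (\<lambda>x y.
        bracket (P \<odot> Q) (a \<otimes>\<^bsub>functionals P,functionals Q\<^esub> b) (G (y \<otimes>\<^bsub>vectors Q',vectors P'\<^esub> x))))"
  assumes P: "pairing P" and Q: "pairing Q" and P': "pairing P'" and Q': "pairing Q'"
    and G: "linear_map (vectors Q' \<otimes> vectors P') (vectors Q \<otimes> vectors P) G"
    and bij: "bij_onto (functionals P \<otimes> functionals Q) (functionals P' \<otimes> functionals Q') E D"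
  shows "adjoint (P \<odot> Q) (P' \<odot> Q') (corestrict (functionals P' \<otimes> functionals Q') E D) G" (is ?A)
    and "linear_iso (functionals P \<otimes> functionals Q) (functionals P' \<otimes> functionals Q')
      (corestrict (functionals P' \<otimes> functionals Q') E D)"
proof -
  note PQ = pairing_tensor_pair[OF P Q]
  note V = pairingD(1)[OF P] pairingD(1)[OF Q] pairingD(2)[OF P'] pairingD(2)[OF Q']
  have "bilinear_map (vectors P') (vectors Q') (vectors Q \<otimes> vectors P)
      (\<lambda>x y. G (y \<otimes>\<^bsub>vectors Q',vectors P'\<^esub> x))"
    by (rule bilinear_map_swap[OF bilinear_map_post[OF bilinear_pure_tensor[OF V(4,3)] G]])
  then have quad: "quadrilinear (functionals P) (functionals Q) (vectors P') (vectors Q')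
      (\<lambda>a b x y. bracket (P \<odot> Q) (a \<otimes>\<^bsub>functionals P,functionals Q\<^esub> b) (G (y \<otimes>\<^bsub>vectors Q',vectors P'\<^esub> x)))"
    by (rule quadrilinear_pre[OF pairingD(3)[OF PQ, unfolded tensor_pair_sel(1,2)]
          bilinear_pure_tensor[OF V(1,2)]])
  note D = tlift_dual[OF V quad, folded D_def]
  have im: "D s \<in> E ` carrier (functionals P' \<otimes> functionals Q')"
    if "s \<in> carrier (functionals P \<otimes> functionals Q)" for s
    using bij that by (auto simp: bij_onto_def bij_betw_def)
  show ?A
  proof (rule adjoint_dual_embed[OF PQ P' Q'])
    show "linear_map (vectors Q' \<otimes> vectors P') (vectors (P \<odot> Q)) G" using G by simp
    fix s assume "s \<in> carrier (functionals (P \<odot> Q))"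
    then have s: "s \<in> carrier (functionals P \<otimes> functionals Q)" by simp
    note c = corestrict[of D s E, OF im[OF s]]
    show "corestrict (functionals P' \<otimes> functionals Q') E D s \<in> carrier (functionals P' \<otimes> functionals Q')" by (rule c(1))
    fix x y assume xy: "x \<in> carrier (vectors P')" "y \<in> carrier (vectors Q')"
    have g: "G (y \<otimes>\<^bsub>vectors Q',vectors P'\<^esub> x) \<in> carrier (vectors (P \<odot> Q))"
      using linear_mapD(1)[OF G pure_in_tensor[OF xy(2,1)]] by simp
    have "D s (x \<otimes>\<^bsub>vectors P',vectors Q'\<^esub> y) = bracket (P \<odot> Q) s (G (y \<otimes>\<^bsub>vectors Q',vectors P'\<^esub> x))"
      by (rule tensor_ext[OF bilinear_mapD(2)[OF D(2) pure_in_tensor[OF xy]]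
          bilinear_mapD(2)[OF pairingD(3)[OF PQ] g, unfolded tensor_pair_sel(1)] _ s])
        (simp add: D(3) xy)
    then show "dual_embed (functionals P') (functionals Q') (vectors P') (vectors Q') (bracket P') (bracket Q')
        (corestrict (functionals P' \<otimes> functionals Q') E D s) (x \<otimes>\<^bsub>vectors P',vectors Q'\<^esub> y)
        = bracket (P \<odot> Q) s (G (y \<otimes>\<^bsub>vectors Q',vectors P'\<^esub> x))"
      using c(2) by (simp add: E_def)
  qed
  then show "linear_iso (functionals P \<otimes> functionals Q) (functionals P' \<otimes> functionals Q')
      (corestrict (functionals P' \<otimes> functionals Q') E D)"
    using adjointD(1) bij_betw_corestrict[OF inj_dual_embed[OF P' Q', folded E_def] bij]
    by (fastforce simp: linear_iso_def)
qed

context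
  fixes H :: "('k::field, 'h::ab_group_add) vs" and U :: "('k, 'h \<Rightarrow> 'k) vs" and m e \<Psi>
  assumes A: "braided_unital_algebra H m e \<Psi>" and U: "nondegenerate_subspace H U"
begin

lemma algebra_components: "vspace H" "linear_map (H \<otimes> H) H m" "linear_iso (H \<otimes> H) (H \<otimes> H) \<Psi>"
  using A by (auto simp: braided_unital_algebra_def unital_algebra_def braided_def)

lemma pairing_UH: "pairing (function_pair U H)"
  by (rule pairing_function_pair[OF algebra_components(1) U])

lemma PsiUU_adjoint:
  assumes "PsiUU_bij H \<Psi> U"
  shows "adjoint (function_pair U H \<odot> function_pair U H) (function_pair U H \<odot> function_pair U H)
      (PsiUU H \<Psi> U) \<Psi>"
    and "linear_iso (U \<otimes> U) (U \<otimes> U) (PsiUU H \<Psi> U)"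
  using corestrict_adjoint[OF pairing_UH pairing_UH pairing_UH pairing_UH, of \<Psi>] linear_isoD[OF algebra_components(3)] assms
  by (simp_all add: PsiUU_bij_def PsiUU_def PsiUU_emb_def PsiUU_dual_def)

lemma tinv_PsiUU_adjoint:
  assumes "PsiUU_bij H \<Psi> U"
  shows "adjoint (function_pair U H \<odot> function_pair U H) (function_pair U H \<odot> function_pair U H)
      (tinv U U (PsiUU H \<Psi> U)) (tinv H H \<Psi>)"
    and "linear_iso (U \<otimes> U) (U \<otimes> U) (tinv U U (PsiUU H \<Psi> U))"
proof -
  note p = pairing_tensor_pair[OF pairing_UH pairing_UH] and a = PsiUU_adjoint[OF assms]
  show "adjoint (function_pair U H \<odot> function_pair U H) (function_pair U H \<odot> function_pair U H)
      (tinv U U (PsiUU H \<Psi> U)) (tinv H H \<Psi>)"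
    using adjoint_inverse[OF p p a(1)] a(2) algebra_components(3) by (simp add: tinv_def)
  show "linear_iso (U \<otimes> U) (U \<otimes> U) (tinv U U (PsiUU H \<Psi> U))"
    using linear_iso_inv(1)[OF vspace_tensor a(2)] by (simp add: tinv_def)
qed

text \<open>The representing tensor is unique by nondegeneracy of the double bracket, so that the description
  operator in \<open>Delta_circ\<close> is well defined.\<close>

lemma Delta_circ_adjoint:
  assumes ex: "\<And>f. f \<in> carrier U \<Longrightarrow> \<exists>t. is_Delta_circ H m \<Psi> U f t"
  shows "adjoint (function_pair U H) (function_pair U H \<odot> function_pair U H)
    (Delta_circ H m \<Psi> U) (m \<circ> tinv H H \<Psi>)"
proof -
  let ?P = "function_pair U H"
  note p = pairing_tensor_pair[OF pairing_UH pairing_UH]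
  have G: "linear_map (H \<otimes> H) H (m \<circ> tinv H H \<Psi>)"
    by (rule linear_map_comp[OF linear_tinv[OF algebra_components(1,1,3)] algebra_components(2)])
  have rep: "bracket (?P \<odot> ?P) t z = f ((m \<circ> tinv H H \<Psi>) z)"
    if t: "is_Delta_circ H m \<Psi> U f t" and f: "f \<in> carrier U" and z: "z \<in> carrier (H \<otimes> H)" for f t z
  proof -
    have tU: "t \<in> carrier (functionals (?P \<odot> ?P))" using t by (simp add: is_Delta_circ_def)
    have l: "linear_map (H \<otimes> H) ground (bracket (?P \<odot> ?P) t)"
      using bilinear_mapD(1)[OF pairingD(3)[OF p] tU] by simp
    have r: "linear_map (H \<otimes> H) ground (\<lambda>z. f ((m \<circ> tinv H H \<Psi>) z))"
      using linear_map_comp[OF G bilinear_mapD(1)[OF pairingD(3)[OF pairing_UH, unfolded function_pair_sel] f]] by (simp add: o_def)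
    show ?thesis
      by (rule tensor_ext[OF l r _ z]) (use t in \<open>simp add: is_Delta_circ_def\<close>)
  qed
  have D: "is_Delta_circ H m \<Psi> U f (Delta_circ H m \<Psi> U f)" if f: "f \<in> carrier U" for f
  proof -
    obtain t where t: "is_Delta_circ H m \<Psi> U f t" using ex[OF f] by blast
    moreover have "s = t" if s: "is_Delta_circ H m \<Psi> U f s" for s
    proof (rule pairing_eqI[OF p])
      show "s \<in> carrier (functionals (?P \<odot> ?P))" "t \<in> carrier (functionals (?P \<odot> ?P))"
        using s t by (simp_all add: is_Delta_circ_def)
      show "bracket (?P \<odot> ?P) s z = bracket (?P \<odot> ?P) t z" if "z \<in> carrier (vectors (?P \<odot> ?P))" for z
        using rep[OF s f] rep[OF t f] that by simp
    qed
    ultimately have "\<exists>!t. is_Delta_circ H m \<Psi> U f t" by blast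
    from theI'[OF this] show ?thesis by (simp add: Delta_circ_def)
  qed
  show ?thesis
  proof (rule adjointI[OF pairing_UH p])
    show "linear_map (vectors (?P \<odot> ?P)) (vectors ?P) (m \<circ> tinv H H \<Psi>)" using G by simp
    show "Delta_circ H m \<Psi> U f \<in> carrier (functionals (?P \<odot> ?P))" if "f \<in> carrier (functionals ?P)" for f
      using D[of f] that by (simp add: is_Delta_circ_def)
    show "bracket (?P \<odot> ?P) (Delta_circ H m \<Psi> U f) z = bracket ?P f ((m \<circ> tinv H H \<Psi>) z)"
      if "f \<in> carrier (functionals ?P)" "z \<in> carrier (vectors (?P \<odot> ?P))" for f z
      using rep[OF D, of f z] that by simp
  qed
qed

end

context
  fixes H :: "('k::field, 'h::ab_group_add) vs" and U :: "('k, 'h \<Rightarrow> 'k) vs"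
    and V :: "('k, 'v::ab_group_add) vs" and W :: "('k, 'v \<Rightarrow> 'k) vs"
  assumes H: "vspace H" and V: "vspace V" and U: "nondegenerate_subspace H U" and W: "nondegenerate_subspace V W"
begin

lemma evaluation_forms: "vspace U" "carrier U \<subseteq> carrier (dual H)" "vspace W" "carrier W \<subseteq> carrier (dual V)"
  "bilinear_map U H ground (\<lambda>f a. f a)" "bilinear_map W V ground (\<lambda>f v. f v)"
  "bilinear_map (dual V) V ground (\<lambda>f v. f v)"
  using U W bilinear_evaluation[of U H] bilinear_evaluation[of W V] bilinear_evaluation[of "dual V" V]
  by (auto simp: nondegenerate_subspace_def)

lemmas coevaluation_forms = evaluation_forms(5-7)[THEN bilinear_map_swap]

text \<open>The bullet braiding is defined through the \<open>\<circ>\<close>-braiding of \<open>U\<close> and \<open>V\<close>.  The two dualisations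
  cancel: pairing \<open>a \<otimes> e\<close> with the tensor \<open>\<Psi>\<^sup>\<circ>(f \<otimes> v)\<close> is evaluating the functional which that
  tensor represents at \<open>e \<otimes> a\<close>, and this is \<open>\<langle>\<langle>e \<otimes> f, \<Psi>\<^sup>-\<^sup>1(v \<otimes> a)\<rangle>\<rangle>\<close> by definition.\<close>

lemma PsiWU_bullet_dual_eq:
  assumes \<Phi>: "linear_iso (H \<otimes> V) (V \<otimes> H) \<Phi>" and bij: "PsiUV_circ_bij H V \<Phi> U"
  shows "PsiWU_bullet_dual H V \<Phi> U W = tlift W U (dual (H \<otimes> V)) (\<lambda>e f. tlift H V ground (\<lambda>a v.
    twisted W U H V ev ev (e \<otimes>\<^bsub>W,U\<^esub> f) (tinv H V \<Phi> (v \<otimes>\<^bsub>V,H\<^esub> a))))"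
  unfolding PsiWU_bullet_dual_def
proof (intro tlift_cong)
  fix e f a v assume e: "e \<in> carrier W" and f: "f \<in> carrier U" and a: "a \<in> carrier H" and v: "v \<in> carrier V"
  let ?S = "tinv H V \<Phi>" and ?t = "PsiUV_circ H V \<Phi> U (f \<otimes>\<^bsub>U,V\<^esub> v)"
  note S = linear_tinv[OF H V \<Phi>]
  have e': "e \<in> carrier (dual V)" using e evaluation_forms(4) by blast
  note fv = pure_in_tensor[OF f v] and z = linear_mapD(1)[OF S pure_in_tensor[OF v a]]
  have im: "PsiUV_circ_dual H V \<Phi> U (f \<otimes>\<^bsub>U,V\<^esub> v) \<in> PsiUV_circ_emb H V U ` carrier (V \<otimes> U)"
    using bij fv by (auto simp: PsiUV_circ_bij_def bij_onto_def bij_betw_def)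
  note c = corestrict[where F = "PsiUV_circ_dual H V \<Phi> U", OF im, folded PsiUV_circ_def]
  note tw = twisted[OF H evaluation_forms(3) V evaluation_forms(1) coevaluation_forms(1) evaluation_forms(6)] and de = dual_embed[OF V evaluation_forms(1) vspace_dual H coevaluation_forms(3) evaluation_forms(5)]
    and tw' = twisted[OF vspace_dual evaluation_forms(1) H V evaluation_forms(7,5)] and tw'' = twisted[OF evaluation_forms(3,1) H V evaluation_forms(6,5)]
  note quad = quadrilinear_mixed(1)[OF tw'(1) bilinear_pure_tensor[OF vspace_dual evaluation_forms(1)]
      bilinear_map_post[OF bilinear_pure_tensor[OF V H] S]]
  have "twisted H W V U coev ev (a \<otimes>\<^bsub>H,W\<^esub> e) ?t
      = dual_embed V U (dual V) H coev ev ?t (e \<otimes>\<^bsub>dual V,H\<^esub> a)"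
    by (rule tensor_ext[OF bilinear_mapD(1)[OF tw(1) pure_in_tensor[OF a e]]
          bilinear_mapD(2)[OF de(1) pure_in_tensor[OF e' a]] _ c(1)])
      (simp add: tw(2) de(2) a e e')
  also have "\<dots> = PsiUV_circ_dual H V \<Phi> U (f \<otimes>\<^bsub>U,V\<^esub> v) (e \<otimes>\<^bsub>dual V,H\<^esub> a)"
    using c(2) by (simp add: PsiUV_circ_emb_def)
  also have "\<dots> = twisted (dual V) U H V ev ev (e \<otimes>\<^bsub>dual V,U\<^esub> f) (?S (v \<otimes>\<^bsub>V,H\<^esub> a))"
    using tlift_dual_pure[OF evaluation_forms(1) V vspace_dual H quad f v e' a] by (simp add: PsiUV_circ_dual_def)
  also have "\<dots> = twisted W U H V ev ev (e \<otimes>\<^bsub>W,U\<^esub> f) (?S (v \<otimes>\<^bsub>V,H\<^esub> a))"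
    by (rule tensor_ext[OF bilinear_mapD(1)[OF tw'(1) pure_in_tensor[OF e' f]]
          bilinear_mapD(1)[OF tw''(1) pure_in_tensor[OF e f]] _ z])
      (simp add: tw'(2) tw''(2) e e' f)
  finally show "twisted H W V U coev ev (a \<otimes>\<^bsub>H,W\<^esub> e) ?t
      = twisted W U H V ev ev (e \<otimes>\<^bsub>W,U\<^esub> f) (?S (v \<otimes>\<^bsub>V,H\<^esub> a))" .
qed

lemma PsiUW_bullet_dual_eq:
  assumes \<Phi>: "linear_iso (V \<otimes> H) (H \<otimes> V) \<Phi>" and bij: "PsiVU_circ_bij H V \<Phi> U"
  shows "PsiUW_bullet_dual H V \<Phi> U W = tlift U W (dual (V \<otimes> H)) (\<lambda>f e. tlift V H ground (\<lambda>v a.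
    twisted U W V H ev ev (f \<otimes>\<^bsub>U,W\<^esub> e) (tinv V H \<Phi> (a \<otimes>\<^bsub>H,V\<^esub> v))))"
  unfolding PsiUW_bullet_dual_def
proof (intro tlift_cong)
  fix f e v a assume f: "f \<in> carrier U" and e: "e \<in> carrier W" and v: "v \<in> carrier V" and a: "a \<in> carrier H"
  let ?S = "tinv V H \<Phi>" and ?t = "PsiVU_circ H V \<Phi> U (v \<otimes>\<^bsub>V,U\<^esub> f)"
  note S = linear_tinv[OF V H \<Phi>]
  have e': "e \<in> carrier (dual V)" using e evaluation_forms(4) by blast
  note vf = pure_in_tensor[OF v f] and z = linear_mapD(1)[OF S pure_in_tensor[OF a v]]
  have im: "PsiVU_circ_dual H V \<Phi> U (v \<otimes>\<^bsub>V,U\<^esub> f) \<in> PsiVU_circ_emb H V U ` carrier (U \<otimes> V)"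
    using bij vf by (auto simp: PsiVU_circ_bij_def bij_onto_def bij_betw_def)
  note c = corestrict[where F = "PsiVU_circ_dual H V \<Phi> U", OF im, folded PsiVU_circ_def]
  note tw = twisted[OF evaluation_forms(3) H evaluation_forms(1) V evaluation_forms(6) coevaluation_forms(1)] and de = dual_embed[OF evaluation_forms(1) V H vspace_dual evaluation_forms(5) coevaluation_forms(3)]
    and tw' = twisted[OF evaluation_forms(1) vspace_dual V H evaluation_forms(5,7)] and tw'' = twisted[OF evaluation_forms(1,3) V H evaluation_forms(5,6)]
  note quad = quadrilinear_mixed(2)[OF tw'(1) bilinear_map_swap[OF bilinear_pure_tensor[OF evaluation_forms(1) vspace_dual]]
      bilinear_map_swap[OF bilinear_map_post[OF bilinear_pure_tensor[OF H V] S]]]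
  have "twisted W H U V ev coev (e \<otimes>\<^bsub>W,H\<^esub> a) ?t
      = dual_embed U V H (dual V) ev coev ?t (a \<otimes>\<^bsub>H,dual V\<^esub> e)"
    by (rule tensor_ext[OF bilinear_mapD(1)[OF tw(1) pure_in_tensor[OF e a]]
          bilinear_mapD(2)[OF de(1) pure_in_tensor[OF a e']] _ c(1)])
      (simp add: tw(2) de(2) a e e')
  also have "\<dots> = PsiVU_circ_dual H V \<Phi> U (v \<otimes>\<^bsub>V,U\<^esub> f) (a \<otimes>\<^bsub>H,dual V\<^esub> e)"
    using c(2) by (simp add: PsiVU_circ_emb_def)
  also have "\<dots> = twisted U (dual V) V H ev ev (f \<otimes>\<^bsub>U,dual V\<^esub> e) (?S (a \<otimes>\<^bsub>H,V\<^esub> v))"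
    using tlift_dual_pure[OF V evaluation_forms(1) H vspace_dual quad v f a e'] by (simp add: PsiVU_circ_dual_def)
  also have "\<dots> = twisted U W V H ev ev (f \<otimes>\<^bsub>U,W\<^esub> e) (?S (a \<otimes>\<^bsub>H,V\<^esub> v))"
    by (rule tensor_ext[OF bilinear_mapD(1)[OF tw'(1) pure_in_tensor[OF f e']]
          bilinear_mapD(1)[OF tw''(1) pure_in_tensor[OF f e]] _ z])
      (simp add: tw'(2) tw''(2) e e' f)
  finally show "twisted W H U V ev coev (e \<otimes>\<^bsub>W,H\<^esub> a) ?t
      = twisted U W V H ev ev (f \<otimes>\<^bsub>U,W\<^esub> e) (?S (a \<otimes>\<^bsub>H,V\<^esub> v))" .
qed

lemma pairing_UH_WV: "pairing (function_pair U H)" "pairing (function_pair W V)"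
  using pairing_function_pair H V U W by auto

lemma PsiWU_bullet_adjoint:
  assumes \<Phi>: "linear_iso (H \<otimes> V) (V \<otimes> H) \<Phi>"
    and bij: "PsiUV_circ_bij H V \<Phi> U" "PsiWU_bullet_bij H V \<Phi> U W"
  shows "adjoint (function_pair W V \<odot> function_pair U H) (function_pair U H \<odot> function_pair W V)
      (PsiWU_bullet H V \<Phi> U W) (tinv H V \<Phi>)"
    and "linear_iso (W \<otimes> U) (U \<otimes> W) (PsiWU_bullet H V \<Phi> U W)"
  using corestrict_adjoint[OF pairing_UH_WV(2,1,1,2), of "tinv H V \<Phi>"] linear_tinv[OF H V \<Phi>] bij(2)
  by (simp_all add: PsiWU_bullet_bij_def PsiWU_bullet_def PsiWU_bullet_emb_def
      PsiWU_bullet_dual_eq[OF \<Phi> bij(1)])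

lemma PsiUW_bullet_adjoint:
  assumes \<Phi>: "linear_iso (V \<otimes> H) (H \<otimes> V) \<Phi>"
    and bij: "PsiVU_circ_bij H V \<Phi> U" "PsiUW_bullet_bij H V \<Phi> U W"
  shows "adjoint (function_pair U H \<odot> function_pair W V) (function_pair W V \<odot> function_pair U H)
      (PsiUW_bullet H V \<Phi> U W) (tinv V H \<Phi>)"
    and "linear_iso (U \<otimes> W) (W \<otimes> U) (PsiUW_bullet H V \<Phi> U W)"
  using corestrict_adjoint[OF pairing_UH_WV(1,2,2,1), of "tinv V H \<Phi>"] linear_tinv[OF V H \<Phi>] bij(2)
  by (simp_all add: PsiUW_bullet_bij_def PsiUW_bullet_def PsiUW_bullet_emb_def
      PsiUW_bullet_dual_eq[OF \<Phi> bij(1)])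

lemma rhoL_adjoint:
  assumes \<Phi>: "linear_iso (H \<otimes> V) (V \<otimes> H) \<Phi>" and \<nu>: "linear_map (H \<otimes> V) V \<nu>"
    and im: "rhoL_dual H V \<Phi> \<nu> ` carrier W \<subseteq> dual_embed U W H V ev ev ` carrier (U \<otimes> W)"
  shows "adjoint (function_pair W V) (function_pair U H \<odot> function_pair W V)
    (rhoL H V \<Phi> \<nu> U W) (\<nu> \<circ> tinv H V \<Phi>)"
proof (rule adjoint_dual_embed[OF pairing_UH_WV(2,1,2)])
  have G: "linear_map (V \<otimes> H) V (\<nu> \<circ> tinv H V \<Phi>)" by (rule linear_map_comp[OF linear_tinv[OF H V \<Phi>] \<nu>])
  then show "linear_map (vectors (function_pair W V) \<otimes> vectors (function_pair U H)) (vectors (function_pair W V))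
    (\<nu> \<circ> tinv H V \<Phi>)" by simp
  fix e assume "e \<in> carrier (functionals (function_pair W V))"
  then have e: "e \<in> carrier W" by simp
  then have "rhoL_dual H V \<Phi> \<nu> e \<in> dual_embed U W H V ev ev ` carrier (U \<otimes> W)" using im by blast
  note c = corestrict[where F = "rhoL_dual H V \<Phi> \<nu>", OF this, folded rhoL_def]
  then show "rhoL H V \<Phi> \<nu> U W e \<in> carrier (functionals (function_pair U H) \<otimes> functionals (function_pair W V))" by simp
  have b: "bilinear_map H V ground (\<lambda>a v. e ((\<nu> \<circ> tinv H V \<Phi>) (v \<otimes>\<^bsub>V,H\<^esub> a)))"
    using bilinear_map_swap[OF bilinear_map_post[OF bilinear_map_post[OF bilinear_pure_tensor[OF V H] G]
        bilinear_mapD(1)[OF evaluation_forms(6) e]]] .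
  fix a v assume "a \<in> carrier (vectors (function_pair U H))" "v \<in> carrier (vectors (function_pair W V))"
  then show "dual_embed (functionals (function_pair U H)) (functionals (function_pair W V))
      (vectors (function_pair U H)) (vectors (function_pair W V))
      (bracket (function_pair U H)) (bracket (function_pair W V)) (rhoL H V \<Phi> \<nu> U W e)
      (a \<otimes>\<^bsub>vectors (function_pair U H),vectors (function_pair W V)\<^esub> v)
    = bracket (function_pair W V) e ((\<nu> \<circ> tinv H V \<Phi>) (v \<otimes>\<^bsub>vectors (function_pair W V),vectors (function_pair U H)\<^esub> a))"
    using tlift_pure[OF H V vspace_ground b] c(2) by (simp add: rhoL_dual_def)
qed

lemma rhoR_adjoint:
  assumes \<Phi>: "linear_iso (V \<otimes> H) (H \<otimes> V) \<Phi>" and \<nu>: "linear_map (V \<otimes> H) V \<nu>"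
    and im: "rhoR_dual H V \<Phi> \<nu> ` carrier W \<subseteq> dual_embed W U V H ev ev ` carrier (W \<otimes> U)"
  shows "adjoint (function_pair W V) (function_pair W V \<odot> function_pair U H)
    (rhoR H V \<Phi> \<nu> U W) (\<nu> \<circ> tinv V H \<Phi>)"
proof (rule adjoint_dual_embed[OF pairing_UH_WV(2,2,1)])
  have G: "linear_map (H \<otimes> V) V (\<nu> \<circ> tinv V H \<Phi>)" by (rule linear_map_comp[OF linear_tinv[OF V H \<Phi>] \<nu>])
  then show "linear_map (vectors (function_pair U H) \<otimes> vectors (function_pair W V)) (vectors (function_pair W V))
    (\<nu> \<circ> tinv V H \<Phi>)" by simp
  fix e assume "e \<in> carrier (functionals (function_pair W V))"
  then have e: "e \<in> carrier W" by simp
  then have "rhoR_dual H V \<Phi> \<nu> e \<in> dual_embed W U V H ev ev ` carrier (W \<otimes> U)" using im by blast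
  note c = corestrict[where F = "rhoR_dual H V \<Phi> \<nu>", OF this, folded rhoR_def]
  then show "rhoR H V \<Phi> \<nu> U W e \<in> carrier (functionals (function_pair W V) \<otimes> functionals (function_pair U H))" by simp
  have b: "bilinear_map V H ground (\<lambda>v a. e ((\<nu> \<circ> tinv V H \<Phi>) (a \<otimes>\<^bsub>H,V\<^esub> v)))"
    using bilinear_map_swap[OF bilinear_map_post[OF bilinear_map_post[OF bilinear_pure_tensor[OF H V] G]
        bilinear_mapD(1)[OF evaluation_forms(6) e]]] .
  fix v a assume "v \<in> carrier (vectors (function_pair W V))" "a \<in> carrier (vectors (function_pair U H))"
  then show "dual_embed (functionals (function_pair W V)) (functionals (function_pair U H))
      (vectors (function_pair W V)) (vectors (function_pair U H))
      (bracket (function_pair W V)) (bracket (function_pair U H)) (rhoR H V \<Phi> \<nu> U W e)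
      (v \<otimes>\<^bsub>vectors (function_pair W V),vectors (function_pair U H)\<^esub> a)
    = bracket (function_pair W V) e ((\<nu> \<circ> tinv V H \<Phi>) (a \<otimes>\<^bsub>vectors (function_pair U H),vectors (function_pair W V)\<^esub> v))"
    using tlift_pure[OF V H vspace_ground b] c(2) by (simp add: rhoR_dual_def)
qed

end

theorem proposition5p9:
  fixes H :: "('k::field, 'h::ab_group_add) vs" and V :: "('k, 'v::ab_group_add) vs"
    and U :: "('k, 'h \<Rightarrow> 'k) vs" and W :: "('k, 'v \<Rightarrow> 'k) vs"
  shows
    "(\<forall>m e \<Psi>HH \<Psi>HV \<nu>L.
        braided_unital_algebra H m e \<Psi>HH \<longrightarrow>
        braided_left_module H m e \<Psi>HH V \<Psi>HV \<nu>L \<longrightarrow>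
        nondegenerate_subspace H U \<longrightarrow> nondegenerate_subspace V W \<longrightarrow>
        PsiUU_bij H \<Psi>HH U \<longrightarrow> PsiHW_circ_bij H V \<Psi>HV W \<longrightarrow>
        PsiUV_circ_bij H V \<Psi>HV U \<longrightarrow> PsiWU_bullet_bij H V \<Psi>HV U W \<longrightarrow>
        (\<forall>f\<in>carrier U. \<exists>t. is_Delta_circ H m \<Psi>HH U f t) \<longrightarrow>
        rhoL_dual H V \<Psi>HV \<nu>L ` carrier W \<subseteq> dual_embed U W H V ev ev ` carrier (U \<otimes> W) \<longrightarrow>
        braided_left_comodule U (Delta_circ H m \<Psi>HH U) (\<lambda>f. f e) (tinv U U (PsiUU H \<Psi>HH U))
          W (PsiWU_bullet H V \<Psi>HV U W) (rhoL H V \<Psi>HV \<nu>L U W)) \<and>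
     (\<forall>m e \<Psi>HH \<Psi>VH \<nu>R.
        braided_unital_algebra H m e \<Psi>HH \<longrightarrow>
        braided_right_module H m e \<Psi>HH V \<Psi>VH \<nu>R \<longrightarrow>
        nondegenerate_subspace H U \<longrightarrow> nondegenerate_subspace V W \<longrightarrow>
        PsiUU_bij H \<Psi>HH U \<longrightarrow> PsiWH_circ_bij H V \<Psi>VH W \<longrightarrow>
        PsiVU_circ_bij H V \<Psi>VH U \<longrightarrow> PsiUW_bullet_bij H V \<Psi>VH U W \<longrightarrow>
        (\<forall>f\<in>carrier U. \<exists>t. is_Delta_circ H m \<Psi>HH U f t) \<longrightarrow>
        rhoR_dual H V \<Psi>VH \<nu>R ` carrier W \<subseteq> dual_embed W U V H ev ev ` carrier (W \<otimes> U) \<longrightarrow>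
        braided_right_comodule U (Delta_circ H m \<Psi>HH U) (\<lambda>f. f e) (tinv U U (PsiUU H \<Psi>HH U))
          W (PsiUW_bullet H V \<Psi>VH U W) (rhoR H V \<Psi>VH \<nu>R U W))"
proof (intro conjI allI impI)
  fix m e \<Psi>HH \<Psi>HV \<nu>L
  assume A: "braided_unital_algebra H m e \<Psi>HH"
    and M: "braided_left_module H m e \<Psi>HH V \<Psi>HV \<nu>L"
    and U: "nondegenerate_subspace H U" and W: "nondegenerate_subspace V W"
    and bUU: "PsiUU_bij H \<Psi>HH U" and bUV: "PsiUV_circ_bij H V \<Psi>HV U"
    and bWU: "PsiWU_bullet_bij H V \<Psi>HV U W"
    and \<Delta>: "\<forall>f\<in>carrier U. \<exists>t. is_Delta_circ H m \<Psi>HH U f t"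
    and \<rho>: "rhoL_dual H V \<Psi>HV \<nu>L ` carrier W \<subseteq> dual_embed U W H V ev ev ` carrier (U \<otimes> W)"
  have V: "vspace H" "vspace V" "linear_iso (H \<otimes> V) (V \<otimes> H) \<Psi>HV" "linear_map (H \<otimes> V) V \<nu>L"
    using M by (auto simp: braided_left_module_def left_braided_def braided_def)
  note UW = V(1,2) U W
  show "braided_left_comodule U (Delta_circ H m \<Psi>HH U) (\<lambda>f. f e) (tinv U U (PsiUU H \<Psi>HH U))
      W (PsiWU_bullet H V \<Psi>HV U W) (rhoL H V \<Psi>HV \<nu>L U W)"
    using braided_left_comodule_dual[OF pairing_UH_WV[OF UW], simplified, OF braided_right_module_opposite[OF M]
        Delta_circ_adjoint[OF A U] tinv_PsiUU_adjoint[OF A U bUU]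
        PsiWU_bullet_adjoint[OF UW V(3) bUV bWU] rhoL_adjoint[OF UW V(3,4) \<rho>]] \<Delta> by blast
next
  fix m e \<Psi>HH \<Psi>VH \<nu>R
  assume A: "braided_unital_algebra H m e \<Psi>HH"
    and M: "braided_right_module H m e \<Psi>HH V \<Psi>VH \<nu>R"
    and U: "nondegenerate_subspace H U" and W: "nondegenerate_subspace V W"
    and bUU: "PsiUU_bij H \<Psi>HH U" and bVU: "PsiVU_circ_bij H V \<Psi>VH U"
    and bUW: "PsiUW_bullet_bij H V \<Psi>VH U W"
    and \<Delta>: "\<forall>f\<in>carrier U. \<exists>t. is_Delta_circ H m \<Psi>HH U f t"
    and \<rho>: "rhoR_dual H V \<Psi>VH \<nu>R ` carrier W \<subseteq> dual_embed W U V H ev ev ` carrier (W \<otimes> U)"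
  have V: "vspace H" "vspace V" "linear_iso (V \<otimes> H) (H \<otimes> V) \<Psi>VH" "linear_map (V \<otimes> H) V \<nu>R"
    using M by (auto simp: braided_right_module_def right_braided_def braided_def)
  note UW = V(1,2) U W
  show "braided_right_comodule U (Delta_circ H m \<Psi>HH U) (\<lambda>f. f e) (tinv U U (PsiUU H \<Psi>HH U))
      W (PsiUW_bullet H V \<Psi>VH U W) (rhoR H V \<Psi>VH \<nu>R U W)"
    using braided_right_comodule_dual[OF pairing_UH_WV[OF UW], simplified, OF braided_left_module_opposite[OF M]
        Delta_circ_adjoint[OF A U] tinv_PsiUU_adjoint[OF A U bUU]
        PsiUW_bullet_adjoint[OF UW V(3) bVU bUW] rhoR_adjoint[OF UW V(3,4) \<rho>]] \<Delta> by blast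
qed

end
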